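(* Let $X=(x_1,\ldots,x_N)$ be a list of vectors spanning $U\cong\mathbb{R}^r$. Then the set $$\{\det(B)\,R^B_{X\setminus E(B)} : B\in\mathbb{B}(X)\}$$ is a basis of the Dahmen–Micchelli space $\mathcal{D}(X)$, and this basis is dual to the basis $\{Q_B : B\in\mathbb{B}(X)\}$ of $\mathcal{P}(X)$ under the pairing $\langle\cdot,\cdot\rangle$, i.e. $\langle Q_B,\det(D)R^D_{X\setminus E(D)}\rangle=\delta_{B,D}$ for all $B,D\in\mathbb{B}(X)$ (where both bases are constructed with the same order on $X$).
   Context: $U$ is a real vector space of dimension $r$ with a fixed basis $(s_1,\ldots,s_r)$, used to identify $U$ with $\mathbb{R}^r$ (Lebesgue measure and determinants $\det(B)$ of $r$-tuples of vectors are taken with respect to it). $V=U^*$ with dual basis $(t_1,\ldots,t_r)$; $\mathrm{Sym}(U)=\mathbb{R}[s_1,\ldots,s_r]$ and $\mathrm{Sym}(V)=\mathbb{R}[t_1,\ldots,t_r]$, the latter viewed as polynomial functions on $U$. For $u=\sum\lambda_is_i\in U$ let $p_u=\sum\lambda_is_i\in\mathrm{Sym}(U)$, and for a list $Y$ let $p_Y=\prod_{y\in Y}p_y$ ($p_\emptyset=1$). Pairing: $\langle p,f\rangle=\big(p(\partial/\partial t_1,\ldots,\partial/\partial t_r)f\big)(0)$ for $p\in\mathrm{Sym}(U)$, $f\in\mathrm{Sym}(V)$; so $p_u$ acts as the directional derivative $D_u$, and $D_Y=\prod_{y\in Y}D_y$. Lists: $X$ is ordered by $x_i<x_j$ iff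 $i<j$; sublists are determined by positions (equal vectors at different positions are different elements), and $X\setminus Y$ removes the positions of $Y$. $\mathbb{B}(X)$ is the set of sublists of $X$ forming a basis of $U$, each ordered as in $X$; two bases are equal iff they occupy the same positions. For $B\in\mathbb{B}(X)$, an element $x\in X\setminus B$ is externally active if $x\in\mathrm{span}\{b\in B: b<x\}$; $E(B)$ is the sublist of externally active elements. A cocircuit is a sublist $C\subseteq X$ meeting every basis in $\mathbb{B}(X)$ and minimal with this property. $\mathcal{D}(X)=\{f\in\mathrm{Sym}(V): D_Cf=0\text{ for all cocircuits }C\}$ (the kernel of the ideal generated by the $p_C$). $\mathcal{P}(X)=\mathrm{span}\{p_Y: Y\subseteq X,\ X\setminus Y\text{ spans }U\}$, and $Q_B=p_{X\setminus(B\cup E(B))}$. Construction of $R^B_Z$: for a finite list $Y=(y_1,\ldots,y_m)$ in $U$ such that some linear functional is positive on all $y_j$, the multivariate spline $T_Y$ is the distribution on $U$ with $\int_U\varphi\,T_Y=\int_{[0,\infty)^m}\varphi(\sum_j\lambda_jy_j)\,d\lambda$ ($T_\emptyset=\delta_0$). Let $Z$ be a finite list spanning $U$ and $B=(b_1,\ldots,b_r)\subseteq Z$ a basis ordered as in $Z$; set $S_0=\{0\}$, $S_i=\mathrm{span}(b_1,\ldots,b_i)$. An element $u\in S_i\setminus S_{i-1}$ is positive if its $b_i$-coefficient in the basis $(b_1,\ldots,b_r)$ is positive, negative otherwise. Let $P_i$ (resp. $N_i$) be the sublist of positive (resp. negative) elements of $Z$ lying in $S_i\setminus S_{i-1}$,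 and $-N_i$ the list of their negatives. Put $T_i^{B+}=(-1)^{|N_i|}T_{P_i}*T_{-N_i}$, $T_i^{B-}=(-1)^{|P_i|}T_{-P_i}*T_{N_i}$, $R_i^B=T_i^{B+}-T_i^{B-}$ and $R^B_Z=R^B_1*\cdots*R^B_r$ (convolution of distributions; these convolutions are well defined). $R^B_Z$ is a homogeneous polynomial function on $U$, regarded as an element of $\mathrm{Sym}(V)$.
   Formalization: det(B) is read as |det(B)|: with the signed determinant the duality fails, e.g. for r=1 and X=B=(-1) one has R=1, Q_B=1, det(B)=-1, so the pairing is -1 instead of 1. *)

theory Defs
  imports "HOL-Analysis.Analysis" "HOL-Library.Poly_Mapping"
begin

section \<open>Polynomials and the pairing\<close>

text \<open>
  The space \<open>U\<close> with its fixed basis \<open>s\<^sub>1, \<dots>, s\<^sub>r\<close> is \<open>real ^ 'r\<close> with the standard basis, where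
  \<open>'r\<close> is a finite linearly ordered index type.  A polynomial in variables indexed by \<open>'r\<close> is a
  finitely supported map from exponent vectors to coefficients; multiplication is that of
  \<^theory>\<open>HOL-Library.Poly_Mapping\<close>.  The variables are called \<open>s\<^sub>i\<close> in \<open>Sym(U)\<close> and \<open>t\<^sub>i\<close> in \<open>Sym(V)\<close>.
\<close>

type_synonym 'r symU = "('r \<Rightarrow>\<^sub>0 nat) \<Rightarrow>\<^sub>0 real"
type_synonym 'r symV = "('r \<Rightarrow>\<^sub>0 nat) \<Rightarrow>\<^sub>0 real"

instantiation poly_mapping :: (type, real_vector) real_vector
begin

definition scaleR_poly_mapping :: "real \<Rightarrow> ('a \<Rightarrow>\<^sub>0 'b) \<Rightarrow> ('a \<Rightarrow>\<^sub>0 'b)"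
  where "scaleR_poly_mapping c p = Poly_Mapping.map (\<lambda>a. c *\<^sub>R a) p"

lemma lookup_scaleR: "Poly_Mapping.lookup (c *\<^sub>R p) k = c *\<^sub>R Poly_Mapping.lookup p k"
  by (simp add: scaleR_poly_mapping_def Poly_Mapping.map.rep_eq when_def)

instance
  by intro_classes
    (auto intro!: poly_mapping_eqI simp: lookup_scaleR lookup_add scaleR_add_right scaleR_add_left)

end

definition peval :: "'r::finite symV \<Rightarrow> real ^ 'r \<Rightarrow> real"
  where "peval f x = (\<Sum>m\<in>Poly_Mapping.keys f.
    Poly_Mapping.lookup f m * (\<Prod>i\<in>UNIV. (x $ i) ^ Poly_Mapping.lookup m i))"

text \<open>The formal partial derivative with respect to the variable \<open>t\<^sub>i\<close>; in the monomials in which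
  \<open>t\<^sub>i\<close> does not occur the truncated exponent is harmless, since the coefficient is \<open>0\<close>.\<close>

definition pderiv_var :: "'r \<Rightarrow> 'r symV \<Rightarrow> 'r symV"
  where "pderiv_var i f =
    (\<Sum>m\<in>Poly_Mapping.keys f. Poly_Mapping.single (m - Poly_Mapping.single i 1)
      (real (Poly_Mapping.lookup m i) * Poly_Mapping.lookup f m))"

definition pderiv_monom :: "('r::{finite,linorder} \<Rightarrow>\<^sub>0 nat) \<Rightarrow> 'r symV \<Rightarrow> 'r symV"
  where "pderiv_monom m =
    fold (\<lambda>i. pderiv_var i ^^ Poly_Mapping.lookup m i) (sorted_list_of_set UNIV)"

text \<open>\<open>diff_op p f\<close> is \<open>p(\<partial>/\<partial>t\<^sub>1, \<dots>, \<partial>/\<partial>t\<^sub>r) f\<close>.\<close>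

definition diff_op :: "'r::{finite,linorder} symU \<Rightarrow> 'r symV \<Rightarrow> 'r symV"
  where "diff_op p f = (\<Sum>m\<in>Poly_Mapping.keys p. Poly_Mapping.lookup p m *\<^sub>R pderiv_monom m f)"

definition pairing :: "'r::{finite,linorder} symU \<Rightarrow> 'r symV \<Rightarrow> real"
  where "pairing p f = peval (diff_op p f) 0"

definition lin_poly :: "real ^ 'r \<Rightarrow> 'r::finite symU"
  where "lin_poly u = (\<Sum>i\<in>UNIV. Poly_Mapping.single (Poly_Mapping.single i 1) (u $ i))"

definition list_poly :: "(real ^ 'r) list \<Rightarrow> 'r::finite symU"
  where "list_poly Y = prod_list (map lin_poly Y)"

definition dir_deriv :: "real ^ 'r \<Rightarrow> 'r::finite symV \<Rightarrow> 'r symV"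
  where "dir_deriv u f = (\<Sum>i\<in>UNIV. (u $ i) *\<^sub>R pderiv_var i f)"

definition list_deriv :: "(real ^ 'r) list \<Rightarrow> 'r::finite symV \<Rightarrow> 'r symV"
  where "list_deriv Y = foldr dir_deriv Y"


section \<open>Bases, external activity, cocircuits and the two spaces\<close>

text \<open>A sublist of \<open>X\<close> is given by its set \<open>J \<subseteq> {..<length X}\<close> of positions; the sublist itself is
  \<open>nths X J\<close>.\<close>

definition is_basis_list :: "'a::real_vector list \<Rightarrow> bool"
  where "is_basis_list bs \<longleftrightarrow> distinct bs \<and> independent (set bs) \<and> span (set bs) = UNIV"

definition bases :: "'a::real_vector list \<Rightarrow> nat set set"
  where "bases X = {J. J \<subseteq> {..<length X} \<and> is_basis_list (nths X J)}"

definition ext_active :: "'a::real_vector list \<Rightarrow> nat set \<Rightarrow> nat set"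
  where "ext_active X J = {k \<in> {..<length X} - J. X ! k \<in> span {X ! j | j. j \<in> J \<and> j < k}}"

definition meets_all_bases :: "'a::real_vector list \<Rightarrow> nat set \<Rightarrow> bool"
  where "meets_all_bases X C \<longleftrightarrow> C \<subseteq> {..<length X} \<and> (\<forall>J\<in>bases X. C \<inter> J \<noteq> {})"

definition cocircuits :: "'a::real_vector list \<Rightarrow> nat set set"
  where "cocircuits X = {C. meets_all_bases X C \<and> (\<forall>C'. C' \<subset> C \<longrightarrow> \<not> meets_all_bases X C')}"

definition DM_space :: "(real ^ 'r) list \<Rightarrow> 'r::finite symV set"
  where "DM_space X = {f. \<forall>C\<in>cocircuits X. list_deriv (nths X C) f = 0}"

definition P_space :: "(real ^ 'r) list \<Rightarrow> 'r::finite symU set"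
  where "P_space X = span {list_poly (nths X J) | J.
    J \<subseteq> {..<length X} \<and> span (set (nths X ({..<length X} - J))) = UNIV}"

definition Q_poly :: "(real ^ 'r) list \<Rightarrow> nat set \<Rightarrow> 'r::finite symU"
  where "Q_poly X J = list_poly (nths X ({..<length X} - (J \<union> ext_active X J)))"


section \<open>Distributions\<close>

text \<open>The condition at \<open>k + 1\<close> says that all directional derivatives exist and are of class \<open>C\<^sup>k\<close>.\<close>

primrec C_k :: "nat \<Rightarrow> ('a::real_normed_vector \<Rightarrow> real) \<Rightarrow> bool" where
  "C_k 0 f \<longleftrightarrow> continuous_on UNIV f"
| "C_k (Suc k) f \<longleftrightarrow>
    (\<forall>x. f differentiable (at x)) \<and> (\<forall>v. C_k k (\<lambda>x. frechet_derivative f (at x) v))"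

definition supp :: "('a::topological_space \<Rightarrow> real) \<Rightarrow> 'a set"
  where "supp f = closure {x. f x \<noteq> 0}"

definition test_fun :: "('a::real_normed_vector \<Rightarrow> real) \<Rightarrow> bool"
  where "test_fun \<phi> \<longleftrightarrow> (\<forall>k. C_k k \<phi>) \<and> compact (supp \<phi>)"

text \<open>A distribution is a functional on test functions.  Only its values on test functions
  matter; the functionals below are also assigned (irrelevant) values elsewhere.\<close>

type_synonym 'a distribution = "('a \<Rightarrow> real) \<Rightarrow> real"

definition dist_supported_on :: "'a::real_normed_vector distribution \<Rightarrow> 'a set \<Rightarrow> bool"
  where "dist_supported_on S A \<longleftrightarrow> (\<forall>\<phi>. test_fun \<phi> \<and> supp \<phi> \<inter> A = {} \<longrightarrow> S \<phi> = 0)"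

text \<open>Addition is a proper map on \<open>A \<times> B\<close>: the usual condition on supports under which the
  convolution exists.\<close>

definition add_proper :: "'a::real_normed_vector set \<Rightarrow> 'a set \<Rightarrow> bool"
  where "add_proper A B \<longleftrightarrow> closed A \<and> closed B \<and>
    (\<forall>K. compact K \<longrightarrow> compact {z \<in> A \<times> B. fst z + snd z \<in> K})"

definition cutoff :: "'a::real_normed_vector set \<Rightarrow> 'a set \<Rightarrow> ('a \<Rightarrow> real) \<Rightarrow> ('a \<times> 'a \<Rightarrow> real) \<Rightarrow> bool"
  where "cutoff A B \<phi> \<eta> \<longleftrightarrow> test_fun \<eta> \<and>
    (\<exists>W. open W \<and> {z \<in> A \<times> B. fst z + snd z \<in> supp \<phi>} \<subseteq> W \<and> (\<forall>z\<in>W. \<eta> z = 1))"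

text \<open>The convolution \<open>S * T\<close> maps \<open>\<phi>\<close> to the value of \<open>S \<otimes> T\<close> at \<open>(x, y) \<mapsto> \<phi> (x + y)\<close>.  The latter
  function is not compactly supported and is therefore multiplied by a cutoff function \<open>\<eta>\<close> which is
  \<open>1\<close> near its support within \<open>supp S \<times> supp T\<close>; the value does not depend on \<open>\<eta>\<close>, nor on the closed
  sets \<open>A\<close>, \<open>B\<close> carrying \<open>S\<close> and \<open>T\<close>.\<close>

definition conv :: "'a::real_normed_vector distribution \<Rightarrow> 'a distribution \<Rightarrow> 'a distribution"
  where "conv S T \<phi> = (THE c. \<exists>A B. add_proper A B \<and> dist_supported_on S A \<and> dist_supported_on T B \<and>
    (\<forall>\<eta>. cutoff A B \<phi> \<eta> \<longrightarrow> c = S (\<lambda>x. T (\<lambda>y. \<eta> (x, y) * \<phi> (x + y)))))"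


section \<open>Multivariate splines and the polynomials $R^B_Z$\<close>

definition spline :: "'a::real_normed_vector list \<Rightarrow> 'a distribution"
  where "spline Y \<phi> =
    (LINT l : ({..<length Y} \<rightarrow>\<^sub>E {0..}) | (\<Pi>\<^sub>M j\<in>{..<length Y}. lborel).
      \<phi> (\<Sum>j<length Y. l j *\<^sub>R Y ! j))"

text \<open>In the following, \<open>bs = [b\<^sub>1, \<dots>, b\<^sub>r]\<close> is a basis and the index \<open>i\<close> starts at \<open>0\<close>, so that
  \<open>layer bs i\<close> is \<open>S\<^bsub>i+1\<^esub> - S\<^sub>i\<close>, and \<open>bs ! i\<close> is \<open>b\<^bsub>i+1\<^esub>\<close>.\<close>

definition layer :: "'a::real_vector list \<Rightarrow> nat \<Rightarrow> 'a set"
  where "layer bs i = span (set (take (Suc i) bs)) - span (set (take i bs))"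

definition positive_in :: "'a::real_vector list \<Rightarrow> nat \<Rightarrow> 'a \<Rightarrow> bool"
  where "positive_in bs i u \<longleftrightarrow> representation (set bs) u (bs ! i) > 0"

definition pos_part :: "'a::real_vector list \<Rightarrow> 'a list \<Rightarrow> nat \<Rightarrow> 'a list"
  where "pos_part bs Z i = filter (\<lambda>u. u \<in> layer bs i \<and> positive_in bs i u) Z"

definition neg_part :: "'a::real_vector list \<Rightarrow> 'a list \<Rightarrow> nat \<Rightarrow> 'a list"
  where "neg_part bs Z i = filter (\<lambda>u. u \<in> layer bs i \<and> \<not> positive_in bs i u) Z"

definition T_plus :: "'a::real_normed_vector list \<Rightarrow> 'a list \<Rightarrow> nat \<Rightarrow> 'a distribution"
  where "T_plus bs Z i \<phi> = (- 1) ^ length (neg_part bs Z i) *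
    conv (spline (pos_part bs Z i)) (spline (map uminus (neg_part bs Z i))) \<phi>"

definition T_minus :: "'a::real_normed_vector list \<Rightarrow> 'a list \<Rightarrow> nat \<Rightarrow> 'a distribution"
  where "T_minus bs Z i \<phi> = (- 1) ^ length (pos_part bs Z i) *
    conv (spline (map uminus (pos_part bs Z i))) (spline (neg_part bs Z i)) \<phi>"

definition R_layer :: "'a::real_normed_vector list \<Rightarrow> 'a list \<Rightarrow> nat \<Rightarrow> 'a distribution"
  where "R_layer bs Z i \<phi> = T_plus bs Z i \<phi> - T_minus bs Z i \<phi>"

text \<open>The fold starts with the unit \<open>spline [] = \<delta>\<^sub>0\<close> of convolution.\<close>

definition R_dist :: "'a::real_normed_vector list \<Rightarrow> 'a list \<Rightarrow> 'a distribution"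
  where "R_dist bs Z = foldl conv (spline []) (map (R_layer bs Z) [0..<length bs])"

definition R_poly :: "(real ^ 'r) list \<Rightarrow> (real ^ 'r) list \<Rightarrow> 'r::finite symV"
  where "R_poly bs Z =
    (THE f. \<forall>\<phi>. test_fun \<phi> \<longrightarrow> R_dist bs Z \<phi> = (\<integral>x. peval f x * \<phi> x \<partial>lborel))"

text \<open>The matrix whose columns are the entries of \<open>bs\<close>, in order; \<open>card {k. k < j}\<close> is the position
  of \<open>j\<close> in the index type, counted from \<open>0\<close>.\<close>

definition col_matrix ::
  "(real ^ 'r::{finite,linorder}) list \<Rightarrow> real ^ 'r::{finite,linorder} ^ 'r::{finite,linorder}"
  where "col_matrix bs = (\<chi> i j. (bs ! card {k. k < j}) $ i)"

text \<open>The determinant \<open>det(B)\<close> in the normalisation of $R^B_Z$ is the volume of the parallelepiped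
  spanned by \<open>B\<close>, i.e. the absolute value of the determinant: the spline \<open>T\<^sub>B\<close> is $1/|\det(B)|$ times
  the indicator function of a cone.  The signed determinant would give the wrong sign:
  for \<open>r = 1\<close>, \<open>X = B = (-1)\<close>, one has $R^B_X = 1$ and $Q_B = 1$, but signed determinant \<open>-1\<close>.\<close>

definition basis_det :: "(real ^ 'r::{finite,linorder}) list \<Rightarrow> real"
  where "basis_det bs = \<bar>det (col_matrix bs)\<bar>"

definition dual_poly :: "(real ^ 'r::{finite,linorder}) list \<Rightarrow> nat set \<Rightarrow> 'r symV"
  where "dual_poly X J = basis_det (nths X J) *\<^sub>R
    R_poly (nths X J) (nths X ({..<length X} - ext_active X J))"

end

theory Submission
  imports Defs
begin

text \<open>
  The distribution $R^B_Z$ has a polynomial density that can be computed one vector at a time.  The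
  first vector \<open>z\<close> of layer \<open>i\<close> extends the density from the subspace $S_{i-1}$ to $S_i$ constantly
  along \<open>z\<close>, with a factor $1/z_i$; every further vector \<open>z\<close> of the layer replaces the density \<open>p\<close> by
  the \<open>g\<close> with $D_z g = p$ and $g = 0$ on $S_{i-1}$.  The same polynomial describes $T_i^{B+}$ on the
  positive side and $-T_i^{B-}$ on the negative side.  Consequently $D_z$ removes \<open>z\<close> from the list, the
  polynomial of a list with an empty layer is \<open>0\<close>, and the value at \<open>0\<close> vanishes as soon as some layer
  does not consist of exactly one vector.

  A cocircuit is the complement of a hyperplane \<open>H\<close>, and if $b_i$ is the first element of \<open>B\<close> outside
  \<open>H\<close>, then it contains layer \<open>i\<close>; so the polynomials lie in $D(X)$.  For the pairing of $Q_B$ with the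
  polynomial of \<open>D\<close>, suppose that no layer of \<open>X - E(D)\<close> is removed completely by the derivatives in
  \<open>W = X - (B \<union> E(B))\<close>.  Choosing an element of \<open>B \<union> E(B)\<close> in each layer one sees that \<open>E(D)\<close> is contained
  in \<open>E(B)\<close>, so all these derivatives remove vectors, and if exactly one vector per layer
  is left, then \<open>B = D\<close>.

  Replacing an externally active element by a combination of earlier basis elements expresses each
  generator of $P(X)$ through the $Q_B$.  If \<open>f\<close> in $D(X)$ is orthogonal to $P(X)$, then $D_Y f = 0$ for all
  sublists \<open>Y\<close> by downward induction on \<open>Y\<close>: if the complement of \<open>Y\<close> spans, $D_Y f$ is constant by induction
  and the constant is a value of the pairing; otherwise \<open>Y\<close> contains a cocircuit.
\<close>

text \<open>Algebra and analysis meet only in the identity between \<open>dual_poly\<close> and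
  \<open>flag_poly\<close>; membership in \<open>DM_space\<close> and the pairing are settled for
  flag polynomials. Densities on the subspaces of the flag are taken with respect to the coordinates
  in the basis \<open>bs\<close>, not with respect to a Euclidean measure. In these coordinates a
  vector contributes only its coefficients, and the volume of the parallelepiped of
  \<open>bs\<close> enters once, when the integral over all coordinates is compared with Lebesgue
  measure: this is the origin of the factor \<open>basis_det\<close>. The obstacle on the analytic
  side is that \<open>conv\<close> is a definite description involving smooth cutoffs, whereas
  integrals of a test function along rays are no longer compactly supported. The closed sets are
  subspaces and cones, for which properness of addition is a linear norm estimate.\<close>

abbreviation lookup :: "('a \<Rightarrow>\<^sub>0 'b::zero) \<Rightarrow> 'a \<Rightarrow> 'b"
  where "lookup \<equiv> Poly_Mapping.lookup"

abbreviation single :: "'a \<Rightarrow> 'b \<Rightarrow> ('a \<Rightarrow>\<^sub>0 'b::zero)"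
  where "single \<equiv> Poly_Mapping.single"

abbreviation keys :: "('a \<Rightarrow>\<^sub>0 'b::zero) \<Rightarrow> 'a set"
  where "keys \<equiv> Poly_Mapping.keys"

definition var_exp :: "'r \<Rightarrow> ('r \<Rightarrow>\<^sub>0 nat)"
  where "var_exp i = single i 1"

section \<open>Exponent vectors and coefficients\<close>

lemma lookup_single_if: "lookup (single k v) k' = (if k = k' then v else 0)"
  by (simp add: lookup_single when_def)

lemma lookup_var_exp: "lookup (var_exp i) j = (if i = j then 1 else 0)"
  by (simp add: var_exp_def lookup_single_if)

lemma poly_mapping_sum_single:
  fixes f :: "'a \<Rightarrow>\<^sub>0 'b::comm_monoid_add"
  shows "f = (\<Sum>m\<in>keys f. single m (lookup f m))"
  by (rule poly_mapping_eqI)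
    (auto simp: lookup_sum lookup_single_if if_distrib sum.delta' in_keys_iff)

text \<open>Subtraction of exponents is truncated, so it can be undone only if the variable
  \<open>i\<close> occurs in \<open>k\<close>.\<close>

lemma exp_diff_var_eq_iff:
  fixes k m :: "'r \<Rightarrow>\<^sub>0 nat"
  assumes "lookup k i \<noteq> 0"
  shows "k - var_exp i = m \<longleftrightarrow> k = m + var_exp i"
proof
  assume "k - var_exp i = m"
  then show "k = m + var_exp i"
    using assms
    by (intro poly_mapping_eqI) (auto simp: lookup_add lookup_minus lookup_var_exp)
next
  assume "k = m + var_exp i"
  then show "k - var_exp i = m" by simp
qed

section \<open>Formal derivatives\<close>

text \<open>Reading off coefficients replaces the sum over \<open>keys\<close> by a formula valid
  for every exponent; linearity and commutation can then be checked coefficientwise.\<close>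

lemma lookup_pderiv_var:
  "lookup (pderiv_var i f) m = real (lookup m i + 1) * lookup f (m + var_exp i)"
proof -
  have "lookup (pderiv_var i f) m
      = (\<Sum>k\<in>keys f. if k = m + var_exp i then real (lookup k i) * lookup f k else 0)"
    unfolding pderiv_var_def lookup_sum var_exp_def[symmetric]
  proof (intro sum.cong refl)
    fix k assume "k \<in> keys f"
    show "lookup (single (k - var_exp i) (real (lookup k i) * lookup f k)) m
        = (if k = m + var_exp i then real (lookup k i) * lookup f k else 0)"
      using exp_diff_var_eq_iff[of k i m]
      by (cases "lookup k i = 0") (auto simp: lookup_single_if)
  qed
  also have "\<dots> = real (lookup m i + 1) * lookup f (m + var_exp i)"
    by (auto simp: sum.delta in_keys_iff lookup_add lookup_var_exp)
  finally show ?thesis .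
qed

lemma lookup_dir_deriv:
  "lookup (dir_deriv u f) m = (\<Sum>i\<in>UNIV. u $ i * (real (lookup m i + 1) * lookup f (m + var_exp i)))"
  by (simp add: dir_deriv_def lookup_sum lookup_scaleR lookup_pderiv_var)

lemma linear_dir_deriv: "linear (dir_deriv u)"
  by (intro linearI poly_mapping_eqI)
    (simp_all add: lookup_dir_deriv lookup_add lookup_scaleR algebra_simps sum.distrib sum_distrib_left)

lemmas dir_deriv_add = linear_add[OF linear_dir_deriv]
  and dir_deriv_diff = linear_diff[OF linear_dir_deriv]
  and dir_deriv_scaleR = linear_scale[OF linear_dir_deriv]
  and dir_deriv_0 [simp] = linear_0[OF linear_dir_deriv]

lemma linear_dir_deriv_dir: "linear (\<lambda>u. dir_deriv u f)"
  by (intro linearI poly_mapping_eqI)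
    (simp_all add: lookup_dir_deriv lookup_add lookup_scaleR algebra_simps sum.distrib sum_distrib_left)

lemma dir_deriv_commute:
  fixes f :: "'r::finite symV"
  shows "dir_deriv u (dir_deriv v f) = dir_deriv v (dir_deriv u f)"
proof (rule poly_mapping_eqI)
  fix m :: "'r \<Rightarrow>\<^sub>0 nat"
  have expand: "lookup (dir_deriv u (dir_deriv v f)) m = (\<Sum>i\<in>UNIV. \<Sum>j\<in>UNIV. u $ i * v $ j *
      (real (lookup m i + 1) * real (lookup (m + var_exp i) j + 1)) * lookup f (m + var_exp i + var_exp j))"
    for u v
    by (simp only: lookup_dir_deriv sum_distrib_left mult_ac)
  have swap: "u $ i * v $ j *
      (real (lookup m i + 1) * real (lookup (m + var_exp i) j + 1)) * lookup f (m + var_exp i + var_exp j)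
    = v $ j * u $ i *
      (real (lookup m j + 1) * real (lookup (m + var_exp j) i + 1)) * lookup f (m + var_exp j + var_exp i)"
    for i j
  proof -
    have "m + var_exp i + var_exp j = m + var_exp j + var_exp i"
      by (simp add: ac_simps)
    then show ?thesis by (simp add: lookup_add lookup_var_exp)
  qed
  show "lookup (dir_deriv u (dir_deriv v f)) m = lookup (dir_deriv v (dir_deriv u f)) m"
    unfolding expand swap by (rule sum.swap)
qed

section \<open>Total degree and nilpotency of derivatives\<close>

definition exp_degree :: "('r::finite \<Rightarrow>\<^sub>0 nat) \<Rightarrow> nat"
  where "exp_degree m = (\<Sum>i\<in>UNIV. lookup m i)"

lemma exp_degree_add_var [simp]: "exp_degree (m + var_exp i) = Suc (exp_degree m)"
  by (simp add: exp_degree_def lookup_add sum.distrib lookup_var_exp)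

lemma exp_degree_eq_0: "exp_degree m = 0 \<longleftrightarrow> m = 0"
  by (auto simp: exp_degree_def poly_mapping_eq_iff fun_eq_iff)

lemma exp_degree_Suc:
  assumes "exp_degree m = Suc n"
  obtains m' i where "m = m' + var_exp i" "exp_degree m' = n"
proof -
  obtain i where i: "lookup m i \<noteq> 0"
    using assms unfolding exp_degree_def by (cases "\<forall>i. lookup m i = 0") auto
  then have m: "m = (m - var_exp i) + var_exp i"
    by (rule exp_diff_var_eq_iff[THEN iffD1, OF _ refl])
  show thesis
  proof (rule that[OF m])
    have "Suc (exp_degree (m - var_exp i)) = exp_degree m"
      by (subst (2) m) (rule exp_degree_add_var[symmetric])
    then show "exp_degree (m - var_exp i) = n"
      using assms by simp
  qed
qed

text \<open>Each derivative lowers the total degree. Nilpotency is what terminates the repeated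
  integration by parts in \<open>antideriv_exists\<close>.\<close>

lemma dir_deriv_nilpotent: "\<exists>n. (dir_deriv u ^^ n) f = 0"
proof -
  have *: "(dir_deriv u ^^ n) f = 0" if "\<forall>m. exp_degree m \<ge> n \<longrightarrow> lookup f m = 0" for n f
    using that
  proof (induction n arbitrary: f)
    case 0
    then show ?case by (auto intro: poly_mapping_eqI)
  next
    case (Suc n)
    have "(dir_deriv u ^^ n) (dir_deriv u f) = 0"
      by (rule Suc.IH) (auto simp: lookup_dir_deriv Suc.prems intro!: sum.neutral)
    then show ?case by (simp add: funpow_Suc_right del: funpow.simps)
  qed
  \<comment> \<open>One more than every degree that occurs; the inserted 0 covers
    \<open>f = 0\<close>.\<close>
  define n where "n = Suc (Max (insert 0 (exp_degree ` keys f)))"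
  have "lookup f m = 0" if "exp_degree m \<ge> n" for m
  proof (rule ccontr)
    assume "lookup f m \<noteq> 0"
    then have "exp_degree m \<le> Max (insert 0 (exp_degree ` keys f))"
      by (intro Max_ge) (auto simp: in_keys_iff)
    with that show False by (simp add: n_def)
  qed
  then show ?thesis using * by blast
qed

section \<open>Evaluation\<close>

definition meval :: "('r::finite \<Rightarrow>\<^sub>0 nat) \<Rightarrow> real ^ 'r \<Rightarrow> real"
  where "meval m x = (\<Prod>i\<in>UNIV. (x $ i) ^ lookup m i)"

text \<open>\<open>keys\<close> may shrink by cancellation, so additivity is proved with sums over a
  common finite superset.\<close>

lemma peval_superset:
  assumes "finite K" "keys f \<subseteq> K"
  shows "peval f x = (\<Sum>m\<in>K. lookup f m * meval m x)"
  unfolding peval_def meval_def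
  by (intro sum.mono_neutral_left) (use assms in \<open>auto simp: in_keys_iff\<close>)

lemma peval_keys: "peval f x = (\<Sum>m\<in>keys f. lookup f m * meval m x)"
  by (rule peval_superset) auto

lemma linear_peval: "linear (\<lambda>f. peval f x)"
proof (rule linearI)
  fix f g :: "'a symV" and c :: real
  have K: "finite (keys f \<union> keys g)" by simp
  show "peval (f + g) x = peval f x + peval g x"
    using peval_superset[OF K, of f x] peval_superset[OF K, of g x]
      peval_superset[OF K keys_add, of x]
    by (simp add: lookup_add ring_distribs sum.distrib)
  have "keys (c *\<^sub>R f) \<subseteq> keys f"
    by (auto simp: in_keys_iff lookup_scaleR)
  then show "peval (c *\<^sub>R f) x = c *\<^sub>R peval f x"
    using peval_superset[of "keys f" "c *\<^sub>R f" x] peval_keys[of f x]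
    by (simp add: lookup_scaleR sum_distrib_left mult.assoc)
qed

lemmas peval_add = linear_add[OF linear_peval]
  and peval_diff = linear_diff[OF linear_peval]
  and peval_scaleR = linear_scale[OF linear_peval]
  and peval_0 [simp] = linear_0[OF linear_peval]
  and peval_sum = linear_sum[OF linear_peval]

lemma peval_single: "peval (single m c) x = c * meval m x"
  using peval_superset[of "{m}" "single m c" x] by simp

lemma peval_at_0: "peval f 0 = lookup f 0"
proof -
  have "meval m (0 :: real ^ 'a) = (if m = 0 then 1 else 0)" for m
  proof (cases "m = 0")
    case False
    then obtain i where "lookup m i \<noteq> 0"
      by (metis lookup_zero poly_mapping_eqI)
    then have "(\<Prod>i\<in>UNIV. (0 :: real ^ 'a) $ i ^ lookup m i) = 0"
      by (intro prod_zero) (auto intro!: exI[of _ i])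
    then show ?thesis using False by (simp add: meval_def)
  qed (simp add: meval_def)
  then have "peval f 0 = (\<Sum>m\<in>insert 0 (keys f). lookup f m * (if m = 0 then 1 else 0))"
    using peval_superset[of "insert 0 (keys f)" f "0 :: real ^ 'a"] by auto
  then show ?thesis by (simp add: if_distrib cong: if_cong)
qed

lemma meval_add: "meval (m + m') x = meval m x * meval m' x"
  by (simp add: meval_def lookup_add power_add prod.distrib)

lemma peval_mult: "peval (f * g) x = peval f x * peval g x"
proof -
  have "peval (f * g) x
      = peval ((\<Sum>m\<in>keys f. single m (lookup f m)) * (\<Sum>m\<in>keys g. single m (lookup g m))) x"
    by (simp only: poly_mapping_sum_single[symmetric])
  also have "\<dots> = (\<Sum>m\<in>keys f. \<Sum>m'\<in>keys g. (lookup f m * meval m x) * (lookup g m' * meval m' x))"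
    unfolding sum_product peval_sum mult_single peval_single meval_add
    by (intro sum.cong refl) simp
  also have "\<dots> = peval f x * peval g x"
    by (simp only: sum_product[symmetric] peval_keys)
  finally show ?thesis .
qed

lemma peval_one [simp]: "peval 1 x = 1"
  using peval_single[of 0 1 x] by (simp add: meval_def)

lemma peval_power: "peval (f ^ n) x = peval f x ^ n"
  by (induction n) (simp_all add: peval_mult)

lemma meval_var: "meval (var_exp i) x = x $ i"
proof -
  have "meval (var_exp i) x = (\<Prod>j\<in>UNIV. if j = i then x $ i else 1)"
    unfolding meval_def by (intro prod.cong) (auto simp: lookup_var_exp)
  then show ?thesis by simp
qed

lemma peval_lin_poly: "peval (lin_poly u) x = u \<bullet> x"
  by (simp only: lin_poly_def var_exp_def[symmetric] peval_sum peval_single meval_var inner_vec_def inner_real_def)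

lemma meval_diff_var:
  assumes "lookup m i \<noteq> 0"
  shows "meval (m - var_exp i) x = x $ i ^ (lookup m i - 1) * (\<Prod>j\<in>UNIV - {i}. x $ j ^ lookup m j)"
proof -
  have "meval (m - var_exp i) x = x $ i ^ lookup (m - var_exp i) i *
      (\<Prod>j\<in>UNIV - {i}. x $ j ^ lookup (m - var_exp i) j)"
    unfolding meval_def by (simp add: prod.remove[of UNIV i])
  also have "(\<Prod>j\<in>UNIV - {i}. x $ j ^ lookup (m - var_exp i) j) = (\<Prod>j\<in>UNIV - {i}. x $ j ^ lookup m j)"
    by (intro prod.cong) (auto simp: lookup_minus lookup_var_exp)
  finally show ?thesis by (simp add: lookup_minus lookup_var_exp)
qed

lemma has_derivative_meval:
  "(meval m has_derivative
     (\<lambda>h. \<Sum>i\<in>UNIV. h $ i * (real (lookup m i) * meval (m - var_exp i) x))) (at x)"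
proof -
  have d: "((\<lambda>x. x $ i ^ lookup m i) has_derivative
      (\<lambda>h. real (lookup m i) * (h $ i) * x $ i ^ (lookup m i - 1))) (at x)" for i
    by (rule has_derivative_power[OF bounded_linear_imp_has_derivative[OF bounded_linear_vec_nth], THEN has_derivative_eq_rhs])
       (simp add: fun_eq_iff mult_ac)
  have "((\<lambda>x. \<Prod>i\<in>UNIV. x $ i ^ lookup m i) has_derivative (\<lambda>h. \<Sum>i\<in>UNIV. real (lookup m i) * (h $ i) * x $ i ^ (lookup m i - 1) *
      (\<Prod>j\<in>UNIV - {i}. x $ j ^ lookup m j))) (at x)"
    by (rule has_derivative_prod[OF d])
  also have "(\<lambda>h. \<Sum>i\<in>UNIV. real (lookup m i) * (h $ i) * x $ i ^ (lookup m i - 1) *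
      (\<Prod>j\<in>UNIV - {i}. x $ j ^ lookup m j))
     = (\<lambda>h. \<Sum>i\<in>UNIV. h $ i * (real (lookup m i) * meval (m - var_exp i) x))"
  proof (intro ext sum.cong refl)
    fix h i
    show "real (lookup m i) * h $ i * x $ i ^ (lookup m i - 1) * (\<Prod>j\<in>UNIV - {i}. x $ j ^ lookup m j)
      = h $ i * (real (lookup m i) * meval (m - var_exp i) x)"
      using meval_diff_var[of m i x] by (cases "lookup m i = 0") auto
  qed
  finally show ?thesis
    by (simp only: meval_def[abs_def])
qed

text \<open>Formal and analytic derivatives agree. Constancy along lines, the product rule and the
  fundamental theorem of calculus become available for formal polynomials through this fact.\<close>

lemma has_derivative_peval: "(peval f has_derivative (\<lambda>h. peval (dir_deriv h f) x)) (at x)"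
proof -
  have "((\<lambda>x. \<Sum>m\<in>keys f. lookup f m * meval m x) has_derivative (\<lambda>h. \<Sum>m\<in>keys f. lookup f m *
      (\<Sum>i\<in>UNIV. h $ i * (real (lookup m i) * meval (m - var_exp i) x)))) (at x)"
    by (intro has_derivative_sum has_derivative_mult_right has_derivative_meval)
  also have "(\<lambda>h. \<Sum>m\<in>keys f. lookup f m *
      (\<Sum>i\<in>UNIV. h $ i * (real (lookup m i) * meval (m - var_exp i) x)))
    = (\<lambda>h. peval (dir_deriv h f) x)"
    unfolding dir_deriv_def pderiv_var_def var_exp_def[symmetric]
    unfolding peval_sum peval_scaleR peval_single real_scaleR_def sum_distrib_left
    by (subst sum.swap) (simp only: mult_ac)
  finally show ?thesis
    by (simp only: peval_keys[abs_def])
qed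

lemma continuous_peval [continuous_intros]:
  "continuous_on S g \<Longrightarrow> continuous_on S (\<lambda>x. peval f (g x))"
  by (rule continuous_on_compose2[of UNIV "peval f"])
    (auto intro!: continuous_at_imp_continuous_on has_derivative_continuous[OF has_derivative_peval])

lemma borel_measurable_peval [measurable (raw)]:
  "g \<in> borel_measurable M \<Longrightarrow> (\<lambda>x. peval f (g x)) \<in> borel_measurable M"
  using borel_measurable_continuous_on[of "peval f" g M] continuous_peval[of UNIV id f] by simp

lemma peval_line_deriv:
  "((\<lambda>t. peval f (x + t *\<^sub>R v)) has_real_derivative peval (dir_deriv v f) (x + t *\<^sub>R v)) (at t within S)"
proof -
  have line: "((\<lambda>t. x + t *\<^sub>R v) has_derivative (\<lambda>h. h *\<^sub>R v)) (at t within S)"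
    by (auto intro!: derivative_eq_intros)
  have "((\<lambda>t. peval f (x + t *\<^sub>R v)) has_derivative
      (\<lambda>h. peval (dir_deriv (h *\<^sub>R v) f) (x + t *\<^sub>R v))) (at t within S)"
    using has_derivative_compose[OF line has_derivative_peval[of f]] by simp
  moreover have "(\<lambda>h. peval (dir_deriv (h *\<^sub>R v) f) (x + t *\<^sub>R v))
      = (*) (peval (dir_deriv v f) (x + t *\<^sub>R v))"
    by (simp add: fun_eq_iff linear_scale[OF linear_dir_deriv_dir] peval_scaleR)
  ultimately show ?thesis
    by (simp add: has_field_derivative_def)
qed

text \<open>A vanishing polynomial function has vanishing derivatives along the axes, and up to a
  positive integer factor a coefficient of degree n + 1 is a coefficient of degree n of one of these
  derivatives.\<close>

lemma peval_eq_0_imp: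
  assumes "\<And>x. peval f x = 0"
  shows "f = 0"
proof (rule poly_mapping_eqI)
  fix m
  have "lookup f m = 0" if "\<forall>x. peval f x = 0" "exp_degree m = n" for n m and f :: "'a symV"
    using that
  proof (induction n arbitrary: m f)
    case 0
    then show ?case using peval_at_0[of f] by (simp add: exp_degree_eq_0)
  next
    case (Suc n)
    obtain m' i where m: "m = m' + var_exp i" "exp_degree m' = n"
      using Suc.prems exp_degree_Suc by metis
    have "peval (dir_deriv (axis i 1) f) x = 0" for x
    proof -
      have "((\<lambda>t. peval f (x + t *\<^sub>R axis i 1)) has_real_derivative 0) (at 0)"
        using Suc.prems by simp
      then show ?thesis
        using peval_line_deriv[of f x "axis i 1" 0 UNIV] DERIV_unique by fastforce
    qed
    then have "lookup (dir_deriv (axis i 1) f) m' = 0"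
      using Suc.IH m by blast
    moreover have "lookup (dir_deriv (axis i 1) f) m' = real (lookup m' i + 1) * lookup f m"
      unfolding lookup_dir_deriv m(1)
      by (subst sum.remove[of _ i]) (auto simp: axis_def intro!: sum.neutral)
    ultimately show ?case by simp
  qed
  then show "lookup f m = lookup 0 m" using assms by simp
qed

lemma peval_inject: "(\<And>x. peval f x = peval g x) \<Longrightarrow> f = g"
  using peval_eq_0_imp[of "f - g"] by (simp add: peval_diff)

text \<open>Polynomials are determined by their values, so the Leibniz rule is imported from
  analysis by uniqueness of derivatives.\<close>

lemma dir_deriv_mult: "dir_deriv u (f * g) = dir_deriv u f * g + f * dir_deriv u g"
proof (rule peval_inject)
  fix x
  have 1: "((\<lambda>x. peval f x * peval g x) has_derivative (\<lambda>h. peval f x * peval (dir_deriv h g) x +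
      peval (dir_deriv h f) x * peval g x)) (at x)"
    by (intro has_derivative_mult has_derivative_peval)
  have "(peval (f * g) has_derivative (\<lambda>h. peval (dir_deriv h (f * g)) x)) (at x)"
    by (rule has_derivative_peval)
  then have 2: "((\<lambda>x. peval f x * peval g x) has_derivative (\<lambda>h. peval (dir_deriv h (f * g)) x)) (at x)"
    by (simp add: peval_mult[abs_def])
  show "peval (dir_deriv u (f * g)) x = peval (dir_deriv u f * g + f * dir_deriv u g) x"
    using fun_cong[OF has_derivative_unique[OF 1 2], of u] by (simp add: peval_add peval_mult)
qed

section \<open>The pairing\<close>

lemma lookup_pderiv_var_pow:
  "lookup ((pderiv_var i ^^ n) f) m
    = fact (lookup m i + n) / fact (lookup m i) * lookup f (m + single i n)"
proof (induction n arbitrary: m)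
  case 0
  then show ?case by simp
next
  case (Suc n)
  have "m + var_exp i + single i n = m + single i (Suc n)"
    by (simp add: var_exp_def single_add[symmetric] add.assoc)
  moreover have "real (lookup m i + 1) * (c / fact (lookup m i + 1) * d) = c / fact (lookup m i) * d" for c d
    by simp
  ultimately show ?case
    by (simp only: funpow.simps o_apply lookup_pderiv_var Suc.IH lookup_add lookup_var_exp if_True
        add_Suc_right add_Suc add.assoc One_nat_def simp_thms) simp
qed

definition exp_fact :: "('r::finite \<Rightarrow>\<^sub>0 nat) \<Rightarrow> real"
  where "exp_fact m = (\<Prod>i\<in>UNIV. fact (lookup m i))"

lemma exp_fact_add_var: "exp_fact (m + var_exp i) = real (lookup m i + 1) * exp_fact m"
proof -
  have "exp_fact (m + var_exp i)
      = fact (lookup m i + 1) * (\<Prod>j\<in>UNIV - {i}. fact (lookup (m + var_exp i) j))"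
    unfolding exp_fact_def by (simp add: prod.remove[of UNIV i] lookup_add lookup_var_exp)
  also have "(\<Prod>j\<in>UNIV - {i}. fact (lookup (m + var_exp i) j) :: real) = (\<Prod>j\<in>UNIV - {i}. fact (lookup m j))"
    by (intro prod.cong) (auto simp: lookup_add lookup_var_exp)
  also have "(fact (lookup m i + 1) :: real) * (\<Prod>j\<in>UNIV - {i}. fact (lookup m j)) = real (lookup m i + 1) * exp_fact m"
    unfolding exp_fact_def by (simp add: prod.remove[of UNIV i] mult_ac)
  finally show ?thesis .
qed

lemma lookup_fold_pderiv_var:
  assumes "distinct is"
  shows "lookup (fold (\<lambda>i. pderiv_var i ^^ lookup k i) is f) m
    = (\<Prod>i\<in>set is. fact (lookup m i + lookup k i) / fact (lookup m i)) *
      lookup f (m + (\<Sum>i\<in>set is. single i (lookup k i)))"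
  using assms
proof (induction "is" arbitrary: f)
  case (Cons i "is")
  have "lookup (\<Sum>i\<in>set is. single i (lookup k i)) i = 0"
    using Cons.prems by (auto simp: lookup_sum lookup_single_if intro!: sum.neutral)
  with Cons show ?case
    by (simp add: lookup_pderiv_var_pow lookup_add add_ac)
qed simp

lemma sum_single_UNIV: "(\<Sum>i\<in>UNIV. single i (lookup k i)) = (k :: 'r::finite \<Rightarrow>\<^sub>0 nat)"
  by (rule poly_mapping_eqI) (simp add: lookup_sum lookup_single_if)

text \<open>Monomials are orthogonal: at the origin only the coefficient of the differentiated
  monomial itself survives, with the product of the factorials of its exponents as weight.\<close>

lemma pairing_superset:
  assumes "finite K" "keys p \<subseteq> K"
  shows "pairing p f = (\<Sum>m\<in>K. lookup p m * (exp_fact m * lookup f m))"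
proof -
  have "lookup (pderiv_monom m f) 0 = exp_fact m * lookup f m" for m
    by (simp add: pderiv_monom_def lookup_fold_pderiv_var exp_fact_def sum_single_UNIV)
  then have "pairing p f = (\<Sum>m\<in>keys p. lookup p m * (exp_fact m * lookup f m))"
    by (simp add: pairing_def diff_op_def peval_at_0 lookup_sum lookup_scaleR)
  also have "\<dots> = (\<Sum>m\<in>K. lookup p m * (exp_fact m * lookup f m))"
    by (rule sum.mono_neutral_left) (use assms in \<open>auto simp: in_keys_iff\<close>)
  finally show ?thesis .
qed

lemma linear_pairing_left: "linear (\<lambda>p. pairing p f)"
proof (rule linearI)
  fix p q :: "'a symU" and c :: real
  have K: "finite (keys p \<union> keys q)" by simp
  show "pairing (p + q) f = pairing p f + pairing q f"
    using pairing_superset[OF K, of p f] pairing_superset[OF K, of q f]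
      pairing_superset[OF K keys_add, of f]
    by (simp add: lookup_add ring_distribs sum.distrib)
  have "keys (c *\<^sub>R p) \<subseteq> keys p"
    by (auto simp: in_keys_iff lookup_scaleR)
  then show "pairing (c *\<^sub>R p) f = c *\<^sub>R pairing p f"
    using pairing_superset[of "keys p" "c *\<^sub>R p" f] pairing_superset[of "keys p" p f]
    by (simp add: lookup_scaleR sum_distrib_left mult.assoc)
qed

lemma linear_pairing_right: "linear (pairing p)"
  by (rule linearI)
    (simp_all add: pairing_superset[of "keys p" p] lookup_add lookup_scaleR ring_distribs sum.distrib
      sum_distrib_left mult_ac)

lemma pairing_single: "pairing (single m c) f = c * (exp_fact m * lookup f m)"
  using pairing_superset[of "{m}" "single m c" f] by simp

text \<open>Multiplication is adjoint to differentiation: raising the exponent of variable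
  \<open>i\<close> changes the weight by exactly the factor \<open>lookup m i + 1\<close> that
  differentiation produces.\<close>

lemma pairing_lin_poly_mult: "pairing (lin_poly u * p) f = pairing p (dir_deriv u f)"
proof -
  have "lin_poly u * p = (\<Sum>i\<in>UNIV. \<Sum>m\<in>keys p. single (var_exp i + m) (u $ i * lookup p m))"
    by (subst poly_mapping_sum_single[of p])
      (simp only: lin_poly_def var_exp_def[symmetric] sum_product mult_single)
  then have "pairing (lin_poly u * p) f = (\<Sum>i\<in>UNIV. \<Sum>m\<in>keys p.
      u $ i * lookup p m * (real (lookup m i + 1) * exp_fact m * lookup f (m + var_exp i)))"
    by (simp add: linear_sum[OF linear_pairing_left] pairing_single exp_fact_add_var
        add.commute[of "var_exp i" for i])
  also have "\<dots> = pairing p (dir_deriv u f)"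
    unfolding pairing_superset[of "keys p" p, OF finite_keys order_refl] lookup_dir_deriv sum_distrib_left
    by (subst sum.swap) (simp add: mult_ac)
  finally show ?thesis .
qed

lemma pairing_one: "pairing 1 f = peval f 0"
  using pairing_single[of 0 1 f] by (simp add: exp_fact_def peval_at_0)

section \<open>Iterated directional derivatives\<close>

lemma list_deriv_Nil [simp]: "list_deriv [] f = f"
  and list_deriv_Cons [simp]: "list_deriv (y # Y) f = dir_deriv y (list_deriv Y f)"
  and list_deriv_append: "list_deriv (Y @ Z) f = list_deriv Y (list_deriv Z f)"
  by (simp_all add: list_deriv_def)

lemma list_deriv_mset:
  assumes "mset Y = mset Z"
  shows "list_deriv Y f = list_deriv Z f"
  unfolding list_deriv_def foldr_conv_fold
  by (rule fun_cong[OF fold_multiset_equiv]) (use assms in \<open>auto simp: dir_deriv_commute\<close>)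

lemma linear_list_deriv: "linear (list_deriv Y)"
  by (induction Y) (simp_all add: linear_iff dir_deriv_add dir_deriv_scaleR)

lemma pairing_list_poly: "pairing (list_poly Y) f = peval (list_deriv Y f) 0"
proof -
  \<comment> \<open>The trailing factor \<open>p\<close> makes the induction work; adjoints appear
    in reversed order.\<close>
  have "pairing (list_poly Y * p) f = pairing p (list_deriv (rev Y) f)" for p
    by (induction Y arbitrary: p f)
      (simp_all add: list_poly_def list_deriv_append pairing_lin_poly_mult mult.assoc)
  note this[of 1]
  moreover have "list_deriv (rev Y) f = list_deriv Y f"
    by (rule list_deriv_mset) simp
  ultimately show ?thesis by (simp add: pairing_one)
qed

section \<open>Antiderivatives vanishing on a hyperplane\<close>

definition vanishing_on_hyperplane :: "real ^ 'r \<Rightarrow> 'r::finite symV \<Rightarrow> bool"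
  where "vanishing_on_hyperplane a g \<longleftrightarrow> (\<forall>x. a \<bullet> x = 0 \<longrightarrow> peval g x = 0)"

text \<open>Uniqueness for an initial value problem: \<open>f\<close> is constant on every line in
  direction \<open>z\<close>, and each such line meets the hyperplane, for the line through
  \<open>x\<close> at distance parameter
  \<open>t = (a \<bullet> x) / (a \<bullet> z)\<close>.\<close>

lemma vanishing_transversal_deriv_0:
  assumes "a \<bullet> z \<noteq> 0" "dir_deriv z f = 0" "vanishing_on_hyperplane a f"
  shows "f = 0"
proof (rule peval_eq_0_imp)
  fix x
  define t where "t = (a \<bullet> x) / (a \<bullet> z)"
  define y where "y = x - t *\<^sub>R z"
  have "((\<lambda>t. peval f (y + t *\<^sub>R z)) has_real_derivative 0) (at t)" for t
    using peval_line_deriv[of f y z t UNIV] assms(2) by simp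
  then have "peval f (y + t *\<^sub>R z) = peval f (y + 0 *\<^sub>R z)"
    using DERIV_isconst_all[of "\<lambda>t. peval f (y + t *\<^sub>R z)"] by blast
  moreover have "a \<bullet> y = 0"
    using assms(1) by (simp add: y_def t_def inner_diff_right)
  ultimately show "peval f x = 0"
    using assms(3) by (simp add: y_def vanishing_on_hyperplane_def)
qed

lemma vanishing_deriv_tangent:
  assumes "vanishing_on_hyperplane a f" "a \<bullet> u = 0" "a \<bullet> x = 0"
  shows "peval (dir_deriv u f) x = 0"
proof -
  have "((\<lambda>t. peval f (x + t *\<^sub>R u)) has_real_derivative 0) (at 0)"
    using assms by (simp add: vanishing_on_hyperplane_def inner_add_right)
  then show ?thesis
    using peval_line_deriv[of f x u 0 UNIV] DERIV_unique by fastforce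
qed

text \<open>The vector \<open>(a \<bullet> z) *\<^sub>R u - (a \<bullet> u) *\<^sub>R z\<close> is
  tangent to the hyperplane. In other words, at points of the hyperplane the gradient of
  \<open>f\<close> is a multiple of \<open>a\<close>.\<close>

lemma vanishing_deriv_proportional:
  assumes "vanishing_on_hyperplane a f" "a \<bullet> x = 0"
  shows "(a \<bullet> z) * peval (dir_deriv u f) x = (a \<bullet> u) * peval (dir_deriv z f) x"
proof -
  have "peval (dir_deriv ((a \<bullet> z) *\<^sub>R u - (a \<bullet> u) *\<^sub>R z) f) x = 0"
    using assms by (intro vanishing_deriv_tangent[of a]) (auto simp: inner_diff_right)
  then show ?thesis
    by (simp add: linear_diff[OF linear_dir_deriv_dir] linear_scale[OF linear_dir_deriv_dir]
        peval_diff peval_scaleR)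
qed

lemma scaleR_mult_left: "(c *\<^sub>R f) * g = c *\<^sub>R (f * g)"
  and scaleR_mult_right: "f * (c *\<^sub>R g) = c *\<^sub>R (f * g)" for f g :: "'r::finite symV"
  by (rule peval_inject, simp add: peval_mult peval_scaleR)+

lemma dir_deriv_lin_poly: "dir_deriv z (lin_poly a) = (a \<bullet> z) *\<^sub>R 1"
proof (rule peval_inject)
  fix x
  have "((\<lambda>t. peval (lin_poly a) (x + t *\<^sub>R z)) has_real_derivative (a \<bullet> z)) (at 0)"
    by (auto simp: peval_lin_poly inner_add_right intro!: derivative_eq_intros)
  then show "peval (dir_deriv z (lin_poly a)) x = peval ((a \<bullet> z) *\<^sub>R 1) x"
    using peval_line_deriv[of "lin_poly a" x z 0 UNIV] DERIV_unique by (fastforce simp: peval_scaleR)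
qed

lemma dir_deriv_lin_poly_power:
  "dir_deriv z (lin_poly a ^ Suc k) = (real (Suc k) * (a \<bullet> z)) *\<^sub>R lin_poly a ^ k"
proof (induction k)
  case 0
  then show ?case by (simp add: dir_deriv_lin_poly)
next
  case (Suc k)
  have "dir_deriv z (lin_poly a ^ Suc (Suc k))
      = (a \<bullet> z) *\<^sub>R lin_poly a ^ Suc k + (real (Suc k) * (a \<bullet> z)) *\<^sub>R lin_poly a ^ Suc k"
    unfolding power_Suc[of _ "Suc k"] dir_deriv_mult Suc.IH
    by (simp add: dir_deriv_lin_poly scaleR_mult_left scaleR_mult_right)
  then show ?case
    by (simp only: scaleR_add_left[symmetric]) (simp add: algebra_simps)
qed

text \<open>Integration by parts. Up to the constant \<open>c\<close>, the product of the power
  \<open>Suc k\<close> of \<open>lin_poly a\<close> with \<open>p\<close> has derivative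
  \<open>lin_poly a ^ k * p\<close> plus an error of the same shape, with a higher power and with
  \<open>p\<close> replaced by a multiple of \<open>dir_deriv z p\<close>. Hence the induction over
  the order of nilpotency with arbitrary \<open>k\<close>. Every term contains a factor
  \<open>lin_poly a\<close> and so vanishes on the hyperplane.\<close>

lemma antideriv_exists:
  fixes p :: "'r::finite symV"
  assumes "a \<bullet> z \<noteq> 0"
  shows "\<exists>g. dir_deriv z g = p \<and> vanishing_on_hyperplane a g"
proof -
  have *: "\<exists>g. dir_deriv z g = lin_poly a ^ k * p \<and> vanishing_on_hyperplane a g"
    if "(dir_deriv z ^^ n) p = 0" for n k and p :: "'r symV"
    using that
  proof (induction n arbitrary: k p)
    case 0
    then show ?case
      by (intro exI[of _ 0]) (auto simp: vanishing_on_hyperplane_def)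
  next
    case (Suc n)
    define c where "c = 1 / (real (Suc k) * (a \<bullet> z))"
    have c: "c * (real (Suc k) * (a \<bullet> z)) = 1"
      using assms by (simp add: c_def del: of_nat_Suc)
    have lin: "(dir_deriv z ^^ n) (c *\<^sub>R f) = c *\<^sub>R (dir_deriv z ^^ n) f" for f
      by (induction n) (simp_all add: dir_deriv_scaleR)
    have "(dir_deriv z ^^ n) (c *\<^sub>R dir_deriv z p) = 0"
      using Suc.prems by (simp add: lin funpow_swap1)
    from Suc.IH[OF this, of "Suc k"] obtain g where
      g: "dir_deriv z g = lin_poly a ^ Suc k * (c *\<^sub>R dir_deriv z p)" "vanishing_on_hyperplane a g"
      by blast
    have "dir_deriv z (c *\<^sub>R (lin_poly a ^ Suc k * p) - g)
        = (c * (real (Suc k) * (a \<bullet> z))) *\<^sub>R (lin_poly a ^ k * p)"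
      unfolding dir_deriv_diff dir_deriv_scaleR dir_deriv_mult[of z "lin_poly a ^ Suc k"] g(1)
        dir_deriv_lin_poly_power
      by (simp only: scaleR_mult_left scaleR_mult_right scaleR_add_right scaleR_scaleR) simp
    moreover have "vanishing_on_hyperplane a (c *\<^sub>R (lin_poly a ^ Suc k * p) - g)"
      using g(2) by (auto simp: vanishing_on_hyperplane_def peval_diff peval_scaleR peval_mult
          peval_power peval_lin_poly)
    ultimately show ?case unfolding c by auto
  qed
  obtain n where "(dir_deriv z ^^ n) p = 0"
    using dir_deriv_nilpotent by blast
  from *[OF this, of 0] show ?thesis by simp
qed

definition antideriv :: "real ^ 'r \<Rightarrow> real ^ 'r \<Rightarrow> 'r::finite symV \<Rightarrow> 'r symV"
  where "antideriv a z p = (THE g. dir_deriv z g = p \<and> vanishing_on_hyperplane a g)"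

lemma antideriv_eqI:
  assumes "a \<bullet> z \<noteq> 0" "dir_deriv z g = p" "vanishing_on_hyperplane a g"
  shows "antideriv a z p = g"
  unfolding antideriv_def
proof (rule the_equality)
  fix g' assume g': "dir_deriv z g' = p \<and> vanishing_on_hyperplane a g'"
  have "dir_deriv z (g' - g) = 0"
    unfolding dir_deriv_diff using assms(2) g' by simp
  moreover have "vanishing_on_hyperplane a (g' - g)"
    using assms(3) g' unfolding vanishing_on_hyperplane_def peval_diff by simp
  ultimately have "g' - g = 0"
    by (rule vanishing_transversal_deriv_0[OF assms(1)])
  then show "g' = g" by simp
qed (use assms in auto)

lemma
  assumes "a \<bullet> z \<noteq> 0"
  shows dir_deriv_antideriv: "dir_deriv z (antideriv a z p) = p"
    and vanishing_antideriv: "vanishing_on_hyperplane a (antideriv a z p)"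
  using antideriv_exists[OF assms, of p] antideriv_eqI[OF assms] by auto

lemma antideriv_0: "a \<bullet> z \<noteq> 0 \<Longrightarrow> antideriv a z 0 = 0"
  by (rule antideriv_eqI) (auto simp: vanishing_on_hyperplane_def)

text \<open>Only the boundary condition is in question. On the hyperplane the derivative along
  \<open>u\<close> of the antiderivative is \<open>(a \<bullet> u) / (a \<bullet> z)\<close> times
  \<open>p\<close>, which explains the two alternatives.\<close>

lemma dir_deriv_antideriv_commute:
  assumes z: "a \<bullet> z \<noteq> 0" and u: "a \<bullet> u = 0 \<or> vanishing_on_hyperplane a p"
  shows "dir_deriv u (antideriv a z p) = antideriv a z (dir_deriv u p)"
proof (rule antideriv_eqI[OF z, symmetric])
  show "dir_deriv z (dir_deriv u (antideriv a z p)) = dir_deriv u p"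
    by (subst dir_deriv_commute) (simp add: dir_deriv_antideriv z)
  show "vanishing_on_hyperplane a (dir_deriv u (antideriv a z p))"
    unfolding vanishing_on_hyperplane_def
  proof (intro allI impI)
    fix x assume x: "a \<bullet> x = 0"
    show "peval (dir_deriv u (antideriv a z p)) x = 0"
      using vanishing_deriv_proportional[OF vanishing_antideriv[OF z, of p] x, of z u] z u x
      by (auto simp: dir_deriv_antideriv vanishing_on_hyperplane_def)
  qed
qed

lemma antideriv_commute:
  assumes "a \<bullet> y \<noteq> 0" "a \<bullet> z \<noteq> 0"
  shows "antideriv a y (antideriv a z p) = antideriv a z (antideriv a y p)"
  by (rule antideriv_eqI)
    (use assms in \<open>auto simp: dir_deriv_antideriv_commute vanishing_antideriv dir_deriv_antideriv\<close>)

text \<open>The polynomial \<open>transport a z q\<close> is constant along \<open>z\<close>; the factor \<open>1 / (a \<bullet> z)\<close> makes it the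
  density of the convolution of \<open>q\<close>, placed on the hyperplane, with the spline of \<open>z\<close>.\<close>

definition transport :: "real ^ 'r \<Rightarrow> real ^ 'r \<Rightarrow> 'r::finite symV \<Rightarrow> 'r symV"
  where "transport a z q = (1 / (a \<bullet> z)) *\<^sub>R (q - antideriv a z (dir_deriv z q))"

lemma dir_deriv_transport: "a \<bullet> z \<noteq> 0 \<Longrightarrow> dir_deriv z (transport a z q) = 0"
  by (simp add: transport_def dir_deriv_scaleR dir_deriv_diff dir_deriv_antideriv)

lemma peval_transport:
  assumes "a \<bullet> z \<noteq> 0" "a \<bullet> x = 0"
  shows "peval (transport a z q) x = peval q x / (a \<bullet> z)"
  using vanishing_antideriv[OF assms(1)] assms(2)
  by (simp add: transport_def peval_scaleR peval_diff vanishing_on_hyperplane_def)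

lemma transport_eqI:
  assumes z: "a \<bullet> z \<noteq> 0" and "dir_deriv z g = 0"
    and "\<And>x. a \<bullet> x = 0 \<Longrightarrow> peval g x = peval q x / (a \<bullet> z)"
  shows "transport a z q = g"
proof -
  have "dir_deriv z (transport a z q - g) = 0"
    by (simp add: dir_deriv_diff dir_deriv_transport assms)
  moreover have "vanishing_on_hyperplane a (transport a z q - g)"
    using assms by (simp add: vanishing_on_hyperplane_def peval_diff peval_transport)
  ultimately have "transport a z q - g = 0"
    by (rule vanishing_transversal_deriv_0[OF z])
  then show ?thesis by simp
qed

lemma dir_deriv_transport_commute:
  "a \<bullet> z \<noteq> 0 \<Longrightarrow> a \<bullet> u = 0 \<Longrightarrow> dir_deriv u (transport a z q) = transport a z (dir_deriv u q)"
  by (simp add: transport_def dir_deriv_scaleR dir_deriv_diff dir_deriv_antideriv_commute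
      dir_deriv_commute[of u z])

lemma transport_0: "a \<bullet> z \<noteq> 0 \<Longrightarrow> transport a z 0 = 0"
  by (simp add: transport_def antideriv_0)

text \<open>Differentiating along the auxiliary vector \<open>b\<close> treats all elements of \<open>ys\<close> alike, which
  makes the symmetry in \<open>ys\<close> immediate.\<close>

definition layer_poly :: "real ^ 'r \<Rightarrow> real ^ 'r \<Rightarrow> (real ^ 'r) list \<Rightarrow> 'r::finite symV \<Rightarrow> 'r symV"
  where "layer_poly a b ys q = dir_deriv b (fold (antideriv a) ys (transport a b q))"

context
  fixes a b :: "real ^ 'r::finite"
  assumes b: "a \<bullet> b \<noteq> 0"
begin

lemma layer_poly_mset:
  assumes "\<forall>y\<in>set ys. a \<bullet> y \<noteq> 0" "mset ys = mset zs"
  shows "layer_poly a b ys q = layer_poly a b zs q"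
proof -
  have "fold (antideriv a) ys = fold (antideriv a) zs"
    using assms by (intro fold_multiset_equiv) (auto simp: antideriv_commute)
  then show ?thesis by (simp add: layer_poly_def)
qed

lemma layer_poly_Nil [simp]: "layer_poly a b [] q = 0"
  by (simp add: layer_poly_def dir_deriv_transport b)

lemma dir_deriv_fold_antideriv:
  assumes "\<forall>y\<in>set ys. a \<bullet> y \<noteq> 0" "a \<bullet> u = 0 \<or> vanishing_on_hyperplane a p"
  shows "dir_deriv u (fold (antideriv a) ys p) = fold (antideriv a) ys (dir_deriv u p)"
  using assms
  by (induction ys arbitrary: p) (auto simp: dir_deriv_antideriv_commute vanishing_antideriv)

text \<open>The auxiliary vector cancels. Differentiating the antiderivative of
  \<open>transport a b q\<close> along \<open>b\<close> gives a polynomial that is constant along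
  \<open>y\<close>, and its boundary values are \<open>(a \<bullet> b) / (a \<bullet> y)\<close>
  times those of \<open>transport a b q\<close>, that is,
  \<open>q / (a \<bullet> y)\<close>.\<close>

lemma layer_poly_Cons:
  assumes "\<forall>y\<in>set (y # ys). a \<bullet> y \<noteq> 0"
  shows "layer_poly a b (y # ys) q = fold (antideriv a) ys (transport a y q)"
proof -
  have y: "a \<bullet> y \<noteq> 0" using assms by simp
  let ?g = "antideriv a y (transport a b q)"
  have "transport a y q = dir_deriv b ?g"
  proof (rule transport_eqI[OF y])
    show "dir_deriv y (dir_deriv b ?g) = 0"
      by (subst dir_deriv_commute) (simp add: dir_deriv_antideriv dir_deriv_transport y b)
    fix x assume x: "a \<bullet> x = 0"
    have "(a \<bullet> y) * peval (dir_deriv b ?g) x = (a \<bullet> b) * peval (transport a b q) x"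
      using vanishing_deriv_proportional[OF vanishing_antideriv[OF y] x, of y b "transport a b q"]
      by (simp add: dir_deriv_antideriv y)
    also have "\<dots> = peval q x"
      by (simp add: peval_transport b x)
    finally show "peval (dir_deriv b ?g) x = peval q x / (a \<bullet> y)"
      using y by (simp add: field_simps)
  qed
  then show ?thesis
    using assms y by (simp add: layer_poly_def dir_deriv_fold_antideriv vanishing_antideriv)
qed

lemma dir_deriv_layer_poly:
  assumes "\<forall>y\<in>set ys. a \<bullet> y \<noteq> 0" "y \<in> set ys"
  shows "dir_deriv y (layer_poly a b ys q) = layer_poly a b (remove1 y ys) q"
proof -
  \<comment> \<open>As \<open>ys\<close> may be permuted, \<open>y\<close> is moved to the end,
    where \<open>fold\<close> makes its antiderivative the outermost one.\<close>
  have "layer_poly a b ys q = layer_poly a b (remove1 y ys @ [y]) q"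
    using assms by (intro layer_poly_mset) auto
  then have "dir_deriv y (layer_poly a b ys q)
      = dir_deriv b (dir_deriv y (antideriv a y (fold (antideriv a) (remove1 y ys) (transport a b q))))"
    by (simp add: layer_poly_def dir_deriv_commute)
  then show ?thesis
    using assms by (simp add: dir_deriv_antideriv layer_poly_def)
qed

lemma dir_deriv_layer_poly_tangent:
  assumes "\<forall>y\<in>set ys. a \<bullet> y \<noteq> 0" "a \<bullet> u = 0"
  shows "dir_deriv u (layer_poly a b ys q) = layer_poly a b ys (dir_deriv u q)"
  using assms b
  by (simp add: layer_poly_def dir_deriv_commute[of u b] dir_deriv_fold_antideriv
      dir_deriv_transport_commute)

lemma layer_poly_0:
  assumes "\<forall>y\<in>set ys. a \<bullet> y \<noteq> 0"
  shows "layer_poly a b ys 0 = 0"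
proof -
  have "fold (antideriv a) ys 0 = 0"
    using assms by (induction ys) (auto simp: antideriv_0)
  then show ?thesis by (simp add: layer_poly_def transport_0 b)
qed

text \<open>With at least two vectors the outermost operation is an antiderivative, which vanishes
  on the hyperplane and hence at 0; a single vector gives only the boundary value of
  \<open>transport\<close>.\<close>

lemma peval_layer_poly_at_0:
  assumes "\<forall>y\<in>set ys. a \<bullet> y \<noteq> 0"
  shows "peval (layer_poly a b ys q) 0 = (if length ys = 1 then peval q 0 / (a \<bullet> hd ys) else 0)"
proof (cases ys)
  case Nil
  then show ?thesis by simp
next
  case (Cons y zs)
  then have eq: "layer_poly a b ys q = fold (antideriv a) zs (transport a y q)"
    using layer_poly_Cons assms by simp
  show ?thesis
  proof (cases zs rule: rev_cases)
    case Nil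
    then show ?thesis using eq Cons assms by (simp add: peval_transport)
  next
    case (snoc ws z)
    then show ?thesis
      using eq Cons assms vanishing_antideriv[of a z] by (simp add: vanishing_on_hyperplane_def)
  qed
qed

end

section \<open>Sublists and positions\<close>

lemma finite_positions: "A \<subseteq> {..<n::nat} \<Longrightarrow> finite A"
  using finite_subset by blast

lemma nths_conv_sorted_positions:
  assumes "A \<subseteq> {..<length X}"
  shows "nths X A = map ((!) X) (sorted_list_of_set A)"
proof -
  have "finite A" using assms by (rule finite_positions)
  have "zip X [0..<length X] = map (\<lambda>i. (X ! i, i)) [0..<length X]"
    by (rule nth_equalityI) auto
  then have "nths X A = map ((!) X) (filter (\<lambda>i. i \<in> A) [0..<length X])"
    by (simp add: nths_def filter_map o_def)
  moreover have "filter (\<lambda>i. i \<in> A) [0..<length X] = sorted_list_of_set A"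
    using assms \<open>finite A\<close> by (intro sorted_distinct_set_unique) (auto simp: sorted_wrt_filter)
  ultimately show ?thesis by simp
qed

lemma mset_nths:
  "A \<subseteq> {..<length X} \<Longrightarrow> mset (nths X A) = image_mset ((!) X) (mset_set A)"
  using finite_positions[of A "length X"] mset_set_set[of "sorted_list_of_set A"]
  by (simp add: nths_conv_sorted_positions)

lemma set_nths_positions: "A \<subseteq> {..<length X} \<Longrightarrow> set (nths X A) = (!) X ` A"
  using finite_positions[of A "length X"] by (simp add: nths_conv_sorted_positions)

lemma list_deriv_insert:
  assumes "insert k A \<subseteq> {..<length X}" "k \<notin> A"
  shows "list_deriv (nths X (insert k A)) f = dir_deriv (X ! k) (list_deriv (nths X A) f)"
proof -
  have "finite A" using assms(1) by (auto intro: finite_positions)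
  then have "mset (nths X (insert k A)) = mset (X ! k # nths X A)"
    using assms by (subst mset_nths) (auto simp: mset_nths)
  from list_deriv_mset[OF this] show ?thesis by simp
qed

lemma list_poly_mset: "mset Y = mset Z \<Longrightarrow> list_poly Y = list_poly Z"
  by (simp add: list_poly_def mset_map prod_mset_prod_list[symmetric])

lemma list_poly_insert:
  assumes "insert k A \<subseteq> {..<length X}" "k \<notin> A"
  shows "list_poly (nths X (insert k A)) = lin_poly (X ! k) * list_poly (nths X A)"
proof -
  have "finite A" using assms(1) by (auto intro: finite_positions)
  then have "mset (nths X (insert k A)) = mset (X ! k # nths X A)"
    using assms by (subst mset_nths) (auto simp: mset_nths)
  from list_poly_mset[OF this] show ?thesis by (simp add: list_poly_def)
qed

lemma list_deriv_superset_eq_0: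
  assumes "list_deriv (nths X L) f = 0" "L \<subseteq> A" "A \<subseteq> {..<length X}"
  shows "list_deriv (nths X A) f = 0"
proof -
  have fin: "finite A" "finite L"
    using assms(2,3) finite_positions[of A] finite_subset[of L A] by auto
  have "mset (nths X A) = mset (nths X (A - L) @ nths X L)"
  proof -
    have "mset_set A = mset_set (A - L) + mset_set L"
      using assms(2) fin mset_set_Union[of "A - L" L] by (auto simp: Un_absorb2)
    moreover have "A - L \<subseteq> {..<length X}" "L \<subseteq> {..<length X}" using assms by auto
    ultimately show ?thesis using assms(3) by (simp add: mset_nths)
  qed
  from list_deriv_mset[OF this, of f] show ?thesis
    by (simp add: list_deriv_append assms(1) linear_0[OF linear_list_deriv])
qed

section \<open>Coordinates with respect to a basis and the flag polynomials\<close>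

lemma filter_eq_single: "distinct xs \<Longrightarrow> x \<in> set xs \<Longrightarrow> filter (\<lambda>u. u = x) xs = [x]"
  by (induction xs) (auto simp: filter_empty_conv)

lemma basis_list_length:
  fixes bs :: "(real ^ 'r::finite) list"
  assumes "is_basis_list bs"
  shows "length bs = CARD('r)"
  using assms dim_eq_card[of "set bs" UNIV]
  by (simp add: is_basis_list_def distinct_card dim_UNIV dim_span)

text \<open>The dual basis vector, obtained by representing the coefficient functional through the
  inner product. It serves as the normal of the hyperplane spanned by the other basis
  vectors.\<close>

definition coord :: "(real ^ 'r) list \<Rightarrow> nat \<Rightarrow> real ^ 'r::finite"
  where "coord bs i = (\<Sum>b\<in>Basis. representation (set bs) b (bs ! i) *\<^sub>R b)"

text \<open>A polynomial on the whole space at every stage; as a density only its values on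
  \<open>span (set (take i bs))\<close> matter.\<close>

primrec flag_poly :: "(real ^ 'r) list \<Rightarrow> (real ^ 'r) list \<Rightarrow> nat \<Rightarrow> 'r::finite symV" where
  "flag_poly bs Z 0 = 1"
| "flag_poly bs Z (Suc i) =
    layer_poly (coord bs i) (bs ! i) (filter (\<lambda>u. u \<in> layer bs i) Z) (flag_poly bs Z i)"

context
  fixes bs :: "(real ^ 'r::finite) list"
  assumes basis: "is_basis_list bs"
begin

lemma basis_independent: "independent (set bs)"
  and basis_span: "span (set bs) = UNIV"
  and basis_distinct: "distinct bs"
  using basis by (auto simp: is_basis_list_def)

lemma coord_eq_representation: "coord bs i \<bullet> x = representation (set bs) x (bs ! i)"
proof -
  have lin: "linear (\<lambda>x. representation (set bs) x (bs ! i))"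
    by (rule linearI) (simp_all add: representation_add representation_scale basis_independent basis_span)
  have "representation (set bs) x (bs ! i)
      = (\<Sum>b\<in>Basis. (x \<bullet> b) * representation (set bs) b (bs ! i))"
    by (subst euclidean_representation[of x, symmetric])
      (simp add: linear_sum[OF lin] linear_scale[OF lin])
  also have "\<dots> = coord bs i \<bullet> x"
    by (simp add: coord_def inner_sum_left inner_commute[of x] mult.commute)
  finally show ?thesis by simp
qed

lemma coord_basis: "i < length bs \<Longrightarrow> j < length bs \<Longrightarrow> coord bs i \<bullet> (bs ! j) = (if i = j then 1 else 0)"
  by (simp add: coord_eq_representation representation_basis basis_independent
      nth_eq_iff_index_eq[OF basis_distinct] eq_commute)

lemma coord_expansion: "x = (\<Sum>j<length bs. (coord bs j \<bullet> x) *\<^sub>R bs ! j)"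
proof -
  have "(\<Sum>b\<in>set bs. representation (set bs) x b *\<^sub>R b) = x"
    by (rule sum_representation_eq) (auto simp: basis_independent basis_span)
  moreover have "(\<Sum>b\<in>set bs. representation (set bs) x b *\<^sub>R b)
      = (\<Sum>j<length bs. representation (set bs) x (bs ! j) *\<^sub>R bs ! j)"
    by (rule sum.reindex_bij_betw[OF bij_betw_nth[OF basis_distinct refl refl], symmetric])
  ultimately show ?thesis by (simp add: coord_eq_representation)
qed

lemma span_take_iff:
  assumes "i \<le> length bs"
  shows "x \<in> span (set (take i bs)) \<longleftrightarrow> (\<forall>j. i \<le> j \<and> j < length bs \<longrightarrow> coord bs j \<bullet> x = 0)"
proof
  assume "x \<in> span (set (take i bs))"
  then show "\<forall>j. i \<le> j \<and> j < length bs \<longrightarrow> coord bs j \<bullet> x = 0"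
  proof (induction rule: span_induct)
    case base
    show ?case by (rule subspaceI) (auto simp: inner_add_right)
  next
    case (step x)
    then show ?case using assms by (auto simp: in_set_conv_nth coord_basis)
  qed
next
  assume *: "\<forall>j. i \<le> j \<and> j < length bs \<longrightarrow> coord bs j \<bullet> x = 0"
  have "(\<Sum>j<length bs. (coord bs j \<bullet> x) *\<^sub>R bs ! j) \<in> span (set (take i bs))"
  proof (rule span_sum)
    fix j assume j: "j \<in> {..<length bs}"
    show "(coord bs j \<bullet> x) *\<^sub>R bs ! j \<in> span (set (take i bs))"
    proof (cases "j < i")
      case True
      then have "bs ! j \<in> set (take i bs)"
        using j assms by (auto simp: in_set_conv_nth)
      then show ?thesis by (intro span_scale span_base)
    next
      case False
      then show ?thesis using * j by (simp add: span_zero)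
    qed
  qed
  then show "x \<in> span (set (take i bs))"
    using coord_expansion[of x] by simp
qed

lemma layer_iff:
  assumes "i < length bs"
  shows "x \<in> layer bs i \<longleftrightarrow>
    coord bs i \<bullet> x \<noteq> 0 \<and> (\<forall>j. i < j \<and> j < length bs \<longrightarrow> coord bs j \<bullet> x = 0)"
proof -
  have "Suc i \<le> length bs" "i \<le> length bs" using assms by auto
  then show ?thesis
    unfolding layer_def Diff_iff span_take_iff[OF \<open>Suc i \<le> length bs\<close>]
      span_take_iff[OF \<open>i \<le> length bs\<close>] Suc_le_eq
    using assms by (metis le_neq_implies_less less_imp_le order_refl)
qed

lemma layer_nz: "i < length bs \<Longrightarrow> x \<in> layer bs i \<Longrightarrow> coord bs i \<bullet> x \<noteq> 0"
  by (simp add: layer_iff)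

lemma layer_unique:
  assumes "i < length bs" "j < length bs" "x \<in> layer bs i" "x \<in> layer bs j"
  shows "i = j"
  using assms by (metis layer_iff linorder_neqE_nat)

lemma layer_exists:
  assumes "x \<noteq> 0"
  obtains i where "i < length bs" "x \<in> layer bs i"
proof -
  \<comment> \<open>The layer of \<open>x\<close> is the index of its last nonzero
    coordinate.\<close>
  define I where "I = {j. j < length bs \<and> coord bs j \<bullet> x \<noteq> 0}"
  have "I \<noteq> {}"
  proof
    assume "I = {}"
    then have "x = (\<Sum>j<length bs. 0 *\<^sub>R bs ! j)"
      by (subst coord_expansion) (intro sum.cong, auto simp: I_def)
    with assms show False by simp
  qed
  moreover have "finite I" by (simp add: I_def)
  ultimately obtain m where m: "m \<in> I" and max: "\<And>j. j \<in> I \<Longrightarrow> j \<le> m"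
    using Max_in Max_ge by metis
  have "coord bs j \<bullet> x = 0" if "m < j" "j < length bs" for j
  proof (rule ccontr)
    assume "coord bs j \<bullet> x \<noteq> 0"
    then have "j \<in> I" using that by (simp add: I_def)
    then show False using max[of j] that(1) by simp
  qed
  with m have "m < length bs \<and> x \<in> layer bs m"
    by (auto simp: layer_iff I_def)
  then show thesis using that by blast
qed

lemma basis_in_layer: "i < length bs \<Longrightarrow> bs ! i \<in> layer bs i"
  by (auto simp: layer_iff coord_basis)

lemma flag_poly_cong:
  assumes "n \<le> length bs"
    and "\<And>i. i < n \<Longrightarrow> mset (filter (\<lambda>u. u \<in> layer bs i) Y) = mset (filter (\<lambda>u. u \<in> layer bs i) Z)"
  shows "flag_poly bs Y n = flag_poly bs Z n"
  using assms
proof (induction n)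
  case (Suc n)
  have "flag_poly bs Y n = flag_poly bs Z n" using Suc by simp
  moreover have "layer_poly (coord bs n) (bs ! n) (filter (\<lambda>u. u \<in> layer bs n) Y) q
      = layer_poly (coord bs n) (bs ! n) (filter (\<lambda>u. u \<in> layer bs n) Z) q" for q
    using Suc.prems by (intro layer_poly_mset) (auto simp: coord_basis layer_nz)
  ultimately show ?case by simp
qed simp

lemma flag_poly_empty_layer:
  assumes "i < n" "n \<le> length bs" "filter (\<lambda>u. u \<in> layer bs i) Z = []"
  shows "flag_poly bs Z n = 0"
  using assms(1,2)
proof (induction n)
  case (Suc n)
  show ?case
  proof (cases "i = n")
    case True
    then show ?thesis using assms(3) Suc.prems by (simp add: coord_basis)
  next
    case False
    then have "flag_poly bs Z n = 0" using Suc by simp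
    then show ?thesis using Suc.prems by (simp add: layer_poly_0 coord_basis layer_nz)
  qed
qed simp

text \<open>For the layers above \<open>i\<close> the vector \<open>u\<close> is tangent to the
  hyperplane, so the derivative passes inwards to stage \<open>i\<close>; there it undoes the
  antiderivative along \<open>u\<close>.\<close>

lemma dir_deriv_flag_poly:
  assumes "i < n" "n \<le> length bs" "u \<in> layer bs i" "u \<in> set Z"
  shows "dir_deriv u (flag_poly bs Z n) = flag_poly bs (remove1 u Z) n"
  using assms(1,2)
proof (induction n)
  case (Suc n)
  let ?L = "\<lambda>j Z. filter (\<lambda>u. u \<in> layer bs j) Z"
  have other: "?L j (remove1 u Z) = ?L j Z" if "j < length bs" "j \<noteq> i" for j
  proof -
    have "u \<notin> layer bs j" using layer_unique[of i j u] that assms Suc.prems by auto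
    then show ?thesis by (simp add: filter_remove1 remove1_idem)
  qed
  have n: "n < length bs" using Suc.prems by simp
  show ?case
  proof (cases "i = n")
    case True
    have "flag_poly bs (remove1 u Z) n = flag_poly bs Z n"
      using True Suc.prems by (intro flag_poly_cong) (simp_all add: other)
    moreover have "dir_deriv u (layer_poly (coord bs n) (bs ! n) (?L n Z) q)
        = layer_poly (coord bs n) (bs ! n) (remove1 u (?L n Z)) q" for q
      using True assms n by (intro dir_deriv_layer_poly) (auto simp: coord_basis layer_nz)
    ultimately show ?thesis by (simp add: filter_remove1)
  next
    case False
    have "coord bs n \<bullet> u = 0"
      using False assms Suc.prems by (simp add: layer_iff)
    then have "dir_deriv u (layer_poly (coord bs n) (bs ! n) (?L n Z) q)
        = layer_poly (coord bs n) (bs ! n) (?L n Z) (dir_deriv u q)" for q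
      using n by (intro dir_deriv_layer_poly_tangent) (auto simp: coord_basis layer_nz)
    then show ?thesis using Suc False by (simp add: other)
  qed
qed simp

lemma peval_flag_poly_at_0:
  assumes "n \<le> length bs" "i < n" "length (filter (\<lambda>u. u \<in> layer bs i) Z) \<noteq> 1"
  shows "peval (flag_poly bs Z n) 0 = 0"
  using assms
proof (induction n)
  case (Suc n)
  have "peval (flag_poly bs Z n) 0 = 0 \<or> i = n"
    using Suc by (cases "i = n") auto
  moreover have "\<forall>y\<in>set (filter (\<lambda>u. u \<in> layer bs n) Z). coord bs n \<bullet> y \<noteq> 0"
    using Suc.prems by (auto simp: layer_nz)
  moreover have "coord bs n \<bullet> bs ! n \<noteq> 0"
    using Suc.prems by (simp add: coord_basis)
  ultimately show ?case
    using Suc.prems(3) by (auto simp: peval_layer_poly_at_0)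
qed simp

lemma flag_poly_basis_at_0: "n \<le> length bs \<Longrightarrow> peval (flag_poly bs bs n) 0 = 1"
proof (induction n)
  case (Suc n)
  have n: "n < length bs" using Suc.prems by simp
  have "filter (\<lambda>u. u \<in> layer bs n) bs = filter (\<lambda>u. u = bs ! n) bs"
    using n layer_unique basis_in_layer by (intro filter_cong) (auto simp: in_set_conv_nth)
  also have "\<dots> = [bs ! n]"
    using n basis_distinct by (simp add: filter_eq_single)
  finally have "filter (\<lambda>u. u \<in> layer bs n) bs = [bs ! n]" .
  then show ?case
    using Suc n by (simp add: peval_layer_poly_at_0 coord_basis)
qed simp

end

section \<open>The pairing of \<open>Q_poly\<close> with flag polynomials\<close>

text \<open>A zero vector lies in no layer, and its derivative annihilates instead of deleting; all
  other vectors are deleted one after the other.\<close>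

lemma list_deriv_flag_poly:
  fixes X :: "(real ^ 'r::finite) list"
  assumes bs: "is_basis_list bs" and A: "A \<subseteq> {..<length X}" and L: "L \<subseteq> A"
    and nz: "\<And>k. k \<in> L \<Longrightarrow> X ! k \<noteq> 0"
  shows "list_deriv (nths X L) (flag_poly bs (nths X A) (length bs))
    = flag_poly bs (nths X (A - L)) (length bs)"
proof -
  have "finite L" using finite_positions[of L "length X"] A L by auto
  then show ?thesis using L nz
  proof (induction L rule: finite_induct)
    case (insert k L)
    then have k: "k \<in> A - L" "X ! k \<noteq> 0" by auto
    obtain i where i: "i < length bs" "X ! k \<in> layer bs i"
      using layer_exists[OF bs k(2)] .
    have pos: "A - L \<subseteq> {..<length X}" "insert k L \<subseteq> {..<length X}" "A - insert k L \<subseteq> {..<length X}"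
      using A insert.prems by auto
    have fin: "finite (A - insert k L)" using pos(3) by (rule finite_positions)
    have "mset_set (A - L) = add_mset k (mset_set (A - insert k L))"
    proof -
      have "A - L = insert k (A - insert k L)" "k \<notin> A - insert k L" using k(1) by blast+
      then show ?thesis using mset_set.insert[OF fin] by metis
    qed
    then have "mset (nths X (A - L)) = add_mset (X ! k) (mset (nths X (A - insert k L)))"
      by (simp only: mset_nths[OF pos(1)] mset_nths[OF pos(3)] image_mset_add_mset)
    \<comment> \<open>\<open>remove1\<close> may delete an equal vector at another position, so the
      two lists agree only as multisets; this suffices for \<open>flag_poly\<close>.\<close>
    then have "mset (remove1 (X ! k) (nths X (A - L))) = mset (nths X (A - insert k L))"
      by simp
    then have "flag_poly bs (remove1 (X ! k) (nths X (A - L))) (length bs)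
        = flag_poly bs (nths X (A - insert k L)) (length bs)"
      by (intro flag_poly_cong[OF bs]) (simp_all add: mset_filter)
    moreover have "X ! k \<in> set (nths X (A - L))"
      using k pos by (auto simp: set_nths_positions)
    ultimately show ?case
      using insert pos i by (simp add: list_deriv_insert dir_deriv_flag_poly[OF bs])
  qed simp
qed

section \<open>Positions, bases and external activity\<close>

lemma bases_span: "B \<in> bases X \<Longrightarrow> span ((!) X ` B) = UNIV"
  by (auto simp: bases_def is_basis_list_def set_nths_positions)

lemma bases_subset: "B \<in> bases X \<Longrightarrow> B \<subseteq> {..<length X}"
  by (simp add: bases_def)

lemma bases_not_in_span:
  assumes B: "B \<in> bases X" and "k \<in> B" "C \<subseteq> B - {k}"
  shows "X ! k \<notin> span ((!) X ` C)"
proof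
  assume span: "X ! k \<in> span ((!) X ` C)"
  have fin: "finite B" and sub: "B \<subseteq> {..<length X}"
    using B finite_positions by (auto simp: bases_def)
  have "distinct (map ((!) X) (sorted_list_of_set B))"
    using B nths_conv_sorted_positions[OF sub] by (simp add: bases_def is_basis_list_def)
  moreover have "independent ((!) X ` B)"
    using B set_nths_positions[OF sub] by (simp add: bases_def is_basis_list_def)
  ultimately have inj: "inj_on ((!) X) B" and ind: "independent ((!) X ` B)"
    using fin by (simp_all add: distinct_map)
  have "(!) X ` C \<subseteq> (!) X ` B - {X ! k}"
    using assms inj by (auto simp: inj_on_def)
  then have "X ! k \<in> span ((!) X ` B - {X ! k})"
    using span span_mono by blast
  then show False using ind \<open>k \<in> B\<close> by (auto simp: dependent_def)
qed

lemma not_in_basis_if_in_span_earlier: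
  assumes "B \<in> bases X" "X ! k \<in> span ((!) X ` {j \<in> B. j < k})"
  shows "k \<notin> B"
proof
  assume "k \<in> B"
  from bases_not_in_span[OF assms(1) this, of "{j \<in> B. j < k}"] show False
    using assms(2) by auto
qed

lemma ext_active_iff:
  "k \<in> ext_active X B \<longleftrightarrow>
    k < length X \<and> k \<notin> B \<and> X ! k \<in> span ((!) X ` {j \<in> B. j < k})"
proof -
  have "{X ! j | j. j \<in> B \<and> j < k} = (!) X ` {j \<in> B. j < k}" by auto
  then show ?thesis by (auto simp: ext_active_def)
qed

lemma in_span_of_earlier:
  assumes "k \<in> B \<union> ext_active X B" "k < x"
  shows "X ! k \<in> span ((!) X ` {j \<in> B. j < x})"
proof (cases "k \<in> B")
  case True
  then show ?thesis using assms by (auto intro: span_base)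
next
  case False
  then have "X ! k \<in> span ((!) X ` {j \<in> B. j < k})"
    using assms by (auto simp: ext_active_iff)
  moreover have "(!) X ` {j \<in> B. j < k} \<subseteq> (!) X ` {j \<in> B. j < x}"
    using assms by auto
  ultimately show ?thesis using span_mono by blast
qed

lemma span_scale_cancel:
  fixes v :: "'a::real_vector"
  shows "c *\<^sub>R v \<in> span S \<Longrightarrow> c \<noteq> 0 \<Longrightarrow> v \<in> span S"
  using span_scale[of "c *\<^sub>R v" S "1 / c"] by simp

text \<open>One vector per layer gives a triangular system over \<open>bs\<close> with nonzero
  diagonal entries \<open>c\<close>, which is solved from below.\<close>

lemma span_take_le_span_triangular:
  fixes bs :: "(real ^ 'r::finite) list"
  assumes bs: "is_basis_list bs" and "n \<le> length bs"
    and y: "\<And>j. j < n \<Longrightarrow> y j \<in> layer bs j"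
  shows "span (set (take n bs)) \<subseteq> span (y ` {..<n})"
  using assms(2,3)
proof (induction n)
  case (Suc n)
  have n: "n < length bs" using Suc.prems by simp
  define c where "c = coord bs n \<bullet> y n"
  have c: "c \<noteq> 0" unfolding c_def using layer_nz[OF bs n] Suc.prems by simp
  have sub: "span (y ` {..<n}) \<subseteq> span (y ` {..<Suc n})" by (intro span_mono) auto
  have IH: "span (set (take n bs)) \<subseteq> span (y ` {..<Suc n})"
    using Suc sub by force
  have "y n - c *\<^sub>R bs ! n \<in> span (set (take n bs))"
    using Suc.prems(2)[of n] n
    by (auto simp: span_take_iff[OF bs] layer_iff[OF bs] inner_diff_right coord_basis[OF bs] c_def le_less)
  then have "y n - c *\<^sub>R bs ! n \<in> span (y ` {..<Suc n})"
    using IH by blast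
  moreover have "y n \<in> span (y ` {..<Suc n})"
    by (intro span_base) simp
  ultimately have "y n - (y n - c *\<^sub>R bs ! n) \<in> span (y ` {..<Suc n})"
    by (metis span_diff)
  then have "c *\<^sub>R bs ! n \<in> span (y ` {..<Suc n})" by simp
  then have "bs ! n \<in> span (y ` {..<Suc n})" using c by (rule span_scale_cancel)
  moreover have "set (take n bs) \<subseteq> span (y ` {..<Suc n})"
    using IH span_superset by blast
  ultimately have "set (take (Suc n) bs) \<subseteq> span (y ` {..<Suc n})"
    using n by (simp add: take_Suc_conv_app_nth)
  then show ?case by (rule span_minimal) simp
qed simp

locale flag_of_basis =
  fixes X :: "(real ^ 'r::{finite,linorder}) list" and D :: "nat set"
  assumes D: "D \<in> bases X"
begin

abbreviation "bs \<equiv> nths X D"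
abbreviation "r \<equiv> length bs"

definition pos :: "nat \<Rightarrow> nat"
  where "pos i = sorted_list_of_set D ! i"

definition layer_pos :: "nat \<Rightarrow> nat set"
  where "layer_pos i = {k. k < length X \<and> k \<notin> ext_active X D \<and> X ! k \<in> layer bs i}"

abbreviation "Z \<equiv> {..<length X} - ext_active X D"

lemma basis: "is_basis_list bs" and D_sub: "D \<subseteq> {..<length X}"
  using D by (auto simp: bases_def)

lemma finite_D: "finite D"
  using D_sub by (rule finite_positions)

lemma length_bs: "r = card D"
  using D_sub by (simp add: nths_conv_sorted_positions)

lemma bs_nth: "i < r \<Longrightarrow> bs ! i = X ! pos i"
  using D_sub by (simp add: nths_conv_sorted_positions pos_def)

lemma pos_in: "i < r \<Longrightarrow> pos i \<in> D"
  using nth_mem[of i "sorted_list_of_set D"] finite_D by (simp add: pos_def length_bs)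

lemma pos_surj: "k \<in> D \<Longrightarrow> \<exists>i<r. k = pos i"
  using finite_D set_sorted_list_of_set[OF finite_D]
  by (metis in_set_conv_nth length_bs length_sorted_list_of_set pos_def)

lemma pos_less_iff: "i < r \<Longrightarrow> j < r \<Longrightarrow> pos i < pos j \<longleftrightarrow> i < j"
  using sorted_wrt_nth_less[OF strict_sorted_list_of_set[of D]]
  by (metis length_bs length_sorted_list_of_set less_asym linorder_neqE_nat pos_def)

lemma pos_le_iff: "i < r \<Longrightarrow> j < r \<Longrightarrow> pos i \<le> pos j \<longleftrightarrow> i \<le> j"
  using pos_less_iff[of j i] by auto

text \<open>An element of layer \<open>i\<close> behind the \<open>i\<close>-th basis vector has all
  the basis vectors that it needs in front of it, so it would be externally active. Thus the basis
  vector is the last survivor of its layer.\<close>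

lemma layer_pos_le:
  assumes "i < r" "k \<in> layer_pos i"
  shows "k \<le> pos i"
proof (rule ccontr)
  assume "\<not> k \<le> pos i"
  then have gt: "pos i < k" by simp
  have k: "k < length X" "k \<notin> ext_active X D" "X ! k \<in> layer bs i"
    using assms by (auto simp: layer_pos_def)
  show False
  proof (cases "k \<in> D")
    case True
    then obtain j where j: "j < r" "k = pos j" using pos_surj by blast
    then have "X ! k \<in> layer bs j"
      using basis_in_layer[OF basis j(1)] by (simp add: bs_nth)
    then have "i = j" using layer_unique[OF basis] assms j k by blast
    then show False using gt j by simp
  next
    case False
    have "set (take (Suc i) bs) \<subseteq> (!) X ` {j \<in> D. j < k}"
    proof
      fix u assume "u \<in> set (take (Suc i) bs)"
      then obtain j where j: "j < Suc i" "j < r" "u = bs ! j"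
        by (auto simp: in_set_conv_nth)
      then have "pos j < k" using gt pos_le_iff[of j i] assms by simp
      then show "u \<in> (!) X ` {j \<in> D. j < k}" using j by (auto simp: bs_nth pos_in)
    qed
    moreover have "X ! k \<in> span (set (take (Suc i) bs))"
      using k by (simp add: layer_def)
    ultimately have "X ! k \<in> span ((!) X ` {j \<in> D. j < k})"
      using span_mono by blast
    then show False using k False by (simp add: ext_active_iff)
  qed
qed

text \<open>Up to the position of the \<open>i\<close>-th basis vector only the earlier basis
  vectors are available, and their span misses layer \<open>i\<close>.\<close>

lemma ext_active_gt:
  assumes "i < r" "x \<in> ext_active X D" "X ! x \<in> layer bs i"
  shows "pos i < x"
proof (rule ccontr)
  assume "\<not> pos i < x"
  then have le: "x \<le> pos i" by simp
  have "(!) X ` {j \<in> D. j < x} \<subseteq> set (take i bs)"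
  proof
    fix u assume "u \<in> (!) X ` {j \<in> D. j < x}"
    then obtain j where j: "j < r" "pos j < x" "u = X ! pos j" using pos_surj by blast
    then have "j < i" using le pos_less_iff[of j i] assms by simp
    then show "u \<in> set (take i bs)" using j by (auto simp: in_set_conv_nth bs_nth)
  qed
  from span_mono[OF this] have "X ! x \<in> span (set (take i bs))"
    using assms(2) unfolding ext_active_iff by blast
  then show False using assms(3) by (simp add: layer_def)
qed

lemma pos_in_layer_pos: "i < r \<Longrightarrow> pos i \<in> layer_pos i"
  using basis_in_layer[OF basis, of i] pos_in[of i] D_sub
  by (auto simp: layer_pos_def bs_nth ext_active_def)

context
  fixes B y
  assumes B: "B \<in> bases X"
    and y: "\<And>i. i < r \<Longrightarrow> y i \<in> layer_pos i" "\<And>i. i < r \<Longrightarrow> y i \<in> B \<union> ext_active X B"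
begin

lemma y_layer: "i < r \<Longrightarrow> X ! y i \<in> layer bs i"
  using y(1) by (simp add: layer_pos_def)

text \<open>The chosen vectors span the flag of \<open>D\<close> by triangularity, and each of them
  lies in the span of the elements of \<open>B\<close> up to its own position.\<close>

lemma span_take_subset:
  assumes i: "i < r" and less: "\<And>j. j \<le> i \<Longrightarrow> y j < x"
  shows "span (set (take (Suc i) bs)) \<subseteq> span ((!) X ` {j \<in> B. j < x})"
proof -
  have "span (set (take (Suc i) bs)) \<subseteq> span ((\<lambda>j. X ! y j) ` {..<Suc i})"
    using i y_layer by (intro span_take_le_span_triangular[OF basis]) auto
  also have "\<dots> \<subseteq> span ((!) X ` {j \<in> B. j < x})"
  proof (rule span_minimal)
    show "(\<lambda>j. X ! y j) ` {..<Suc i} \<subseteq> span ((!) X ` {j \<in> B. j < x})"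
    proof safe
      fix j assume j: "j < Suc i"
      have "y j \<in> B \<union> ext_active X B" by (rule y(2)) (use i j in simp)
      then show "X ! y j \<in> span ((!) X ` {j \<in> B. j < x})"
        by (rule in_span_of_earlier) (use less j in simp)
    qed
  qed simp
  finally show ?thesis .
qed

text \<open>If \<open>x\<close> is active for \<open>D\<close> and lies in layer \<open>i\<close>,
  then \<open>y j \<le> pos j \<le> pos i < x\<close> for all \<open>j \<le> i\<close>. Hence the
  part of \<open>B\<close> in front of \<open>x\<close> already spans the flag up to layer
  \<open>i\<close>, and with it \<open>X ! x\<close>.\<close>

lemma ext_active_transfer:
  assumes x: "x \<in> ext_active X D"
  shows "x \<in> ext_active X B \<and> x \<notin> B"
proof -
  have "X ! x \<in> span ((!) X ` {j \<in> B. j < x})"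
  \<comment> \<open>The zero vector lies in no layer, but in every span.\<close>
  proof (cases "X ! x = 0")
    case False
    then obtain i where i: "i < r" "X ! x \<in> layer bs i"
      using layer_exists[OF basis] by blast
    have "y j < x" if "j \<le> i" for j
    proof -
      have "y j \<le> pos j" using layer_pos_le[of j "y j"] y(1)[of j] that i by simp
      also have "\<dots> \<le> pos i" using pos_le_iff[of j i] that i by simp
      also have "\<dots> < x" using ext_active_gt i x by blast
      finally show ?thesis .
    qed
    then have "span (set (take (Suc i) bs)) \<subseteq> span ((!) X ` {j \<in> B. j < x})"
      using span_take_subset i by blast
    moreover have "X ! x \<in> span (set (take (Suc i) bs))" using i by (simp add: layer_def)
    ultimately show ?thesis by blast
  qed (simp add: span_zero)
  moreover from this have "x \<notin> B" by (rule not_in_basis_if_in_span_earlier[OF B])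
  ultimately show ?thesis using x by (simp add: ext_active_iff)
qed

lemma card_B: "card B = r"
  using basis_list_length[OF basis] basis_list_length[of "nths X B"] B bases_subset[OF B]
  by (simp add: bases_def nths_conv_sorted_positions)

text \<open>No element of \<open>B\<close> is active for \<open>D\<close>, so each is the unique
  survivor of its layer, and counting gives that \<open>B\<close> is the set of all
  \<open>y i\<close>. If \<open>y i\<close> differed from \<open>pos i\<close>, all choices up to
  layer \<open>i\<close> would come before \<open>pos i\<close>; then \<open>pos i\<close> would be
  active for \<open>B\<close> and a second survivor in layer \<open>i\<close>.\<close>

lemma eq_basis_of_singletons:
  assumes single: "\<And>i. i < r \<Longrightarrow> layer_pos i \<inter> (B \<union> ext_active X B) = {y i}"
  shows "B = D"
proof -
  have "B \<subseteq> y ` {..<r}"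
  proof
    fix k assume k: "k \<in> B"
    have "X ! k \<noteq> 0"
      using bases_not_in_span[OF B k, of "{}"] by auto
    then obtain i where i: "i < r" "X ! k \<in> layer bs i"
      using layer_exists[OF basis] by blast
    have "k \<notin> ext_active X D" using ext_active_transfer k by blast
    then have "k \<in> layer_pos i" using i k bases_subset[OF B] by (auto simp: layer_pos_def)
    then show "k \<in> y ` {..<r}" using single[OF i(1)] k i by auto
  qed
  moreover have "card (y ` {..<r}) \<le> card B"
    using card_image_le[of "{..<r}" y] by (simp add: card_B)
  ultimately have B_eq: "B = y ` {..<r}"
    by (intro card_seteq) auto
  have "y i = pos i" if i: "i < r" for i
  proof (rule ccontr)
    assume neq: "y i \<noteq> pos i"
    have "y j < pos i" if "j \<le> i" for j
    proof (cases "j = i")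
      case True
      then show ?thesis using neq layer_pos_le[OF i y(1)[OF i]] by simp
    next
      case False
      then have "j < r" "pos j < pos i" using that i pos_less_iff[of j i] by auto
      then show ?thesis using layer_pos_le[of j "y j"] y(1)[of j] by simp
    qed
    then have "span (set (take (Suc i) bs)) \<subseteq> span ((!) X ` {j \<in> B. j < pos i})"
      using span_take_subset i by blast
    moreover have "X ! pos i \<in> span (set (take (Suc i) bs))"
      using basis_in_layer[OF basis i] i by (simp add: layer_def bs_nth)
    ultimately have *: "X ! pos i \<in> span ((!) X ` {j \<in> B. j < pos i})" by blast
    then have "pos i \<notin> B" by (rule not_in_basis_if_in_span_earlier[OF B])
    then have "pos i \<in> ext_active X B" using * pos_in[OF i] D_sub by (auto simp: ext_active_iff)
    then have "pos i \<in> layer_pos i \<inter> (B \<union> ext_active X B)"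
      using pos_in_layer_pos[OF i] by blast
    then show False using single[OF i] neq by simp
  qed
  then have "y ` {..<r} = pos ` {..<r}" by simp
  also have "\<dots> = D" using pos_in pos_surj by auto
  finally show ?thesis using B_eq by simp
qed

end

lemma filter_layer_nths:
  assumes "A \<subseteq> {..<length X}" "A \<inter> ext_active X D = {}"
  shows "length (filter (\<lambda>u. u \<in> layer bs i) (nths X A)) = card (layer_pos i \<inter> A)"
proof -
  have "filter (\<lambda>u. u \<in> layer bs i) (nths X A)
      = map ((!) X) (filter (\<lambda>k. X ! k \<in> layer bs i) (sorted_list_of_set A))"
    using assms by (simp add: nths_conv_sorted_positions filter_map o_def)
  moreover have "layer_pos i \<inter> A = set (filter (\<lambda>k. X ! k \<in> layer bs i) (sorted_list_of_set A))"
    using assms finite_positions[OF assms(1)] by (auto simp: layer_pos_def)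
  ultimately show ?thesis
    by (simp only: length_map) (rule distinct_card[symmetric], simp)
qed

lemma list_deriv_contains_layer:
  assumes "i < r" "layer_pos i \<subseteq> C" "C \<subseteq> {..<length X}"
  shows "list_deriv (nths X C) (flag_poly bs (nths X Z) r) = 0"
proof (rule list_deriv_superset_eq_0)
  have "X ! k \<noteq> 0" if "k \<in> layer_pos i" for k
    using that span_zero[of "set (take i bs)"] by (auto simp: layer_pos_def layer_def)
  then have "list_deriv (nths X (layer_pos i)) (flag_poly bs (nths X Z) r)
      = flag_poly bs (nths X (Z - layer_pos i)) r"
    by (intro list_deriv_flag_poly[OF basis]) (auto simp: layer_pos_def)
  also have "\<dots> = 0"
  proof (rule flag_poly_empty_layer[OF basis assms(1) order_refl])
    have "length (filter (\<lambda>u. u \<in> layer bs i) (nths X (Z - layer_pos i)))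
        = card (layer_pos i \<inter> (Z - layer_pos i))"
      by (rule filter_layer_nths) auto
    then show "filter (\<lambda>u. u \<in> layer bs i) (nths X (Z - layer_pos i)) = []" by simp
  qed
  finally show "list_deriv (nths X (layer_pos i)) (flag_poly bs (nths X Z) r) = 0" .
qed (use assms in auto)

lemma pairing_Q_poly_flag_poly:
  assumes B: "B \<in> bases X"
  shows "pairing (Q_poly X B) (flag_poly bs (nths X Z) r) = (if B = D then 1 else 0)"
proof -
  define W where "W = {..<length X} - (B \<union> ext_active X B)"
  have W: "pairing (Q_poly X B) f = peval (list_deriv (nths X W) f) 0" for f
    by (simp add: Q_poly_def pairing_list_poly W_def)
  have W_nz: "X ! k \<noteq> 0" if "k \<in> W" for k
    using that by (auto simp: W_def ext_active_iff span_zero)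
  show ?thesis
  proof (cases "B = D")
    case True
    have "list_deriv (nths X W) (flag_poly bs (nths X Z) r) = flag_poly bs (nths X (Z - W)) r"
      using True by (intro list_deriv_flag_poly[OF basis]) (auto simp: W_def W_nz[unfolded W_def])
    also have "Z - W = D"
      using True D_sub by (auto simp: W_def ext_active_def)
    finally have "pairing (Q_poly X B) (flag_poly bs (nths X Z) r) = 1"
      unfolding W by (simp add: flag_poly_basis_at_0[OF basis])
    then show ?thesis using True by simp
  next
    case False
    have "peval (list_deriv (nths X W) (flag_poly bs (nths X Z) r)) 0 = 0"
    proof (cases "\<exists>i<r. layer_pos i \<subseteq> W")
      case True
      then show ?thesis using list_deriv_contains_layer[of _ W] by (auto simp: W_def)
    next
      case no_layer: False
      have "\<exists>k. k \<in> layer_pos i \<inter> (B \<union> ext_active X B)" if "i < r" for i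
        using no_layer that by (fastforce simp: W_def layer_pos_def)
      then obtain y where y: "\<And>i. i < r \<Longrightarrow> y i \<in> layer_pos i"
        "\<And>i. i < r \<Longrightarrow> y i \<in> B \<union> ext_active X B"
        by (metis Int_iff)
      have "W \<subseteq> Z"
        using ext_active_transfer[OF B y] by (auto simp: W_def)
      then have eq: "list_deriv (nths X W) (flag_poly bs (nths X Z) r) = flag_poly bs (nths X (Z - W)) r"
        by (intro list_deriv_flag_poly[OF basis]) (auto simp: W_nz)
      obtain i where i: "i < r" "layer_pos i \<inter> (B \<union> ext_active X B) \<noteq> {y i}"
        using eq_basis_of_singletons[OF B y] False by blast
      have "layer_pos i \<inter> (Z - W) = layer_pos i \<inter> (B \<union> ext_active X B)"
        by (auto simp: layer_pos_def W_def)
      moreover have "y i \<in> layer_pos i \<inter> (B \<union> ext_active X B)"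
        using y i(1) by blast
      ultimately have "card (layer_pos i \<inter> (Z - W)) \<noteq> 1"
        using i(2) by (metis card_1_singletonE singletonD)
      then have "length (filter (\<lambda>u. u \<in> layer bs i) (nths X (Z - W))) \<noteq> 1"
        by (subst filter_layer_nths) auto
      then show ?thesis
        unfolding eq using i by (intro peval_flag_poly_at_0[OF basis]) auto
    qed
    then show ?thesis using False by (simp add: W)
  qed
qed

end

section \<open>Greedy bases and cocircuits\<close>

text \<open>The lexicographically first basis inside \<open>A\<close>. Its virtue is that every
  discarded position of \<open>A\<close> is externally active for it.\<close>

definition greedy :: "'a::real_vector list \<Rightarrow> nat set \<Rightarrow> nat set"
  where "greedy X A = {k \<in> A. X ! k \<notin> span ((!) X ` {j \<in> A. j < k})}"

lemma span_greedy_below: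
  "span ((!) X ` {j \<in> greedy X A. j < n}) = span ((!) X ` {j \<in> A. j < n})"
proof (induction n)
  case (Suc n)
  have A: "{j \<in> A. j < Suc n} = (if n \<in> A then insert n {j \<in> A. j < n} else {j \<in> A. j < n})"
    by (auto simp: less_Suc_eq)
  have G: "{j \<in> greedy X A. j < Suc n}
      = (if n \<in> greedy X A then insert n {j \<in> greedy X A. j < n} else {j \<in> greedy X A. j < n})"
    by (auto simp: less_Suc_eq)
  show ?case
  proof (cases "n \<in> A \<and> n \<notin> greedy X A")
    case True
    then have "X ! n \<in> span ((!) X ` {j \<in> A. j < n})" by (simp add: greedy_def)
    then show ?thesis using True Suc unfolding A G by (simp add: span_redundant)
  next
    case False
    then have "n \<in> A \<longleftrightarrow> n \<in> greedy X A" by (auto simp: greedy_def)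
    then show ?thesis using Suc unfolding A G by (simp add: span_insert)
  qed
qed simp

lemma greedy_independent:
  "independent ((!) X ` {j \<in> greedy X A. j < n}) \<and> inj_on ((!) X) {j \<in> greedy X A. j < n}"
proof (induction n)
  case (Suc n)
  have G: "{j \<in> greedy X A. j < Suc n}
      = (if n \<in> greedy X A then insert n {j \<in> greedy X A. j < n} else {j \<in> greedy X A. j < n})"
    by (auto simp: less_Suc_eq)
  show ?case
  proof (cases "n \<in> greedy X A")
    case True
    then have n: "X ! n \<notin> span ((!) X ` {j \<in> greedy X A. j < n})"
      by (simp add: span_greedy_below) (simp add: greedy_def)
    then have notin: "X ! n \<notin> (!) X ` {j \<in> greedy X A. j < n}"
      by (meson span_base)
    have "n \<notin> {j \<in> greedy X A. j < n}" by simp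
    then show ?thesis using Suc n True notin unfolding G
      by (simp only: if_True image_insert inj_on_insert Diff_insert0 Diff_empty independent_insert) simp
  next
    case False
    then show ?thesis using Suc unfolding G by simp
  qed
qed (simp add: independent_empty)

lemma greedy_in_bases:
  assumes A: "A \<subseteq> {..<length X}" and span: "span ((!) X ` A) = UNIV"
  shows "greedy X A \<in> bases X"
proof -
  have sub: "greedy X A \<subseteq> A" by (auto simp: greedy_def)
  have all: "{j \<in> greedy X A. j < length X} = greedy X A" "{j \<in> A. j < length X} = A"
    using A sub by auto
  have pos: "greedy X A \<subseteq> {..<length X}" using A sub by auto
  have "independent ((!) X ` greedy X A)" "inj_on ((!) X) (greedy X A)"
    using greedy_independent[of X A "length X"] unfolding all by auto
  moreover have "span ((!) X ` greedy X A) = UNIV"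
    using span_greedy_below[of X A "length X"] span unfolding all by simp
  moreover have "finite (greedy X A)" using finite_positions[OF pos] .
  ultimately show ?thesis
    using pos set_nths_positions[OF pos]
    by (simp add: bases_def is_basis_list_def nths_conv_sorted_positions distinct_map)
qed

text \<open>A basis avoiding \<open>Y\<close> would lie in the complement and make it span. A subset
  of least cardinality that still meets all bases is minimal for inclusion.\<close>

lemma contains_cocircuit:
  assumes Y: "Y \<subseteq> {..<length X}" and nspan: "span ((!) X ` ({..<length X} - Y)) \<noteq> UNIV"
  obtains C where "C \<in> cocircuits X" "C \<subseteq> Y"
proof -
  have "meets_all_bases X Y"
  proof -
    have False if "J \<in> bases X" "Y \<inter> J = {}" for J
    proof -
      have "J \<subseteq> {..<length X} - Y" using that bases_subset by blast
      then have "span ((!) X ` J) \<subseteq> span ((!) X ` ({..<length X} - Y))"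
        by (intro span_mono) auto
      then show False using bases_span[OF that(1)] nspan by auto
    qed
    then show ?thesis using Y by (auto simp: meets_all_bases_def)
  qed
  then have "\<exists>C. C \<subseteq> Y \<and> meets_all_bases X C" by blast
  then obtain C where C: "C \<subseteq> Y" "meets_all_bases X C"
    and min: "\<And>C'. C' \<subseteq> Y \<and> meets_all_bases X C' \<Longrightarrow> card C \<le> card C'"
    using exists_least_iff[of "\<lambda>n. \<exists>C. C \<subseteq> Y \<and> meets_all_bases X C \<and> card C = n"]
    by (metis linorder_not_less)
  have "\<not> meets_all_bases X C'" if "C' \<subset> C" for C'
  proof
    assume "meets_all_bases X C'"
    then have "card C \<le> card C'" using min that C(1) by blast
    moreover have "card C' < card C"
      using that C(1) Y finite_positions[of C "length X"] by (intro psubset_card_mono) auto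
    ultimately show False by simp
  qed
  then show thesis using C that by (auto simp: cocircuits_def)
qed

lemma cocircuit_complement_not_spanning:
  assumes "C \<in> cocircuits X"
  shows "span ((!) X ` ({..<length X} - C)) \<noteq> UNIV"
proof
  assume "span ((!) X ` ({..<length X} - C)) = UNIV"
  then have "greedy X ({..<length X} - C) \<in> bases X"
    by (intro greedy_in_bases) auto
  moreover have "C \<inter> greedy X ({..<length X} - C) = {}" by (auto simp: greedy_def)
  ultimately show False using assms by (auto simp: cocircuits_def meets_all_bases_def)
qed

lemma (in flag_of_basis) flag_poly_in_DM_space: "flag_poly bs (nths X Z) r \<in> DM_space X"
proof -
  have "list_deriv (nths X C) (flag_poly bs (nths X Z) r) = 0" if C: "C \<in> cocircuits X" for C
  proof -
    have C_sub: "C \<subseteq> {..<length X}"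
      using C by (auto simp: cocircuits_def meets_all_bases_def)
    define H where "H = span ((!) X ` ({..<length X} - C))"
    have "\<exists>i<r. bs ! i \<notin> H"
    proof (rule ccontr)
      assume "\<not> ?thesis"
      then have "set bs \<subseteq> H" by (auto simp: in_set_conv_nth)
      then have "span (set bs) \<subseteq> H" unfolding H_def by (rule span_minimal) simp
      then show False
        using basis_span[OF basis] cocircuit_complement_not_spanning[OF C] by (auto simp: H_def)
    qed
    then obtain i where i: "i < r" "bs ! i \<notin> H" and min: "\<And>j. j < i \<Longrightarrow> bs ! j \<in> H"
      using exists_least_iff[of "\<lambda>i. i < r \<and> bs ! i \<notin> H"] by (meson order.strict_trans)
    have "set (take i bs) \<subseteq> H" using min by (auto simp: in_set_conv_nth)
    then have take_sub: "span (set (take i bs)) \<subseteq> H" unfolding H_def by (rule span_minimal) simp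
    have "layer_pos i \<subseteq> C"
    proof
      fix k assume k: "k \<in> layer_pos i"
      show "k \<in> C"
      proof (rule ccontr)
        assume "k \<notin> C"
        then have kH: "X ! k \<in> H"
          using k by (auto simp: H_def layer_pos_def intro!: span_base)
        \<comment> \<open>Modulo the earlier basis vectors, which lie in \<open>H\<close>, the
          vector \<open>X ! k\<close> is a nonzero multiple of \<open>bs ! i\<close>; so
          \<open>X ! k \<in> H\<close> would force \<open>bs ! i \<in> H\<close>.\<close>
        define c where "c = coord bs i \<bullet> X ! k"
        have c: "c \<noteq> 0" using k layer_nz[OF basis i(1)] by (simp add: c_def layer_pos_def)
        have "X ! k - c *\<^sub>R bs ! i \<in> span (set (take i bs))"
          using k i
          by (auto simp: span_take_iff[OF basis] layer_pos_def layer_iff[OF basis] inner_diff_right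
              coord_basis[OF basis] c_def le_less)
        then have "X ! k - c *\<^sub>R bs ! i \<in> H" using take_sub by blast
        then have "X ! k - (X ! k - c *\<^sub>R bs ! i) \<in> H"
          using kH unfolding H_def by (metis span_diff)
        then have "c *\<^sub>R bs ! i \<in> H" by simp
        then have "bs ! i \<in> H" using c unfolding H_def by (rule span_scale_cancel)
        then show False using i by simp
      qed
    qed
    then show ?thesis using list_deriv_contains_layer i C_sub by blast
  qed
  then show ?thesis by (simp add: DM_space_def)
qed

section \<open>The spaces spanned by the two families\<close>

lemma span_image_sum:
  assumes "finite A" "v \<in> span (f ` A)"
  obtains c where "v = (\<Sum>a\<in>A. c a *\<^sub>R f a)"
proof -
  let ?S = "{v. \<exists>c. v = (\<Sum>a\<in>A. c a *\<^sub>R f a)}"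
  have "span (f ` A) \<subseteq> ?S"
  proof (rule span_minimal)
    show "f ` A \<subseteq> ?S"
    proof safe
      fix a assume "a \<in> A"
      then have "f a = (\<Sum>b\<in>A. (if b = a then 1 else 0) *\<^sub>R f b)"
        using assms(1) by (simp add: if_distrib[of "\<lambda>c. c *\<^sub>R f b" for b] cong: if_cong)
      then show "\<exists>c. f a = (\<Sum>b\<in>A. c b *\<^sub>R f b)" by (intro exI[of _ "\<lambda>b. if b = a then 1 else 0"])
    qed
    show "subspace ?S"
    proof (rule subspaceI)
      show "0 \<in> ?S" by (auto intro!: exI[of _ "\<lambda>_. 0"])
    next
      fix x y assume "x \<in> ?S" "y \<in> ?S"
      then obtain c d where "x = (\<Sum>a\<in>A. c a *\<^sub>R f a)" "y = (\<Sum>a\<in>A. d a *\<^sub>R f a)" by auto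
      then have "x + y = (\<Sum>a\<in>A. (c a + d a) *\<^sub>R f a)"
        by (simp add: scaleR_add_left sum.distrib)
      then show "x + y \<in> ?S" by (intro CollectI exI[of _ "\<lambda>a. c a + d a"])
    next
      fix x and t :: real assume "x \<in> ?S"
      then obtain c where "x = (\<Sum>a\<in>A. c a *\<^sub>R f a)" by auto
      then have "t *\<^sub>R x = (\<Sum>a\<in>A. (t * c a) *\<^sub>R f a)" by (simp add: scaleR_sum_right)
      then show "t *\<^sub>R x \<in> ?S" by (intro CollectI exI[of _ "\<lambda>a. t * c a"])
    qed
  qed
  then show thesis using assms(2) that by blast
qed

lemma linear_lin_poly: "linear lin_poly"
  by (intro linearI; rule peval_inject)
    (simp_all add: peval_lin_poly peval_add peval_scaleR inner_add_left)

text \<open>A straightening argument whose measure is the sum of the positions in \<open>Y\<close>.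
  Let \<open>B\<close> be the greedy basis of the complement. If \<open>Y\<close> contains no
  element active for \<open>B\<close>, then \<open>Y\<close> is exactly the index set of
  \<open>Q_poly X B\<close>. Otherwise an active \<open>x\<close> in \<open>Y\<close> is expanded in
  earlier elements \<open>j\<close> of \<open>B\<close>, and exchanging \<open>x\<close> for
  \<open>j < x\<close> lowers the sum.\<close>

lemma list_poly_in_span_Q_poly:
  fixes X :: "(real ^ 'r::finite) list"
  assumes "Y \<subseteq> {..<length X}" "span ((!) X ` ({..<length X} - Y)) = UNIV"
  shows "list_poly (nths X Y) \<in> span (Q_poly X ` bases X)"
  using assms
proof (induction "\<Sum>Y" arbitrary: Y rule: less_induct)
  case less
  define A where "A = {..<length X} - Y"
  define B where "B = greedy X A"
  have B: "B \<in> bases X" unfolding B_def A_def by (rule greedy_in_bases) (use less.prems in auto)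
  have BA: "B \<subseteq> A" by (auto simp: B_def greedy_def)
  have finY: "finite Y" using less.prems finite_positions by blast
  have "A \<subseteq> B \<union> ext_active X B"
  proof
    fix k assume k: "k \<in> A"
    show "k \<in> B \<union> ext_active X B"
    proof (cases "k \<in> B")
      case False
      then have "X ! k \<in> span ((!) X ` {j \<in> A. j < k})" using k by (simp add: B_def greedy_def)
      then show ?thesis
        using False k by (simp add: ext_active_iff B_def span_greedy_below) (simp add: A_def)
    qed simp
  qed
  show ?case
  proof (cases "Y \<inter> ext_active X B = {}")
    case True
    then have "Y = {..<length X} - (B \<union> ext_active X B)"
      using \<open>A \<subseteq> B \<union> ext_active X B\<close> BA less.prems by (auto simp: A_def)
    then show ?thesis using B by (auto simp: Q_poly_def intro!: span_base)
  next
    case False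
    then obtain x where x: "x \<in> Y" "x \<in> ext_active X B" by blast
    define E where "E = {j \<in> B. j < x}"
    have finE: "finite E" using finite_positions[OF bases_subset[OF B]] by (simp add: E_def)
    have "X ! x \<in> span ((!) X ` E)" using x by (simp add: ext_active_iff E_def)
    then obtain c where c: "X ! x = (\<Sum>j\<in>E. c j *\<^sub>R X ! j)"
      using span_image_sum[OF finE] by blast
    have "list_poly (nths X Y) = list_poly (nths X (insert x (Y - {x})))"
      using x by (simp add: insert_absorb)
    also have "\<dots> = lin_poly (X ! x) * list_poly (nths X (Y - {x}))"
      by (rule list_poly_insert) (use x less.prems in auto)
    also have "\<dots> = (\<Sum>j\<in>E. c j *\<^sub>R (lin_poly (X ! j) * list_poly (nths X (Y - {x}))))"
      unfolding c by (simp add: linear_sum[OF linear_lin_poly] linear_scale[OF linear_lin_poly]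
          sum_distrib_right scaleR_mult_left)
    also have "\<dots> \<in> span (Q_poly X ` bases X)"
    proof (rule span_sum)
      fix j assume j: "j \<in> E"
      then have j': "j \<in> B" "j < x" "j \<in> A" "j \<notin> Y" "j < length X"
        using BA by (auto simp: E_def A_def)
      define Y' where "Y' = insert j (Y - {x})"
      have Y': "Y' \<subseteq> {..<length X}" using less.prems j' by (auto simp: Y'_def)
      have eq: "lin_poly (X ! j) * list_poly (nths X (Y - {x})) = list_poly (nths X Y')"
        unfolding Y'_def by (rule list_poly_insert[symmetric]) (use j' less.prems in auto)
      show "c j *\<^sub>R (lin_poly (X ! j) * list_poly (nths X (Y - {x}))) \<in> span (Q_poly X ` bases X)"
      proof (cases "c j = 0")
        case False
        have "\<Sum>Y' < \<Sum>Y"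
        proof -
          have "\<Sum>Y = x + \<Sum>(Y - {x})" using finY x by (simp add: sum.remove)
          moreover have "\<Sum>Y' = j + \<Sum>(Y - {x})" using finY j' by (simp add: Y'_def)
          ultimately show ?thesis using j' by simp
        qed
        \<comment> \<open>The complement loses \<open>j\<close> and gains \<open>x\<close>. As
          \<open>c j \<noteq> 0\<close>, the relation can be solved for \<open>X ! j\<close>, so the
          complement still spans.\<close>
        moreover have "span ((!) X ` ({..<length X} - Y')) = UNIV"
        proof -
          let ?S = "span ((!) X ` ({..<length X} - Y'))"
          have x_in: "X ! x \<in> ?S"
            using x j' by (intro span_base) (auto simp: Y'_def ext_active_iff)
          have "(\<Sum>i\<in>E - {j}. c i *\<^sub>R X ! i) \<in> ?S"
            using BA x by (intro span_sum span_scale span_base) (auto simp: E_def A_def Y'_def)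
          with x_in have "X ! x - (\<Sum>i\<in>E - {j}. c i *\<^sub>R X ! i) \<in> ?S" by (rule span_diff)
          also have "X ! x - (\<Sum>i\<in>E - {j}. c i *\<^sub>R X ! i) = c j *\<^sub>R X ! j"
            unfolding c using finE j by (simp add: sum.remove)
          finally have j_in: "X ! j \<in> ?S" using False by (rule span_scale_cancel)
          have "X ! k \<in> ?S" if "k \<in> A" for k
            using that j_in by (cases "k = j") (auto simp: A_def Y'_def intro!: span_base)
          then have "(!) X ` A \<subseteq> ?S" by blast
          then have "span ((!) X ` A) \<subseteq> ?S" by (rule span_minimal) simp
          then show ?thesis using less.prems by (auto simp: A_def)
        qed
        ultimately show ?thesis
          unfolding eq using less.hyps Y' by (intro span_scale) blast
      qed (simp add: span_zero)
    qed
    finally show ?thesis .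
  qed
qed

lemma span_Q_poly: "span (Q_poly X ` bases X) = P_space X"
proof
  show "P_space X \<subseteq> span (Q_poly X ` bases X)"
    unfolding P_space_def
    by (rule span_minimal) (auto simp: set_nths_positions intro!: list_poly_in_span_Q_poly)
  have "Q_poly X B \<in> P_space X" if B: "B \<in> bases X" for B
  proof -
    let ?Y = "{..<length X} - (B \<union> ext_active X B)"
    have "span ((!) X ` B) \<subseteq> span (set (nths X ({..<length X} - ?Y)))"
      using bases_subset[OF B] by (intro span_mono) (auto simp: set_nths_positions)
    then have "span (set (nths X ({..<length X} - ?Y))) = UNIV"
      using bases_span[OF B] by auto
    then show ?thesis
      unfolding P_space_def Q_poly_def by (intro span_base) auto
  qed
  then show "span (Q_poly X ` bases X) \<subseteq> P_space X"
    unfolding P_space_def by (intro span_minimal) auto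
qed

section \<open>Nondegeneracy of the pairing and dual families\<close>

lemma constant_if_dir_derivs_0:
  assumes "\<And>u. dir_deriv u g = 0" "peval g 0 = 0"
  shows "g = 0"
proof (rule peval_eq_0_imp)
  fix x
  have "((\<lambda>t. peval g (0 + t *\<^sub>R x)) has_real_derivative 0) (at t)" for t
    using peval_line_deriv[of g 0 x t UNIV] assms(1) by simp
  then have "peval g (0 + 1 *\<^sub>R x) = peval g (0 + 0 *\<^sub>R x)"
    using DERIV_isconst_all[of "\<lambda>t. peval g (0 + t *\<^sub>R x)"] by blast
  then show "peval g x = 0" using assms(2) by simp
qed

lemma DM_space_P_space_nondegenerate:
  fixes X :: "(real ^ 'r::{finite,linorder}) list"
  assumes X: "span (set X) = UNIV" and f: "f \<in> DM_space X"
    and P: "\<And>p. p \<in> P_space X \<Longrightarrow> pairing p f = 0"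
  shows "f = 0"
proof -
  have "list_deriv (nths X Y) f = 0" if "Y \<subseteq> {..<length X}" for Y
    using that
  proof (induction "length X - card Y" arbitrary: Y rule: less_induct)
    case less
    let ?S = "span ((!) X ` ({..<length X} - Y))"
    show ?case
    proof (cases "?S = UNIV")
      case False
      obtain C where C: "C \<in> cocircuits X" "C \<subseteq> Y"
        using contains_cocircuit[OF less.prems False] .
      then have "list_deriv (nths X C) f = 0" using f by (simp add: DM_space_def)
      then show ?thesis using C(2) less.prems by (rule list_deriv_superset_eq_0)
    next
      case True
      let ?g = "list_deriv (nths X Y) f"
      have finY: "finite Y" using less.prems finite_positions by blast
      have "dir_deriv (X ! k) ?g = 0" if "k \<in> {..<length X} - Y" for k
      proof -
        have sub: "insert k Y \<subseteq> {..<length X}" using that less.prems by auto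
        have "card (insert k Y) \<le> length X"
          using card_mono[OF _ sub] by simp
        then have "length X - card (insert k Y) < length X - card Y"
          using that finY by simp
        then have "list_deriv (nths X (insert k Y)) f = 0"
          using less.hyps sub by blast
        then show ?thesis using list_deriv_insert[OF sub] that by simp
      qed
      then have "(!) X ` ({..<length X} - Y) \<subseteq> {u. dir_deriv u ?g = 0}" by auto
      then have "?S \<subseteq> {u. dir_deriv u ?g = 0}"
        by (rule span_minimal)
          (auto intro!: subspaceI simp: linear_0[OF linear_dir_deriv_dir] linear_add[OF linear_dir_deriv_dir]
            linear_scale[OF linear_dir_deriv_dir])
      then have "dir_deriv u ?g = 0" for u using True by blast
      moreover have "peval ?g 0 = 0"
      proof -
        have "list_poly (nths X Y) \<in> P_space X"
          unfolding P_space_def using less.prems True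
          by (intro span_base) (auto simp: set_nths_positions)
        then show ?thesis using P by (simp flip: pairing_list_poly)
      qed
      ultimately show ?thesis by (rule constant_if_dir_derivs_0)
    qed
  qed
  from this[of "{}"] show ?thesis by simp
qed

lemma independent_if_dual:
  assumes lin: "\<And>i. i \<in> I \<Longrightarrow> linear (\<phi> i :: 'a::real_vector \<Rightarrow> real)"
    and dual: "\<And>i j. i \<in> I \<Longrightarrow> j \<in> I \<Longrightarrow> \<phi> i (v j) = (if i = j then 1 else 0)"
  shows "independent (v ` I)"
  unfolding dependent_def
proof safe
  fix i assume i: "i \<in> I" and span: "v i \<in> span (v ` I - {v i})"
  have "v ` I - {v i} \<subseteq> {x. \<phi> i x = 0}" using i by (auto simp: dual)
  then have "span (v ` I - {v i}) \<subseteq> {x. \<phi> i x = 0}"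
    by (rule span_minimal)
      (auto intro!: subspaceI simp: linear_0[OF lin[OF i]] linear_add[OF lin[OF i]] linear_scale[OF lin[OF i]])
  then show False using span i dual[of i i] by auto
qed

text \<open>Spanning needs no count of dimensions: duality gives the expected expansion of
  \<open>f\<close>, and nondegeneracy shows that the remainder is 0. The family \<open>F\<close> is
  kept abstract so that the algebra is independent of how the dual polynomials arise from
  distributions.\<close>

lemma dual_bases_from_flag_polys:
  fixes X :: "(real ^ 'r::{finite,linorder}) list"
  assumes X: "span (set X) = UNIV"
    and F: "\<And>D. D \<in> bases X \<Longrightarrow>
      F D = flag_poly (nths X D) (nths X ({..<length X} - ext_active X D)) (length (nths X D))"
  shows "independent (F ` bases X) \<and> span (F ` bases X) = DM_space X
    \<and> independent (Q_poly X ` bases X) \<and> span (Q_poly X ` bases X) = P_space X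
    \<and> (\<forall>B\<in>bases X. \<forall>D\<in>bases X. pairing (Q_poly X B) (F D) = (if B = D then 1 else 0))"
proof -
  have dual: "pairing (Q_poly X B) (F D) = (if B = D then 1 else 0)"
    if "B \<in> bases X" "D \<in> bases X" for B D
    using flag_of_basis.pairing_Q_poly_flag_poly[OF flag_of_basis.intro[OF that(2)] that(1)] F[OF that(2)]
    by simp
  have F_in: "F D \<in> DM_space X" if "D \<in> bases X" for D
    using flag_of_basis.flag_poly_in_DM_space[OF flag_of_basis.intro[OF that]] F[OF that] by simp
  have subspace: "subspace (DM_space X)"
    by (rule subspaceI) (auto simp: DM_space_def linear_0[OF linear_list_deriv]
        linear_add[OF linear_list_deriv] linear_scale[OF linear_list_deriv])
  have fin: "finite (bases X)"
    by (rule finite_subset[of _ "Pow {..<length X}"]) (auto simp: bases_def)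
  have "f \<in> span (F ` bases X)" if f: "f \<in> DM_space X" for f
  proof -
    \<comment> \<open>The coefficients are forced by duality; with them \<open>f - s\<close> is
      orthogonal to every \<open>Q_poly X B\<close>.\<close>
    define s where "s = (\<Sum>D\<in>bases X. pairing (Q_poly X D) f *\<^sub>R F D)"
    have s: "s \<in> span (F ` bases X)"
      unfolding s_def by (intro span_sum span_scale span_base) auto
    have "span (F ` bases X) \<subseteq> DM_space X"
      using F_in by (intro span_minimal subspace) auto
    then have diff: "f - s \<in> DM_space X"
      using s f subspace subspace_diff by blast
    have "pairing (Q_poly X B) (f - s) = 0" if "B \<in> bases X" for B
      using that fin
      by (simp add: linear_diff[OF linear_pairing_right] s_def linear_sum[OF linear_pairing_right]
          linear_scale[OF linear_pairing_right] dual if_distrib cong: if_cong)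
    then have "Q_poly X ` bases X \<subseteq> {p. pairing p (f - s) = 0}" by auto
    then have "span (Q_poly X ` bases X) \<subseteq> {p. pairing p (f - s) = 0}"
      by (rule span_minimal)
        (auto intro!: subspaceI simp: linear_0[OF linear_pairing_left] linear_add[OF linear_pairing_left]
          linear_scale[OF linear_pairing_left])
    then have "f - s = 0"
      by (intro DM_space_P_space_nondegenerate[OF X diff]) (auto simp: span_Q_poly)
    then show ?thesis using s by simp
  qed
  moreover have "span (F ` bases X) \<subseteq> DM_space X"
    using F_in by (intro span_minimal subspace) auto
  moreover have "independent (F ` bases X)"
    by (rule independent_if_dual[where \<phi> = "\<lambda>B. pairing (Q_poly X B)"])
      (auto simp: linear_pairing_right dual)
  moreover have "independent (Q_poly X ` bases X)"
    by (rule independent_if_dual[where \<phi> = "\<lambda>D p. pairing p (F D)"])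
      (auto simp: linear_pairing_left dual)
  ultimately show ?thesis using dual span_Q_poly[of X] by blast
qed

section \<open>Smooth cutoff functions\<close>

text \<open>The powers of \<open>1 / t\<close> close the family under differentiation.\<close>

definition flat_exp :: "nat \<Rightarrow> real \<Rightarrow> real"
  where "flat_exp k t = (if t > 0 then (1 / t) ^ k * exp (- 1 / t) else 0)"

lemma flat_exp_tendsto_0: "(flat_exp k \<longlongrightarrow> 0) (at_right 0)"
proof -
  have "((\<lambda>t. inverse t ^ k / exp (inverse t)) \<longlongrightarrow> (0::real)) (at_right 0)"
    by (rule filterlim_compose[OF tendsto_power_div_exp_0 filterlim_inverse_at_top_right])
  then show ?thesis
    by (rule Lim_transform_eventually)
      (auto simp: flat_exp_def eventually_at_filter exp_minus field_simps)
qed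

lemma DERIV_flat_exp:
  "(flat_exp k has_real_derivative (flat_exp (k + 2) t - real k * flat_exp (k + 1) t)) (at t)"
proof -
  consider "t > 0" | "t = 0" | "t < 0" by linarith
  then show ?thesis
  proof cases
    case 1
    have "((\<lambda>t. (1 / t) ^ k * exp (- 1 / t)) has_real_derivative
        (flat_exp (k + 2) t - real k * flat_exp (k + 1) t)) (at t)"
    proof -
      have inv: "((\<lambda>t. 1 / t) has_real_derivative - ((1 / t)\<^sup>2)) (at t)"
        using 1 by (auto intro!: derivative_eq_intros simp: power2_eq_square)
      have "real k * (- (x\<^sup>2) * x ^ (k - Suc 0)) = - real k * x ^ (k + 1)" for x :: real
        by (cases k) (simp_all add: power2_eq_square algebra_simps)
      with DERIV_power[OF inv, of k]
      have "((\<lambda>t. (1 / t) ^ k) has_real_derivative - real k * (1 / t) ^ (k + 1)) (at t)"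
        by metis
      moreover have "((\<lambda>t. exp (- 1 / t)) has_real_derivative exp (- 1 / t) * (1 / t)\<^sup>2) (at t)"
        using 1 by (auto intro!: derivative_eq_intros simp: power2_eq_square)
      ultimately have "((\<lambda>t. (1 / t) ^ k * exp (- 1 / t)) has_real_derivative
          - real k * (1 / t) ^ (k + 1) * exp (- 1 / t) + exp (- 1 / t) * (1 / t)\<^sup>2 * (1 / t) ^ k) (at t)"
        by (rule DERIV_mult)
      moreover have "- real k * (1 / t) ^ (k + 1) * exp (- 1 / t) + exp (- 1 / t) * (1 / t)\<^sup>2 * (1 / t) ^ k
          = flat_exp (k + 2) t - real k * flat_exp (k + 1) t"
        using 1 by (simp add: flat_exp_def power2_eq_square mult_ac)
      ultimately show ?thesis by simp
    qed
    moreover have ev: "\<forall>\<^sub>F x in nhds t. (1 / x) ^ k * exp (- 1 / x) = flat_exp k x"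
      using eventually_nhds_in_open[of "{0<..}" t] 1
      by (auto elim!: eventually_mono simp: flat_exp_def)
    ultimately show ?thesis
      using DERIV_cong_ev[OF refl ev refl] by simp
  next
    case 2
    \<comment> \<open>To the left of 0 the difference quotient is 0, to the right it is
      \<open>flat_exp (Suc k)\<close>.\<close>
    have "((\<lambda>h. (flat_exp k (0 + h) - flat_exp k 0) / h) \<longlongrightarrow> 0) (at 0)"
      unfolding filterlim_at_split
    proof
      show "((\<lambda>h. (flat_exp k (0 + h) - flat_exp k 0) / h) \<longlongrightarrow> 0) (at_left 0)"
        by (rule Lim_transform_eventually[OF tendsto_const])
          (auto simp: eventually_at_filter flat_exp_def)
      show "((\<lambda>h. (flat_exp k (0 + h) - flat_exp k 0) / h) \<longlongrightarrow> 0) (at_right 0)"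
        by (rule Lim_transform_eventually[OF flat_exp_tendsto_0[of "Suc k"]])
          (auto simp: eventually_at_filter flat_exp_def)
    qed
    then show ?thesis using 2 by (simp add: DERIV_def flat_exp_def)
  next
    case 3
    have ev: "\<forall>\<^sub>F x in nhds t. 0 = flat_exp k x"
      using eventually_nhds_in_open[of "{..<0}" t] 3
      by (auto elim!: eventually_mono simp: flat_exp_def)
    moreover have "((\<lambda>x. 0) has_real_derivative (flat_exp (k + 2) t - real k * flat_exp (k + 1) t)) (at t)"
      using 3 by (simp add: flat_exp_def)
    ultimately show ?thesis
      using DERIV_cong_ev[OF refl ev refl] by simp
  qed
qed

text \<open>A family of explicit expressions closed under directional derivatives.
  \<open>C_k\<close> for all \<open>k\<close> follows by a plain induction, and the family is rich
  enough to write down bump functions.\<close>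

inductive smooth_class :: "('a::real_inner \<Rightarrow> real) \<Rightarrow> bool" where
  const: "smooth_class (\<lambda>x. c)"
| inner: "smooth_class (\<lambda>x. x \<bullet> v)"
| inner_self: "smooth_class (\<lambda>x. x \<bullet> x)"
| add: "smooth_class f \<Longrightarrow> smooth_class g \<Longrightarrow> smooth_class (\<lambda>x. f x + g x)"
| mult: "smooth_class f \<Longrightarrow> smooth_class g \<Longrightarrow> smooth_class (\<lambda>x. f x * g x)"
| flat_exp: "smooth_class f \<Longrightarrow> smooth_class (\<lambda>x. flat_exp k (f x))"
| inverse: "smooth_class f \<Longrightarrow> (\<And>x. f x \<noteq> 0) \<Longrightarrow> smooth_class (\<lambda>x. inverse (f x))"

lemma smooth_class_derivative:
  assumes "smooth_class f"
  shows "\<exists>f'. (\<forall>x. (f has_derivative f' x) (at x)) \<and> (\<forall>v. smooth_class (\<lambda>x. f' x v))"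
  using assms
proof induction
  case (const c)
  show ?case
    by (rule exI[of _ "\<lambda>x v. 0"]) (auto intro: smooth_class.intros)
next
  case (inner v)
  show ?case
    by (rule exI[of _ "\<lambda>x w. w \<bullet> v"]) (auto intro!: derivative_eq_intros intro: smooth_class.intros)
next
  case inner_self
  have "smooth_class (\<lambda>x. 2 * (x \<bullet> v))" for v :: 'a
    by (rule smooth_class.mult[OF smooth_class.const smooth_class.inner])
  then show ?case
    by (intro exI[of _ "\<lambda>x v. 2 * (x \<bullet> v)"])
      (auto intro!: derivative_eq_intros simp: inner_commute)
next
  case (add f g)
  then obtain f' g' where
    "\<forall>x. (f has_derivative f' x) (at x)" "\<forall>v. smooth_class (\<lambda>x. f' x v)"
    "\<forall>x. (g has_derivative g' x) (at x)" "\<forall>v. smooth_class (\<lambda>x. g' x v)" by metis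
  then show ?case
    by (intro exI[of _ "\<lambda>x v. f' x v + g' x v"])
      (auto intro!: has_derivative_add smooth_class.add)
next
  case (mult f g)
  then obtain f' g' where
    d: "\<forall>x. (f has_derivative f' x) (at x)" "\<forall>v. smooth_class (\<lambda>x. f' x v)"
    "\<forall>x. (g has_derivative g' x) (at x)" "\<forall>v. smooth_class (\<lambda>x. g' x v)" by metis
  have "\<forall>x. ((\<lambda>x. f x * g x) has_derivative (\<lambda>v. f x * g' x v + f' x v * g x)) (at x)"
    using d by (intro allI has_derivative_mult) auto
  moreover have "\<forall>v. smooth_class (\<lambda>x. f x * g' x v + f' x v * g x)"
    using d mult.hyps by (auto intro!: smooth_class.add smooth_class.mult)
  ultimately show ?case by (intro exI[of _ "\<lambda>x v. f x * g' x v + f' x v * g x"]) auto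
next
  case (flat_exp f k)
  then obtain f' where
    d: "\<forall>x. (f has_derivative f' x) (at x)" "\<forall>v. smooth_class (\<lambda>x. f' x v)" by metis
  let ?D = "\<lambda>x. flat_exp (k + 2) (f x) + (- real k) * flat_exp (k + 1) (f x)"
  have "((\<lambda>x. flat_exp k (f x)) has_derivative (\<lambda>v. ?D x * f' x v)) (at x)" for x
  proof -
    have "(flat_exp k has_derivative (\<lambda>h. ?D x * h)) (at (f x))"
      using DERIV_flat_exp[of k "f x"] by (simp add: has_field_derivative_def)
    from has_derivative_compose[OF d(1)[rule_format] this] show ?thesis .
  qed
  moreover have "smooth_class (\<lambda>x. ?D x * f' x v)" for v
    using d flat_exp.hyps
    by (intro smooth_class.mult smooth_class.add smooth_class.flat_exp smooth_class.const) auto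
  ultimately show ?case by (intro exI[of _ "\<lambda>x v. ?D x * f' x v"]) auto
next
  case (inverse f)
  then obtain f' where
    d: "\<forall>x. (f has_derivative f' x) (at x)" "\<forall>v. smooth_class (\<lambda>x. f' x v)" by metis
  let ?D = "\<lambda>x v. - 1 * (inverse (f x) * f' x v * inverse (f x))"
  have "((\<lambda>x. inverse (f x)) has_derivative ?D x) (at x)" for x
    using Deriv.has_derivative_inverse[OF inverse.hyps(2) d(1)[rule_format]] by simp
  moreover have "smooth_class (\<lambda>x. ?D x v)" for v
    using d inverse.hyps
    by (intro smooth_class.mult smooth_class.inverse smooth_class.const) auto
  ultimately show ?case by (intro exI[of _ ?D]) auto
qed

lemma smooth_class_C_k: "smooth_class f \<Longrightarrow> C_k k f"
proof (induction k arbitrary: f)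
  case 0
  then obtain f' where "\<forall>x. (f has_derivative f' x) (at x)"
    using smooth_class_derivative by metis
  then show ?case
    using has_derivative_continuous by (force intro!: continuous_at_imp_continuous_on)
next
  case (Suc k)
  then obtain f' where d: "\<forall>x. (f has_derivative f' x) (at x)" "\<forall>v. smooth_class (\<lambda>x. f' x v)"
    using smooth_class_derivative by metis
  have "frechet_derivative f (at x) = f' x" for x
    using d(1) frechet_derivative_at by metis
  then show ?case using d Suc.IH by (auto simp: differentiable_def)
qed

lemma compact_supp:
  fixes f :: "'a::heine_borel \<Rightarrow> real"
  shows "bounded {x. f x \<noteq> 0} \<Longrightarrow> compact (supp f)"
  by (simp add: supp_def compact_eq_bounded_closed bounded_closure)

lemma smooth_cutoff_exists:
  fixes K :: "'a::euclidean_space set"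
  assumes "bounded K"
  shows "\<exists>\<eta> W. test_fun \<eta> \<and> open W \<and> K \<subseteq> W \<and> (\<forall>z\<in>W. \<eta> z = 1)"
proof -
  obtain R where R: "\<And>z. z \<in> K \<Longrightarrow> norm z \<le> R" "R > 0"
    using assms bounded_normE by metis
  \<comment> \<open>\<open>f\<close> is positive exactly for
    \<open>z \<bullet> z < R\<^sup>2 + 2\<close>, \<open>g\<close> exactly for
    \<open>z \<bullet> z > R\<^sup>2 + 1\<close>. These sets cover the space, so
    \<open>f / (f + g)\<close> is defined everywhere; it is 1 where \<open>g\<close> vanishes and 0
    where \<open>f\<close> vanishes.\<close>
  define f where "f = (\<lambda>z::'a. flat_exp 0 (R\<^sup>2 + 2 + (- 1) * (z \<bullet> z)))"
  define g where "g = (\<lambda>z::'a. flat_exp 0 (z \<bullet> z + (- R\<^sup>2 - 1)))"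
  have f: "smooth_class f" and g: "smooth_class g"
    unfolding f_def g_def by (intro smooth_class.intros)+
  have pos: "f z + g z > 0" for z
    by (auto simp: f_def g_def flat_exp_def intro: add_pos_pos)
  define \<eta> where "\<eta> = (\<lambda>z. f z * inverse (f z + g z))"
  have "smooth_class \<eta>"
    unfolding \<eta>_def using pos by (intro smooth_class.mult smooth_class.inverse smooth_class.add f g)
      (metis less_irrefl)
  moreover have "compact (supp \<eta>)"
  proof (rule compact_supp)
    have "norm z \<le> R + 2" if "\<eta> z \<noteq> 0" for z
    proof (rule power2_le_imp_le)
      have "z \<bullet> z < R\<^sup>2 + 2"
        using that by (auto simp: \<eta>_def f_def flat_exp_def split: if_splits)
      also have "\<dots> \<le> (R + 2)\<^sup>2" using R by (simp add: power2_eq_square algebra_simps)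
      finally show "(norm z)\<^sup>2 \<le> (R + 2)\<^sup>2" by (simp add: power2_norm_eq_inner)
    qed (use R in simp)
    then show "bounded {x. \<eta> x \<noteq> 0}" by (auto intro!: boundedI)
  qed
  ultimately have "test_fun \<eta>" by (simp add: test_fun_def smooth_class_C_k)
  moreover have "open {z::'a. z \<bullet> z < R\<^sup>2 + 1}"
    by (intro open_Collect_less continuous_intros)
  moreover have "K \<subseteq> {z. z \<bullet> z < R\<^sup>2 + 1}"
  proof
    fix z assume "z \<in> K"
    then have "(norm z)\<^sup>2 \<le> R\<^sup>2" using R by (intro power_mono) auto
    then show "z \<in> {z. z \<bullet> z < R\<^sup>2 + 1}" by (simp add: power2_norm_eq_inner)
  qed
  moreover have "\<eta> z = 1" if "z \<in> {z. z \<bullet> z < R\<^sup>2 + 1}" for z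
    using that pos[of z] by (simp add: \<eta>_def g_def flat_exp_def)
  ultimately show ?thesis
    by (intro exI[of _ \<eta>] exI[of _ "{z. z \<bullet> z < R\<^sup>2 + 1}"] conjI ballI)
qed

lemma test_fun_peak_exists:
  fixes x0 :: "'a::euclidean_space"
  assumes "e > 0"
  obtains \<phi> where "test_fun \<phi>" "\<And>x. \<phi> x \<ge> 0" "\<And>x. \<phi> x > 0 \<longleftrightarrow> dist x x0 < e"
proof -
  \<comment> \<open>The argument is the square of \<open>e\<close> minus the square of
    \<open>dist x x0\<close>, expanded into the generators of \<open>smooth_class\<close>.\<close>
  define \<phi> where "\<phi> = (\<lambda>x. flat_exp 0 (e\<^sup>2 - x0 \<bullet> x0 + (2 * (x \<bullet> x0) + (- 1) * (x \<bullet> x))))"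
  have "smooth_class \<phi>" unfolding \<phi>_def by (intro smooth_class.intros)
  have arg: "e\<^sup>2 - x0 \<bullet> x0 + (2 * (x \<bullet> x0) + (- 1) * (x \<bullet> x)) = e\<^sup>2 - (dist x x0)\<^sup>2" for x
    by (simp add: dist_norm power2_norm_eq_inner inner_diff_left inner_diff_right inner_commute algebra_simps)
  have pos: "\<phi> x > 0 \<longleftrightarrow> dist x x0 < e" for x
  proof -
    have "dist x x0 < e \<longleftrightarrow> (dist x x0)\<^sup>2 < e\<^sup>2"
      using assms by (intro iffI power_strict_mono) (auto dest: power2_less_imp_less)
    then show ?thesis unfolding \<phi>_def arg flat_exp_def by auto
  qed
  have nonneg: "\<phi> x \<ge> 0" for x by (simp add: \<phi>_def flat_exp_def)
  have "{x. \<phi> x \<noteq> 0} \<subseteq> ball x0 e"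
    using pos nonneg by (auto simp: dist_commute order.strict_iff_order)
  then have "compact (supp \<phi>)"
    by (intro compact_supp bounded_subset[OF bounded_ball])
  then have "test_fun \<phi>"
    using \<open>smooth_class \<phi>\<close> by (simp add: test_fun_def smooth_class_C_k)
  then show thesis using that pos nonneg by blast
qed

section \<open>Convolution of functionals given by integrals\<close>

definition bounded_supported :: "('a::euclidean_space \<Rightarrow> real) \<Rightarrow> bool"
  where "bounded_supported \<phi> \<longleftrightarrow> \<phi> \<in> borel_measurable borel \<and>
    (\<exists>R. \<forall>x. \<bar>\<phi> x\<bar> \<le> R \<and> (\<phi> x \<noteq> 0 \<longrightarrow> norm x \<le> R))"

lemma bounded_supportedI:
  assumes "\<phi> \<in> borel_measurable borel" "\<And>x. \<bar>\<phi> x\<bar> \<le> R" "\<And>x. \<phi> x \<noteq> 0 \<Longrightarrow> norm x \<le> R'"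
  shows "bounded_supported \<phi>"
  unfolding bounded_supported_def
proof (intro conjI exI allI impI)
  show "\<bar>\<phi> x\<bar> \<le> max R R'" for x using assms(2)[of x] by simp
  show "norm x \<le> max R R'" if "\<phi> x \<noteq> 0" for x using assms(3)[OF that] by simp
qed (rule assms(1))

lemma test_fun_bounded_supported:
  assumes "test_fun \<phi>"
  shows "bounded_supported \<phi>"
proof -
  have "C_k 0 \<phi>" using assms unfolding test_fun_def by blast
  then have cont: "continuous_on UNIV \<phi>" by simp
  have comp: "compact (supp \<phi>)" using assms by (simp add: test_fun_def)
  have in_supp: "x \<in> supp \<phi>" if "\<phi> x \<noteq> 0" for x
    using that closure_subset[of "{x. \<phi> x \<noteq> 0}"] by (auto simp: supp_def)
  have "bounded (\<phi> ` supp \<phi>)"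
    by (intro compact_imp_bounded compact_continuous_image comp continuous_on_subset[OF cont]) auto
  then obtain R where R: "\<And>x. x \<in> supp \<phi> \<Longrightarrow> \<bar>\<phi> x\<bar> \<le> R" "R > 0"
    using bounded_normE by (metis image_eqI real_norm_def)
  obtain R' where "\<And>x. x \<in> supp \<phi> \<Longrightarrow> norm x \<le> R'"
    using compact_imp_bounded[OF comp] bounded_normE by metis
  moreover have "\<bar>\<phi> x\<bar> \<le> R" for x
    using R in_supp[of x] by (cases "\<phi> x = 0") auto
  ultimately show ?thesis
    using in_supp cont by (intro bounded_supportedI[of \<phi> R R'] borel_measurable_continuous_onI) auto
qed

text \<open>\<open>conv S T\<close> is determined by the defining condition already on bounded measurable functions of
  bounded support, which are easier to preserve than smoothness.  \<open>T'\<close> is a formula for \<open>T\<close> that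
  makes sense on arbitrary functions, so that no cutoff is needed in it.\<close>

definition represents_on ::
  "'a::euclidean_space distribution \<Rightarrow> 'a distribution \<Rightarrow> 'a set \<Rightarrow> bool"
  where "represents_on T' T A \<longleftrightarrow> (\<forall>\<phi>. bounded_supported \<phi> \<longrightarrow> T \<phi> = T' \<phi>) \<and> T' (\<lambda>_. 0) = 0 \<and>
    (\<forall>\<phi> \<psi>. (\<forall>x\<in>A. \<phi> x = \<psi> x) \<longrightarrow> T' \<phi> = T' \<psi>)"

text \<open>This makes the inner functional, applied to the slices of a cut off function on the
  product, an admissible argument of the outer functional.\<close>

definition slice_preserving :: "'a::euclidean_space distribution \<Rightarrow> bool"
  where "slice_preserving T \<longleftrightarrow> (\<forall>\<Psi> :: 'a \<times> 'a \<Rightarrow> real. bounded_supported \<Psi> \<longrightarrow>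
    bounded_supported (\<lambda>x. T (\<lambda>y. \<Psi> (x, y))))"

lemma
  assumes "represents_on T' T A"
  shows represents_on_eq: "bounded_supported \<phi> \<Longrightarrow> T \<phi> = T' \<phi>"
    and represents_on_0: "T' (\<lambda>_. 0) = 0"
    and represents_on_cong: "(\<And>x. x \<in> A \<Longrightarrow> \<phi> x = \<psi> x) \<Longrightarrow> T' \<phi> = T' \<psi>"
  using assms[unfolded represents_on_def, THEN conjunct1]
    assms[unfolded represents_on_def, THEN conjunct2, THEN conjunct1]
    assms[unfolded represents_on_def, THEN conjunct2, THEN conjunct2, rule_format, of \<phi> \<psi>]
  by simp_all

lemma represents_on_supported:
  assumes "represents_on T' T A"
  shows "dist_supported_on T A"
  unfolding dist_supported_on_def
proof (intro allI impI)
  fix \<phi> assume \<phi>: "test_fun \<phi> \<and> supp \<phi> \<inter> A = {}"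
  have "\<phi> x = 0" if "x \<in> A" for x
    using that \<phi> closure_subset[of "{x. \<phi> x \<noteq> 0}"] by (auto simp: supp_def)
  then have "T' \<phi> = T' (\<lambda>_. 0)" by (rule represents_on_cong[OF assms])
  then show "T \<phi> = 0"
    using represents_on_0[OF assms] represents_on_eq[OF assms test_fun_bounded_supported] \<phi> by simp
qed

text \<open>The formulas \<open>S'\<close> and \<open>T'\<close> only see \<open>A\<close> and
  \<open>B\<close>. There the cut off integrand coincides with \<open>\<phi> (x + y)\<close>: it
  equals it near the preimage of the support of \<open>\<phi>\<close>, and both vanish elsewhere.
  Hence the cutoff drops out.\<close>

lemma conv_represented:
  fixes S T :: "'a::euclidean_space distribution"
  assumes proper: "add_proper A B"
    and S: "represents_on S' S A" and T: "represents_on T' T B"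
    and slice: "slice_preserving T'" and \<phi>: "bounded_supported \<phi>"
  shows "conv S T \<phi> = S' (\<lambda>x. T' (\<lambda>y. \<phi> (x + y)))"
proof -
  let ?c = "S' (\<lambda>x. T' (\<lambda>y. \<phi> (x + y)))"
  let ?val = "\<lambda>\<eta>. S (\<lambda>x. T (\<lambda>y. \<eta> (x, y) * \<phi> (x + y)))"
  let ?P = "\<lambda>c A B. add_proper A B \<and> dist_supported_on S A \<and> dist_supported_on T B \<and>
    (\<forall>\<eta>. cutoff A B \<phi> \<eta> \<longrightarrow> c = ?val \<eta>)"
  obtain R where R: "\<And>x. \<bar>\<phi> x\<bar> \<le> R" "\<And>x. \<phi> x \<noteq> 0 \<Longrightarrow> norm x \<le> R"
    using \<phi> by (auto simp: bounded_supported_def)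
  have [measurable]: "\<phi> \<in> borel_measurable borel" using \<phi> by (simp add: bounded_supported_def)
  have in_supp: "x \<in> supp \<phi>" if "\<phi> x \<noteq> 0" for x
    using that closure_subset[of "{x. \<phi> x \<noteq> 0}"] by (auto simp: supp_def)
  have comp: "compact (supp \<phi>)"
    using R(2) by (intro compact_supp) (auto intro!: boundedI)
  have "?c = ?val \<eta>" if \<eta>: "cutoff A B \<phi> \<eta>" for \<eta>
  proof -
    obtain W where W: "{z \<in> A \<times> B. fst z + snd z \<in> supp \<phi>} \<subseteq> W" "\<And>z. z \<in> W \<Longrightarrow> \<eta> z = 1"
      using \<eta> by (auto simp: cutoff_def)
    have "bounded_supported \<eta>" using \<eta> by (simp add: cutoff_def test_fun_bounded_supported)
    then obtain R' where R': "\<And>z. \<bar>\<eta> z\<bar> \<le> R'" "\<And>z. \<eta> z \<noteq> 0 \<Longrightarrow> norm z \<le> R'"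
      and [measurable]: "\<eta> \<in> borel_measurable borel"
      by (auto simp: bounded_supported_def)
    have [measurable]: "\<eta> \<in> borel_measurable (borel \<Otimes>\<^sub>M borel)"
      by (simp add: borel_prod)
    define \<Psi> where "\<Psi> = (\<lambda>z. \<eta> z * \<phi> (fst z + snd z))"
    have [measurable]: "\<Psi> \<in> borel_measurable (borel \<Otimes>\<^sub>M borel)"
      unfolding \<Psi>_def by measurable
    have bs: "bounded_supported \<Psi>"
    proof (rule bounded_supportedI)
      show "\<Psi> \<in> borel_measurable borel" by (simp flip: borel_prod)
      show "\<bar>\<Psi> z\<bar> \<le> R' * R" for z
        unfolding \<Psi>_def abs_mult using R(1)[of "fst z + snd z"] R'(1)[of z] by (intro mult_mono) auto
      show "norm z \<le> R'" if "\<Psi> z \<noteq> 0" for z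
        using that R'(2)[of z] by (auto simp: \<Psi>_def)
    qed
    have bs_slice: "bounded_supported (\<lambda>y. \<Psi> (x, y))" for x
    proof (rule bounded_supportedI)
      show "(\<lambda>y. \<Psi> (x, y)) \<in> borel_measurable borel" by measurable
      show "\<bar>\<Psi> (x, y)\<bar> \<le> R' * R" for y
        unfolding \<Psi>_def abs_mult using R(1)[of "x + y"] R'(1)[of "(x, y)"] by (intro mult_mono) auto
      show "norm y \<le> R'" if "\<Psi> (x, y) \<noteq> 0" for y
        using that R'(2)[of "(x, y)"] norm_snd_le[of y x] by (auto simp: \<Psi>_def)
    qed
    have "?val \<eta> = S (\<lambda>x. T (\<lambda>y. \<Psi> (x, y)))" by (simp add: \<Psi>_def)
    also have "\<dots> = S (\<lambda>x. T' (\<lambda>y. \<Psi> (x, y)))"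
      by (simp only: represents_on_eq[OF T bs_slice])
    also have "\<dots> = S' (\<lambda>x. T' (\<lambda>y. \<Psi> (x, y)))"
      by (rule represents_on_eq[OF S]) (use slice bs in \<open>simp add: slice_preserving_def\<close>)
    also have "\<dots> = ?c"
    proof -
      have "\<Psi> (x, y) = \<phi> (x + y)" if "x \<in> A" "y \<in> B" for x y
      proof (cases "\<phi> (x + y) = 0")
        case False
        then have "(x, y) \<in> W" using W(1) in_supp that by auto
        then show ?thesis using W(2) by (simp add: \<Psi>_def)
      qed (simp add: \<Psi>_def)
      then have "T' (\<lambda>y. \<Psi> (x, y)) = T' (\<lambda>y. \<phi> (x + y))" if "x \<in> A" for x
        using that by (intro represents_on_cong[OF T]) auto
      then show ?thesis by (rule represents_on_cong[OF S])
    qed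
    finally show ?thesis by simp
  qed
  then have P: "?P ?c A B"
    using proper represents_on_supported[OF S] represents_on_supported[OF T] by blast
  have "c = ?c" if c: "?P c A' B'" for c A' B'
  proof -
    let ?K = "\<lambda>A B. {z \<in> A \<times> B. fst z + snd z \<in> supp \<phi>}"
    have "bounded (?K A B)" "bounded (?K A' B')"
      using proper c comp by (auto simp: add_proper_def intro!: compact_imp_bounded)
    \<comment> \<open>For uniqueness of the described value, a single cutoff that is 1 near the
      compact sets of both pairs of carriers compares the two values.\<close>
    then have bnd: "bounded (?K A B \<union> ?K A' B')" by simp
    obtain \<eta> W where \<eta>: "test_fun \<eta> \<and> open W \<and> ?K A B \<union> ?K A' B' \<subseteq> W \<and> (\<forall>z\<in>W. \<eta> z = 1)"
      using smooth_cutoff_exists[OF bnd] by (elim exE)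
    have "cutoff A'' B'' \<phi> \<eta>" if "?K A'' B'' \<subseteq> W" for A'' B''
      unfolding cutoff_def using \<eta> that by (intro conjI exI[of _ W] ballI) simp_all
    then have cut: "cutoff A B \<phi> \<eta>" "cutoff A' B' \<phi> \<eta>"
      using \<eta> by simp_all
    have "c = ?val \<eta>" using c cut(2) by simp
    also have "\<dots> = ?c" using P cut(1) by simp
    finally show ?thesis .
  qed
  then show ?thesis
    unfolding conv_def
    by (intro the_equality exI[of _ A] exI[of _ B] P) (elim exE)
qed

section \<open>Splines as iterated integrals along rays\<close>

definition ray_integral :: "'a::euclidean_space \<Rightarrow> ('a \<Rightarrow> real) \<Rightarrow> 'a \<Rightarrow> real"
  where "ray_integral z F x = (LINT l:{0..}|lborel. F (x + l *\<^sub>R z))"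

definition rays :: "'a::euclidean_space list \<Rightarrow> ('a \<Rightarrow> real) \<Rightarrow> 'a \<Rightarrow> real"
  where "rays zs = foldr ray_integral zs"

lemma rays_Nil [simp]: "rays [] F = F"
  and rays_Cons [simp]: "rays (z # zs) F = ray_integral z (rays zs F)"
  and rays_append: "rays (ys @ zs) F = rays ys (rays zs F)"
  by (simp_all add: rays_def)

text \<open>On the half-space, \<open>ray_integral z\<close> with \<open>a \<bullet> z > 0\<close> only involves a bounded part of the ray, so
  these bounds are inherited by the integrals along rays, uniformly in the parameter.\<close>

definition halfspace_family ::
  "'p measure \<Rightarrow> 'a::euclidean_space \<Rightarrow> ('p \<Rightarrow> 'a \<Rightarrow> real) \<Rightarrow> bool"
  where "halfspace_family M a \<Psi> \<longleftrightarrow>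
    (\<lambda>(p, x). \<Psi> p x) \<in> borel_measurable (M \<Otimes>\<^sub>M borel) \<and>
    (\<exists>R\<ge>0. \<forall>p\<in>space M. \<forall>x. a \<bullet> x \<ge> 0 \<longrightarrow> \<bar>\<Psi> p x\<bar> \<le> R \<and> (\<Psi> p x \<noteq> 0 \<longrightarrow> norm x \<le> R))"

lemma abs_integral_le_interval:
  fixes f :: "real \<Rightarrow> real"
  assumes [measurable]: "f \<in> borel_measurable borel" and "0 \<le> R" "0 \<le> L"
    and f: "\<And>l. \<bar>f l\<bar> \<le> R * indicator {0..L} l"
  shows "\<bar>\<integral>l. f l \<partial>lborel\<bar> \<le> R * L"
proof -
  have int: "integrable lborel (\<lambda>l. R * indicator {0..L} l :: real)"
    by (intro integrable_mult_right integrable_real_indicator) (auto simp: emeasure_lborel_Icc_eq)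
  have "integrable lborel f"
    by (rule Bochner_Integration.integrable_bound[OF int]) (use f assms in \<open>auto simp: abs_mult\<close>)
  then have "norm (\<integral>l. f l \<partial>lborel) \<le> (\<integral>l. R * indicator {0..L} l \<partial>lborel)"
    using int by (rule Bochner_Integration.integral_norm_bound_integral) (use f in auto)
  also have "\<dots> = R * L" using \<open>0 \<le> L\<close> by simp
  finally show ?thesis by simp
qed

text \<open>From a point with \<open>a \<bullet> x \<ge> 0\<close> the inner product with
  \<open>a\<close> grows at least like \<open>l * (a \<bullet> z)\<close>, while inside the ball it
  is at most \<open>norm a * R\<close>.\<close>

lemma ray_parameter_bound:
  fixes a :: "'a::euclidean_space"
  assumes z: "a \<bullet> z > 0" and x: "a \<bullet> x \<ge> 0" and n: "norm (x + l *\<^sub>R z) \<le> R"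
  shows "l \<le> norm a * R / (a \<bullet> z)"
proof -
  have "l * (a \<bullet> z) \<le> a \<bullet> (x + l *\<^sub>R z)" using x by (simp add: inner_add_right)
  also have "\<dots> \<le> norm a * norm (x + l *\<^sub>R z)" by (rule norm_cauchy_schwarz)
  also have "\<dots> \<le> norm a * R" by (intro mult_left_mono n) simp
  finally show ?thesis using z by (simp add: field_simps)
qed

lemma halfspace_family_ray_integral:
  assumes \<Psi>: "halfspace_family M a \<Psi>" and z: "a \<bullet> z > 0"
  shows "halfspace_family M a (\<lambda>p. ray_integral z (\<Psi> p))"
proof -
  obtain R where R: "0 \<le> R" "\<And>p x. p \<in> space M \<Longrightarrow> a \<bullet> x \<ge> 0 \<Longrightarrow> \<bar>\<Psi> p x\<bar> \<le> R"
    "\<And>p x. p \<in> space M \<Longrightarrow> a \<bullet> x \<ge> 0 \<Longrightarrow> \<Psi> p x \<noteq> 0 \<Longrightarrow> norm x \<le> R"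
    using \<Psi> unfolding halfspace_family_def by metis
  have [measurable]: "(\<lambda>(p, x). \<Psi> p x) \<in> borel_measurable (M \<Otimes>\<^sub>M borel)"
    using \<Psi> by (simp add: halfspace_family_def)
  \<comment> \<open>For starting points in the half-space, the ray has left the ball of radius
    \<open>R\<close> beyond the parameter \<open>L\<close>.\<close>
  define L where "L = norm a * R / (a \<bullet> z)"
  have L: "0 \<le> L" using z R by (simp add: L_def)
  have L_bound: "l \<le> L" "norm (x + l *\<^sub>R z) \<le> R"
    if "p \<in> space M" "a \<bullet> x \<ge> 0" "l \<ge> 0" "\<Psi> p (x + l *\<^sub>R z) \<noteq> 0" for p x l
  proof -
    have "a \<bullet> (x + l *\<^sub>R z) \<ge> 0" using that z by (simp add: inner_add_right)
    then show "norm (x + l *\<^sub>R z) \<le> R" using R(3) that by blast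
    then show "l \<le> L" unfolding L_def by (rule ray_parameter_bound[OF z that(2)])
  qed
  have bound: "\<bar>indicator {0..} l * \<Psi> p (x + l *\<^sub>R z)\<bar> \<le> R * indicator {0..L} l"
    if "p \<in> space M" "a \<bullet> x \<ge> 0" for p x l
  proof (cases "l \<ge> 0 \<and> \<Psi> p (x + l *\<^sub>R z) \<noteq> 0")
    case True
    then have "a \<bullet> (x + l *\<^sub>R z) \<ge> 0" using that z by (simp add: inner_add_right)
    then show ?thesis using True L_bound[OF that] R(2)[OF that(1)] by simp
  next
    case False
    then show ?thesis using R(1) by (auto simp: indicator_def)
  qed
  have "(\<lambda>(p, x). ray_integral z (\<Psi> p) x) \<in> borel_measurable (M \<Otimes>\<^sub>M borel)"
  proof -
    have [measurable]: "(\<lambda>q. \<Psi> (f q) (g q)) \<in> borel_measurable N"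
      if [measurable]: "f \<in> measurable N M" "g \<in> borel_measurable N" for f g and N :: "'c measure"
    proof -
      have "(\<lambda>q. (\<lambda>(p, x). \<Psi> p x) (f q, g q)) \<in> borel_measurable N" by measurable
      then show ?thesis by simp
    qed
    show ?thesis
      unfolding ray_integral_def set_lebesgue_integral_def split_beta' by measurable
  qed
  moreover have "\<bar>ray_integral z (\<Psi> p) x\<bar> \<le> R * L" if "p \<in> space M" "a \<bullet> x \<ge> 0" for p x
  proof -
    have [measurable]: "\<Psi> p \<in> borel_measurable borel"
    proof -
      have "(\<lambda>x. (\<lambda>(p, x). \<Psi> p x) (p, x)) \<in> borel_measurable borel"
        using that(1) by measurable
      then show ?thesis by simp
    qed
    show ?thesis
      unfolding ray_integral_def set_lebesgue_integral_def real_scaleR_def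
      by (rule abs_integral_le_interval) (use R(1) L bound[OF that] in auto)
  qed
  moreover have "norm x \<le> R + L * norm z"
    if p: "p \<in> space M" "a \<bullet> x \<ge> 0" and nz: "ray_integral z (\<Psi> p) x \<noteq> 0" for p x
  proof -
    have "\<exists>l\<ge>0. \<Psi> p (x + l *\<^sub>R z) \<noteq> 0"
    proof (rule ccontr)
      assume "\<not> ?thesis"
      then have "(\<lambda>l. indicator {0..} l *\<^sub>R \<Psi> p (x + l *\<^sub>R z)) = (\<lambda>_. 0)"
        by (auto simp: indicator_def fun_eq_iff)
      then show False using nz by (simp add: ray_integral_def set_lebesgue_integral_def)
    qed
    then obtain l where l: "l \<ge> 0" "\<Psi> p (x + l *\<^sub>R z) \<noteq> 0" by blast
    have "norm x \<le> norm (x + l *\<^sub>R z) + norm (l *\<^sub>R z)"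
      by (metis add_diff_cancel norm_triangle_ineq4)
    also have "\<dots> \<le> R + L * norm z"
      using L_bound[OF p l] l(1) by (intro add_mono) (auto intro: mult_right_mono)
    finally show ?thesis .
  qed
  moreover have "R * L \<le> max (R * L) (R + L * norm z)" "R + L * norm z \<le> max (R * L) (R + L * norm z)"
    "0 \<le> max (R * L) (R + L * norm z)"
    using R(1) L by (auto simp: le_max_iff_disj)
  ultimately show ?thesis
    unfolding halfspace_family_def by (meson order_trans)
qed

lemma halfspace_family_rays:
  assumes "halfspace_family M a \<Psi>" "\<forall>z\<in>set zs. a \<bullet> z > 0"
  shows "halfspace_family M a (\<lambda>p. rays zs (\<Psi> p))"
  using assms(2)
  by (induction zs) (auto intro: halfspace_family_ray_integral assms(1))

definition halfspace_bounded :: "'a::euclidean_space \<Rightarrow> ('a \<Rightarrow> real) \<Rightarrow> bool"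
  where "halfspace_bounded a F \<longleftrightarrow> F \<in> borel_measurable borel \<and>
    (\<exists>R\<ge>0. \<forall>x. a \<bullet> x \<ge> 0 \<longrightarrow> \<bar>F x\<bar> \<le> R \<and> (F x \<noteq> 0 \<longrightarrow> norm x \<le> R))"

text \<open>A one-point parameter space, so that the results on families also cover single
  functions.\<close>

lemma halfspace_bounded_iff_family:
  "halfspace_bounded a F \<longleftrightarrow> halfspace_family (count_space {()}) a (\<lambda>_. F)"
proof -
  have "(\<lambda>(p, x). F x) \<in> borel_measurable (count_space {()} \<Otimes>\<^sub>M borel) \<longleftrightarrow> F \<in> borel_measurable borel"
    (is "?l \<longleftrightarrow> ?r")
  proof
    assume ?l
    from measurable_compose[OF measurable_Pair1' this, of "()"] show ?r by simp
  next
    assume ?r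
    from measurable_compose[OF measurable_snd this] show ?l by (simp add: split_beta')
  qed
  then show ?thesis by (simp add: halfspace_bounded_def halfspace_family_def)
qed

lemma halfspace_bounded_rays:
  "halfspace_bounded a F \<Longrightarrow> \<forall>z\<in>set zs. a \<bullet> z > 0 \<Longrightarrow> halfspace_bounded a (rays zs F)"
  using halfspace_family_rays[of "count_space {()}" a "\<lambda>_. F" zs]
  by (simp add: halfspace_bounded_iff_family)

lemma halfspace_bounded_ray_integral:
  "halfspace_bounded a F \<Longrightarrow> a \<bullet> z > 0 \<Longrightarrow> halfspace_bounded a (ray_integral z F)"
  using halfspace_bounded_rays[of a F "[z]"] by simp

lemma bounded_supported_halfspace:
  assumes "bounded_supported \<phi>"
  shows "halfspace_bounded a \<phi>"
proof -
  obtain R where "\<forall>x. \<bar>\<phi> x\<bar> \<le> R \<and> (\<phi> x \<noteq> 0 \<longrightarrow> norm x \<le> R)" "\<phi> \<in> borel_measurable borel"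
    using assms by (auto simp: bounded_supported_def)
  moreover from this have "0 \<le> R" using abs_ge_zero order_trans by blast
  ultimately show ?thesis by (auto simp: halfspace_bounded_def)
qed

lemma ray_integral_translate: "ray_integral z (\<lambda>y. F (x + y)) v = ray_integral z F (x + v)"
  by (simp add: ray_integral_def add.assoc)

lemma rays_translate: "rays zs (\<lambda>y. F (x + y)) v = rays zs F (x + v)"
proof (induction zs arbitrary: v)
  case (Cons z zs)
  have "rays zs (\<lambda>y. F (x + y)) = (\<lambda>y. rays zs F (x + y))" using Cons by auto
  then show ?case using ray_integral_translate[of z "rays zs F" x v] by simp
qed simp

section \<open>Splines and the product measure\<close>

interpretation lborel_product: product_sigma_finite "\<lambda>j::nat. lborel :: real measure"
  by (simp add: product_sigma_finite_def sigma_finite_lborel)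

lemma integrable_bounded_finite_support:
  fixes f :: "'a \<Rightarrow> real"
  assumes [measurable]: "f \<in> borel_measurable M" "A \<in> sets M" and fin: "emeasure M A < \<infinity>"
    and bound: "\<And>x. x \<in> space M \<Longrightarrow> \<bar>f x\<bar> \<le> C" and zero: "\<And>x. x \<in> space M \<Longrightarrow> x \<notin> A \<Longrightarrow> f x = 0"
  shows "integrable M f"
proof (rule Bochner_Integration.integrable_bound)
  show "integrable M (\<lambda>x. \<bar>C\<bar> * indicator A x :: real)"
    using fin by (intro integrable_mult_right) (simp add: integrable_indicator_iff)
  show "AE x in M. norm (f x) \<le> norm (\<bar>C\<bar> * indicator A x :: real)"
  proof (rule AE_I2)
    fix x assume x: "x \<in> space M"
    show "norm (f x) \<le> norm (\<bar>C\<bar> * indicator A x :: real)"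
      using bound[OF x] zero[OF x] by (cases "x \<in> A") auto
  qed
qed simp

abbreviation lborel_upto :: "nat \<Rightarrow> (nat \<Rightarrow> real) measure"
  where "lborel_upto n \<equiv> \<Pi>\<^sub>M j\<in>{..<n}. lborel"

lemma emeasure_box_finite:
  fixes u v :: "nat \<Rightarrow> real"
  shows "(\<Pi>\<^sub>E j\<in>{..<n}. {u j..v j}) \<in> sets (lborel_upto n)"
    and "emeasure (lborel_upto n) (\<Pi>\<^sub>E j\<in>{..<n}. {u j..v j}) < \<infinity>"
proof -
  have "emeasure (lborel_upto n) (\<Pi>\<^sub>E j\<in>{..<n}. {u j..v j}) = (\<Prod>j<n. emeasure lborel {u j..v j})"
    by (rule lborel_product.emeasure_PiM) auto
  also have "\<dots> < \<infinity>"
    by (auto simp: ennreal_prod_eq_top less_top[symmetric] emeasure_lborel_Icc_eq)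
  finally show "emeasure (lborel_upto n) (\<Pi>\<^sub>E j\<in>{..<n}. {u j..v j}) < \<infinity>" .
qed (rule sets_PiM_I_finite; simp)

lemma spline_Nil: "spline [] \<phi> = \<phi> 0"
  by (simp add: spline_def set_lebesgue_integral_def PiM_empty lebesgue_integral_count_space_finite)

text \<open>Fubini splits off the last parameter. Integrability holds because all terms
  \<open>l j * (a \<bullet> (Y @ [z]) ! j)\<close> are nonnegative: each one is bounded by the inner
  product of the sum with \<open>a\<close>, which confines the parameters to the box with sides
  \<open>L j\<close> as long as \<open>F\<close> is nonzero.\<close>

lemma spline_snoc:
  assumes F: "halfspace_bounded a F" and Y: "\<forall>y\<in>set (Y @ [z]). a \<bullet> y > 0"
  shows "spline (Y @ [z]) F = spline Y (ray_integral z F)"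
proof -
  let ?m = "length Y"
  let ?f = "\<lambda>l. indicator ({..<Suc ?m} \<rightarrow>\<^sub>E {0..}) l *\<^sub>R F (\<Sum>j<Suc ?m. l j *\<^sub>R (Y @ [z]) ! j)"
  have [measurable]: "F \<in> borel_measurable borel" using F by (simp add: halfspace_bounded_def)
  obtain R where R: "0 \<le> R" "\<And>x. a \<bullet> x \<ge> 0 \<Longrightarrow> \<bar>F x\<bar> \<le> R"
    "\<And>x. a \<bullet> x \<ge> 0 \<Longrightarrow> F x \<noteq> 0 \<Longrightarrow> norm x \<le> R"
    using F unfolding halfspace_bounded_def by metis
  have set_meas [measurable]: "({..<Suc ?m} \<rightarrow>\<^sub>E {0..}) \<in> sets (lborel_upto (Suc ?m))"
    by (rule sets_PiM_I_finite) auto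
  have pos: "a \<bullet> (Y @ [z]) ! j > 0" if "j < Suc ?m" for j
    using Y that by (metis length_append_singleton nth_mem)
  define L where "L j = norm a * R / (a \<bullet> (Y @ [z]) ! j)" for j
  have int: "integrable (lborel_upto (Suc ?m)) ?f"
  proof (rule integrable_bounded_finite_support)
    have "(\<lambda>l. \<Sum>j<Suc ?m. l j *\<^sub>R (Y @ [z]) ! j) \<in> borel_measurable (lborel_upto (Suc ?m))"
      by (intro borel_measurable_sum borel_measurable_scaleR borel_measurable_const)
        (simp add: measurable_component_singleton)
    then have [measurable]:
      "(\<lambda>l. F (\<Sum>j<Suc ?m. l j *\<^sub>R (Y @ [z]) ! j)) \<in> borel_measurable (lborel_upto (Suc ?m))"
      by (rule measurable_compose) simp
    show "?f \<in> borel_measurable (lborel_upto (Suc ?m))" by measurable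
    show "(\<Pi>\<^sub>E j\<in>{..<Suc ?m}. {0..L j}) \<in> sets (lborel_upto (Suc ?m))"
      and "emeasure (lborel_upto (Suc ?m)) (\<Pi>\<^sub>E j\<in>{..<Suc ?m}. {0..L j}) < \<infinity>"
      using emeasure_box_finite[of "Suc ?m" "\<lambda>_. 0" L] by simp_all
    have nonneg: "a \<bullet> (\<Sum>j<Suc ?m. l j *\<^sub>R (Y @ [z]) ! j) \<ge> l i * (a \<bullet> (Y @ [z]) ! i)"
      if "l \<in> {..<Suc ?m} \<rightarrow>\<^sub>E {0..}" "i < Suc ?m" for l i
    proof -
      have "l i * (a \<bullet> (Y @ [z]) ! i) \<le> (\<Sum>j<Suc ?m. l j * (a \<bullet> (Y @ [z]) ! j))"
        using that pos by (intro member_le_sum) (auto intro!: mult_nonneg_nonneg less_imp_le[OF pos] simp del: sum.lessThan_Suc)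
      then show ?thesis by (simp add: inner_sum_right del: sum.lessThan_Suc)
    qed
    have nonneg0: "a \<bullet> (\<Sum>j<Suc ?m. l j *\<^sub>R (Y @ [z]) ! j) \<ge> 0"
      if "l \<in> {..<Suc ?m} \<rightarrow>\<^sub>E {0..}" for l
    proof -
      have "0 \<le> l 0 * (a \<bullet> (Y @ [z]) ! 0)"
        using that pos[of 0] by (intro mult_nonneg_nonneg) auto
      also have "\<dots> \<le> a \<bullet> (\<Sum>j<Suc ?m. l j *\<^sub>R (Y @ [z]) ! j)" by (rule nonneg[OF that]) simp
      finally show ?thesis .
    qed
    show "\<bar>?f l\<bar> \<le> R" for l
      using R(1) R(2)[OF nonneg0[of l]] by (cases "l \<in> {..<Suc ?m} \<rightarrow>\<^sub>E {0..}") (auto simp del: sum.lessThan_Suc)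
    fix l assume notin: "l \<notin> (\<Pi>\<^sub>E j\<in>{..<Suc ?m}. {0..L j})"
    show "?f l = 0"
    proof (rule ccontr)
      assume nz: "?f l \<noteq> 0"
      then have l: "l \<in> {..<Suc ?m} \<rightarrow>\<^sub>E {0..}" and "F (\<Sum>j<Suc ?m. l j *\<^sub>R (Y @ [z]) ! j) \<noteq> 0"
        by (auto simp del: sum.lessThan_Suc simp: indicator_def split: if_splits)
      then have n: "norm (\<Sum>j<Suc ?m. l j *\<^sub>R (Y @ [z]) ! j) \<le> R"
        using R(3)[OF nonneg0] by blast
      have "l i \<le> L i" if i: "i < Suc ?m" for i
      proof -
        have "l i * (a \<bullet> (Y @ [z]) ! i) \<le> a \<bullet> (\<Sum>j<Suc ?m. l j *\<^sub>R (Y @ [z]) ! j)"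
          by (rule nonneg[OF l i])
        also have "\<dots> \<le> norm a * norm (\<Sum>j<Suc ?m. l j *\<^sub>R (Y @ [z]) ! j)"
          by (rule norm_cauchy_schwarz)
        also have "\<dots> \<le> norm a * R" by (intro mult_left_mono n) simp
        finally show ?thesis using pos[OF i] by (simp add: L_def field_simps)
      qed
      then have "l \<in> (\<Pi>\<^sub>E j\<in>{..<Suc ?m}. {0..L j})"
        using l by (intro PiE_I) (auto simp: PiE_def Pi_def extensional_def)
      then show False using notin by blast
    qed
  qed
  have ins: "{..<Suc ?m} = insert ?m {..<?m}" by auto
  have "spline (Y @ [z]) F = integral\<^sup>L (lborel_upto (Suc ?m)) ?f"
    by (simp add: spline_def set_lebesgue_integral_def)
  also have "\<dots> = (\<integral>l. (\<integral>t. ?f (l(?m := t)) \<partial>lborel) \<partial>lborel_upto ?m)"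
    using int lborel_product.product_integral_insert[of "{..<?m}" ?m ?f] unfolding ins by simp
  also have "\<dots> = (\<integral>l. indicator ({..<?m} \<rightarrow>\<^sub>E {0..}) l *\<^sub>R
      ray_integral z F (\<Sum>j<?m. l j *\<^sub>R Y ! j) \<partial>lborel_upto ?m)"
  proof (rule Bochner_Integration.integral_cong[OF refl])
    fix l assume "l \<in> space (lborel_upto ?m)"
    then have ext: "l \<in> extensional {..<?m}" by (simp add: space_PiM PiE_def)
    have "?f (l(?m := t)) = indicator ({..<?m} \<rightarrow>\<^sub>E {0..}) l *\<^sub>R
        (indicator {0..} t *\<^sub>R F ((\<Sum>j<?m. l j *\<^sub>R Y ! j) + t *\<^sub>R z))" for t
    proof -
      have "l(?m := t) \<in> {..<Suc ?m} \<rightarrow>\<^sub>E {0..} \<longleftrightarrow> l \<in> {..<?m} \<rightarrow>\<^sub>E {0..} \<and> t \<in> {0..}"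
        using ext by (fastforce simp: PiE_def Pi_def extensional_def less_Suc_eq)
      then have "indicator ({..<Suc ?m} \<rightarrow>\<^sub>E {0..}) (l(?m := t))
          = (indicator ({..<?m} \<rightarrow>\<^sub>E {0..}) l * indicator {0..} t :: real)"
        by (simp add: indicator_def)
      moreover have "(\<Sum>j<Suc ?m. (l(?m := t)) j *\<^sub>R (Y @ [z]) ! j) = (\<Sum>j<?m. l j *\<^sub>R Y ! j) + t *\<^sub>R z"
        by (simp add: nth_append)
      ultimately show ?thesis by simp
    qed
    then show "(\<integral>t. ?f (l(?m := t)) \<partial>lborel) = indicator ({..<?m} \<rightarrow>\<^sub>E {0..}) l *\<^sub>R
        ray_integral z F (\<Sum>j<?m. l j *\<^sub>R Y ! j)"
      by (simp only: ray_integral_def set_lebesgue_integral_def integral_scaleR_right)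
  qed
  also have "\<dots> = spline Y (ray_integral z F)"
    by (simp add: spline_def set_lebesgue_integral_def)
  finally show ?thesis .
qed

lemma spline_eq_rays:
  assumes "halfspace_bounded a F" "\<forall>y\<in>set Y. a \<bullet> y > 0"
  shows "spline Y F = rays Y F 0"
  using assms
proof (induction Y arbitrary: F rule: rev_induct)
  case (snoc z Y)
  then show ?case
    by (simp add: spline_snoc rays_append halfspace_bounded_ray_integral)
qed (simp add: spline_Nil)

section \<open>Integration over the subspaces of a flag\<close>

definition comb :: "'a::euclidean_space list \<Rightarrow> nat \<Rightarrow> (nat \<Rightarrow> real) \<Rightarrow> 'a"
  where "comb bs n c = (\<Sum>j<n. c j *\<^sub>R bs ! j)"

lemma borel_measurable_comb [measurable]: "comb bs n \<in> borel_measurable (lborel_upto n)"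
  unfolding comb_def
  by (intro borel_measurable_sum borel_measurable_scaleR borel_measurable_const)
    (simp add: measurable_component_singleton)

lemma comb_Suc: "comb bs (Suc n) (c(n := s)) = comb bs n c + s *\<^sub>R bs ! n"
  by (simp add: comb_def)

lemma bounded_supported_bounds:
  assumes "bounded_supported f"
  obtains R where "0 \<le> R" "\<And>x. \<bar>f x\<bar> \<le> R" "\<And>x. f x \<noteq> 0 \<Longrightarrow> norm x \<le> R"
proof -
  obtain R where "\<forall>x. \<bar>f x\<bar> \<le> R \<and> (f x \<noteq> 0 \<longrightarrow> norm x \<le> R)"
    using assms by (auto simp: bounded_supported_def)
  moreover from this have "0 \<le> R" using abs_ge_zero order_trans by blast
  ultimately show thesis using that by blast
qed

lemma bounded_supported_measurable: "bounded_supported f \<Longrightarrow> f \<in> borel_measurable borel"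
  by (simp add: bounded_supported_def)

lemma peval_bounded:
  obtains C where "0 \<le> C" "\<And>x. norm x \<le> R \<Longrightarrow> \<bar>peval p x\<bar> \<le> C"
proof -
  have "bounded (peval p ` cball 0 R)"
    by (intro compact_imp_bounded compact_continuous_image continuous_peval[of _ "\<lambda>x. x"]
        continuous_on_id compact_cball)
  then obtain C where "C > 0" "\<forall>y\<in>peval p ` cball 0 R. norm y \<le> C"
    using bounded_pos by blast
  then show thesis by (intro that[of C]) auto
qed

lemma lborel_upto_translate:
  "distr (lborel_upto n) (lborel_upto n) (\<lambda>c. \<lambda>j\<in>{..<n}. c j + d j) = lborel_upto n"
proof (rule lborel_product.PiM_eqI)
  let ?T = "\<lambda>c. \<lambda>j\<in>{..<n}. c j + d j"
  have T [measurable]: "?T \<in> measurable (lborel_upto n) (lborel_upto n)"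
    by (rule measurable_restrict) (simp add: measurable_component_singleton)
  fix A :: "nat \<Rightarrow> real set" assume A: "\<And>i. i \<in> {..<n} \<Longrightarrow> A i \<in> sets lborel"
  have pre: "?T -` (\<Pi>\<^sub>E j\<in>{..<n}. A j) \<inter> space (lborel_upto n)
      = (\<Pi>\<^sub>E j\<in>{..<n}. (\<lambda>t. t + d j) -` A j)"
    by (auto simp: space_PiM PiE_def Pi_def)
  have sets: "(\<lambda>t. t + d j) -` A j \<in> sets lborel" if "j < n" for j
    using measurable_sets[of "\<lambda>t. t + d j" borel borel "A j"] A[of j] that by simp
  have "emeasure (distr (lborel_upto n) (lborel_upto n) ?T) (\<Pi>\<^sub>E j\<in>{..<n}. A j)
      = emeasure (lborel_upto n) (\<Pi>\<^sub>E j\<in>{..<n}. (\<lambda>t. t + d j) -` A j)"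
    using A by (subst emeasure_distr) (auto simp: pre intro!: sets_PiM_I_finite)
  also have "\<dots> = (\<Prod>j<n. emeasure lborel ((\<lambda>t. t + d j) -` A j))"
    using sets by (intro lborel_product.emeasure_PiM) auto
  also have "\<dots> = (\<Prod>j<n. emeasure lborel (A j))"
  proof (rule prod.cong[OF refl])
    fix j assume "j \<in> {..<n}"
    then have Aj: "A j \<in> sets borel" using A by simp
    have "emeasure lborel (A j) = emeasure (distr lborel borel (\<lambda>t. t + d j)) (A j)"
    proof -
      have "(\<lambda>t. t + d j) = (+) (d j)" by (simp add: fun_eq_iff)
      then show ?thesis by (simp only: lborel_distr_plus)
    qed
    also have "\<dots> = emeasure lborel ((\<lambda>t. t + d j) -` A j)"
      using Aj by (subst emeasure_distr) auto
    finally show "emeasure lborel ((\<lambda>t. t + d j) -` A j) = emeasure lborel (A j)" by simp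
  qed
  finally show "emeasure (distr (lborel_upto n) (lborel_upto n) ?T) (\<Pi>\<^sub>E j\<in>{..<n}. A j)
      = (\<Prod>j\<in>{..<n}. emeasure lborel (A j))" .
qed simp_all

context
  fixes bs :: "(real ^ 'r::finite) list"
  assumes basis: "is_basis_list bs"
begin

lemma coord_comb:
  assumes "n \<le> length bs" "j < length bs"
  shows "coord bs j \<bullet> comb bs n c = (if j < n then c j else 0)"
proof -
  have "coord bs j \<bullet> comb bs n c = (\<Sum>i<n. c i * (coord bs j \<bullet> bs ! i))"
    by (simp add: comb_def inner_sum_right)
  also have "\<dots> = (\<Sum>i<n. if i = j then c j else 0)"
    using assms by (intro sum.cong) (auto simp: coord_basis[OF basis])
  finally show ?thesis by (simp add: sum.delta)
qed

lemma comb_in_span: "n \<le> length bs \<Longrightarrow> comb bs n c \<in> span (set (take n bs))"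
  by (simp add: span_take_iff[OF basis] coord_comb)

lemma span_take_comb:
  assumes "n \<le> length bs" "v \<in> span (set (take n bs))"
  shows "v = comb bs n (\<lambda>j. coord bs j \<bullet> v)"
proof -
  have "v = (\<Sum>j<length bs. (coord bs j \<bullet> v) *\<^sub>R bs ! j)"
    by (rule coord_expansion[OF basis])
  also have "\<dots> = comb bs n (\<lambda>j. coord bs j \<bullet> v)"
    unfolding comb_def
    by (rule sum.mono_neutral_right) (use assms in \<open>auto simp: span_take_iff[OF basis]\<close>)
  finally show ?thesis .
qed

lemma comb_in_box:
  assumes "n \<le> length bs" "c \<in> space (lborel_upto n)" "norm (comb bs n c) \<le> R"
  shows "c \<in> (\<Pi>\<^sub>E j\<in>{..<n}. {- (norm (coord bs j) * R)..norm (coord bs j) * R})"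
proof (rule PiE_I)
  fix j assume "j \<in> {..<n}"
  then have "\<bar>c j\<bar> = \<bar>coord bs j \<bullet> comb bs n c\<bar>"
    using assms by (simp add: coord_comb)
  also have "\<dots> \<le> norm (coord bs j) * norm (comb bs n c)" by (rule Cauchy_Schwarz_ineq2)
  also have "\<dots> \<le> norm (coord bs j) * R" using assms by (intro mult_left_mono) auto
  finally show "c j \<in> {- (norm (coord bs j) * R)..norm (coord bs j) * R}" by auto
next
  fix j assume "j \<notin> {..<n}"
  then show "c j = undefined" using assms by (auto simp: space_PiM PiE_def extensional_def)
qed

lemma integrable_comb:
  assumes n: "n \<le> length bs" and f: "bounded_supported f"
  shows "integrable (lborel_upto n) (\<lambda>c. f (comb bs n c))"
proof -
  obtain R where R: "0 \<le> R" "\<And>x. \<bar>f x\<bar> \<le> R" "\<And>x. f x \<noteq> 0 \<Longrightarrow> norm x \<le> R"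
    using bounded_supported_bounds[OF f] by blast
  have [measurable]: "f \<in> borel_measurable borel" using f by (rule bounded_supported_measurable)
  let ?A = "\<Pi>\<^sub>E j\<in>{..<n}. {- (norm (coord bs j) * R)..norm (coord bs j) * R}"
  show ?thesis
  proof (rule integrable_bounded_finite_support)
    show "?A \<in> sets (lborel_upto n)" "emeasure (lborel_upto n) ?A < \<infinity>"
      by (rule emeasure_box_finite)+
    show "f (comb bs n c) = 0" if "c \<in> space (lborel_upto n)" "c \<notin> ?A" for c
      using comb_in_box[OF n that(1)] R(3) that(2) by blast
  qed (use R in simp_all)
qed

lemma integral_comb_swap:
  fixes G :: "(real ^ 'r) \<times> real \<Rightarrow> real"
  assumes n: "n \<le> length bs" and G: "bounded_supported G"
  shows "(\<integral>c. (\<integral>l. G (comb bs n c, l) \<partial>lborel) \<partial>lborel_upto n)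
    = (\<integral>l. (\<integral>c. G (comb bs n c, l) \<partial>lborel_upto n) \<partial>lborel)"
proof -
  obtain R where R: "0 \<le> R" "\<And>x. \<bar>G x\<bar> \<le> R" "\<And>x. G x \<noteq> 0 \<Longrightarrow> norm x \<le> R"
    using bounded_supported_bounds[OF G] by blast
  have "G \<in> borel_measurable borel" using G by (rule bounded_supported_measurable)
  then have [measurable]: "G \<in> borel_measurable (borel \<Otimes>\<^sub>M borel)" by (simp add: borel_prod)
  let ?A = "\<Pi>\<^sub>E j\<in>{..<n}. {- (norm (coord bs j) * R)..norm (coord bs j) * R}"
  have sf: "sigma_finite_measure (lborel_upto n)"
    by (rule lborel_product.sigma_finite) simp
  interpret P: pair_sigma_finite "lborel_upto n" "lborel :: real measure"
    by (intro pair_sigma_finite.intro sf sigma_finite_lborel)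
  have "integrable (lborel_upto n \<Otimes>\<^sub>M lborel) (\<lambda>(c, l). G (comb bs n c, l))"
  proof (rule integrable_bounded_finite_support)
    show "(\<lambda>(c, l). G (comb bs n c, l)) \<in> borel_measurable (lborel_upto n \<Otimes>\<^sub>M lborel)" by measurable
    have A: "?A \<in> sets (lborel_upto n)" "emeasure (lborel_upto n) ?A < \<infinity>"
      by (rule emeasure_box_finite)+
    show "?A \<times> {- R..R} \<in> sets (lborel_upto n \<Otimes>\<^sub>M lborel)"
      using A by (intro pair_measureI) auto
    have "emeasure (lborel_upto n \<Otimes>\<^sub>M lborel) (?A \<times> {- R..R}) = emeasure (lborel_upto n) ?A * emeasure lborel {- R..R}"
      using A by (intro sigma_finite_measure.emeasure_pair_measure_Times[OF sigma_finite_lborel]) auto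
    also have "\<dots> < \<infinity>" using A R(1) by (simp add: ennreal_mult_less_top)
    finally show "emeasure (lborel_upto n \<Otimes>\<^sub>M lborel) (?A \<times> {- R..R}) < \<infinity>" .
    show "\<bar>(\<lambda>(c, l). G (comb bs n c, l)) q\<bar> \<le> R" for q using R(2) by (simp add: split_beta')
    fix q assume q: "q \<in> space (lborel_upto n \<Otimes>\<^sub>M lborel)" "q \<notin> ?A \<times> {- R..R}"
    obtain c l where cl: "q = (c, l)" by (cases q)
    have c: "c \<in> space (lborel_upto n)" using q cl by (simp add: space_pair_measure)
    show "(\<lambda>(c, l). G (comb bs n c, l)) q = 0"
    proof (rule ccontr)
      assume "\<not> ?thesis"
      then have "norm (comb bs n c, l) \<le> R" using R(3) cl by simp
      then have "norm (comb bs n c) \<le> R" "\<bar>l\<bar> \<le> R"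
        using norm_fst_le[of "comb bs n c" l] norm_snd_le[of l "comb bs n c"] by auto
      then show False using comb_in_box[OF n c] q(2) cl by auto
    qed
  qed
  from P.Fubini_integral[OF this] show ?thesis by simp
qed

lemma integral_comb_translate:
  fixes H :: "real ^ 'r \<Rightarrow> real"
  assumes n: "n \<le> length bs" and [measurable]: "H \<in> borel_measurable borel"
    and v: "v \<in> span (set (take n bs))"
  shows "(\<integral>c. H (comb bs n c + v) \<partial>lborel_upto n) = (\<integral>c. H (comb bs n c) \<partial>lborel_upto n)"
proof -
  let ?d = "\<lambda>j. coord bs j \<bullet> v"
  let ?T = "\<lambda>c. \<lambda>j\<in>{..<n}. c j + ?d j"
  have T [measurable]: "?T \<in> measurable (lborel_upto n) (lborel_upto n)"
    by (rule measurable_restrict) (simp add: measurable_component_singleton)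
  have comb: "comb bs n c + v = comb bs n (?T c)" for c
  proof -
    have "comb bs n c + comb bs n ?d = comb bs n (?T c)"
      by (simp add: comb_def sum.distrib[symmetric] scaleR_add_left)
    then show ?thesis using span_take_comb[OF n v] by simp
  qed
  have "(\<integral>c. H (comb bs n c) \<partial>lborel_upto n)
      = (\<integral>c. H (comb bs n c) \<partial>distr (lborel_upto n) (lborel_upto n) ?T)"
    by (simp add: lborel_upto_translate)
  also have "\<dots> = (\<integral>c. H (comb bs n (?T c)) \<partial>lborel_upto n)"
  proof -
    have "(\<lambda>c. H (comb bs n c)) \<in> borel_measurable (lborel_upto n)" by measurable
    from integral_distr[OF T this] show ?thesis .
  qed
  finally show ?thesis by (simp add: comb)
qed

lemma integral_comb_Suc:
  assumes n: "n < length bs" and f: "bounded_supported f"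
  shows "(\<integral>c. f (comb bs (Suc n) c) \<partial>lborel_upto (Suc n))
    = (\<integral>c. (\<integral>s. f (comb bs n c + s *\<^sub>R bs ! n) \<partial>lborel) \<partial>lborel_upto n)"
proof -
  have ins: "{..<Suc n} = insert n {..<n}" by auto
  have "integrable (lborel_upto (Suc n)) (\<lambda>c. f (comb bs (Suc n) c))"
    using n f by (intro integrable_comb) auto
  then show ?thesis
    using lborel_product.product_integral_insert[of "{..<n}" n "\<lambda>c. f (comb bs (Suc n) c)"]
    unfolding ins by (simp add: comb_Suc)
qed

lemma integral_comb_hyperplane:
  assumes n: "n < length bs" and f: "bounded_supported f"
    and zero: "\<And>x. coord bs n \<bullet> x \<noteq> 0 \<Longrightarrow> f x = 0"
  shows "(\<integral>c. f (comb bs (Suc n) c) \<partial>lborel_upto (Suc n)) = 0"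
proof -
  have "(\<integral>s. f (comb bs n c + s *\<^sub>R bs ! n) \<partial>lborel) = 0" for c
  proof (rule integral_eq_zero_AE)
    have "f (comb bs n c + s *\<^sub>R bs ! n) = 0" if "s \<noteq> 0" for s
      using n that by (intro zero) (simp add: inner_add_right coord_comb coord_basis[OF basis])
    then show "AE s in lborel. f (comb bs n c + s *\<^sub>R bs ! n) = 0"
      using AE_lborel_singleton[of 0] by (auto elim: eventually_mono)
  qed
  then show ?thesis by (simp add: integral_comb_Suc[OF n f])
qed

end

section \<open>Ray integrals against polynomial densities\<close>

lemma bounded_supported_halfspace_poly:
  assumes F: "halfspace_bounded a F"
  shows "bounded_supported (\<lambda>x. indicator {0..} (a \<bullet> x) * (peval p x * F x))"
proof -
  have [measurable]: "F \<in> borel_measurable borel" using F by (simp add: halfspace_bounded_def)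
  obtain R where R: "0 \<le> R" "\<And>x. a \<bullet> x \<ge> 0 \<Longrightarrow> \<bar>F x\<bar> \<le> R"
    "\<And>x. a \<bullet> x \<ge> 0 \<Longrightarrow> F x \<noteq> 0 \<Longrightarrow> norm x \<le> R"
    using F unfolding halfspace_bounded_def by metis
  obtain C where C: "0 \<le> C" "\<And>x. norm x \<le> R \<Longrightarrow> \<bar>peval p x\<bar> \<le> C"
    using peval_bounded by blast
  show ?thesis
  proof (rule bounded_supportedI)
    show "(\<lambda>x. indicator {0..} (a \<bullet> x) * (peval p x * F x)) \<in> borel_measurable borel" by measurable
    show "\<bar>indicator {0..} (a \<bullet> x) * (peval p x * F x)\<bar> \<le> C * R" for x
    proof (cases "a \<bullet> x \<ge> 0 \<and> F x \<noteq> 0")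
      case True
      then have "\<bar>peval p x\<bar> * \<bar>F x\<bar> \<le> C * R"
        using R C by (intro mult_mono) auto
      then show ?thesis using True by (simp add: abs_mult)
    qed (use R(1) C(1) in \<open>auto simp: indicator_def\<close>)
    show "norm x \<le> R" if "indicator {0..} (a \<bullet> x) * (peval p x * F x) \<noteq> 0" for x
      using that R(3)[of x] by (auto simp: indicator_def split: if_splits)
  qed
qed

lemma bounded_supported_ray_integrand:
  assumes F: "halfspace_bounded a F" and z: "a \<bullet> z > 0"
  shows "bounded_supported
    (\<lambda>(x, l). indicator {0..} l * (indicator {0..} (a \<bullet> x) * (peval p x * F (x + l *\<^sub>R z))))"
    (is "bounded_supported ?G")
proof -
  have [measurable]: "F \<in> borel_measurable borel" using F by (simp add: halfspace_bounded_def)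
  obtain R where R: "0 \<le> R" "\<And>x. a \<bullet> x \<ge> 0 \<Longrightarrow> \<bar>F x\<bar> \<le> R"
    "\<And>x. a \<bullet> x \<ge> 0 \<Longrightarrow> F x \<noteq> 0 \<Longrightarrow> norm x \<le> R"
    using F unfolding halfspace_bounded_def by metis
  define L where "L = norm a * R / (a \<bullet> z)"
  define R' where "R' = R + L * norm z"
  obtain C where C: "0 \<le> C" "\<And>x. norm x \<le> R' \<Longrightarrow> \<bar>peval p x\<bar> \<le> C"
    using peval_bounded by blast
  have bounds: "a \<bullet> (x + l *\<^sub>R z) \<ge> 0" "l \<le> L" "norm x \<le> R'"
    if "l \<ge> 0" "a \<bullet> x \<ge> 0" "F (x + l *\<^sub>R z) \<noteq> 0" for x l
  proof -
    show 1: "a \<bullet> (x + l *\<^sub>R z) \<ge> 0" using that z by (simp add: inner_add_right)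
    then have 2: "norm (x + l *\<^sub>R z) \<le> R" using R(3) that by blast
    then show l: "l \<le> L" unfolding L_def by (rule ray_parameter_bound[OF z that(2)])
    have "norm x \<le> norm (x + l *\<^sub>R z) + norm (l *\<^sub>R z)"
      by (metis add_diff_cancel norm_triangle_ineq4)
    also have "\<dots> \<le> R'"
      unfolding R'_def using 2 l that(1) by (intro add_mono) (auto intro: mult_right_mono)
    finally show "norm x \<le> R'" .
  qed
  show ?thesis
  proof (rule bounded_supportedI)
    have "?G \<in> borel_measurable (borel \<Otimes>\<^sub>M borel)" by measurable
    then show "?G \<in> borel_measurable borel" by (simp add: borel_prod)
    show "\<bar>?G q\<bar> \<le> C * R" for q
    proof -
      obtain x l where q: "q = (x, l)" by (cases q)
      show ?thesis
      proof (cases "l \<ge> 0 \<and> a \<bullet> x \<ge> 0 \<and> F (x + l *\<^sub>R z) \<noteq> 0")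
        case True
        then have "\<bar>peval p x\<bar> * \<bar>F (x + l *\<^sub>R z)\<bar> \<le> C * R"
          using bounds[of l x] R(2)[of "x + l *\<^sub>R z"] C by (intro mult_mono) auto
        then show ?thesis using True by (simp add: abs_mult q)
      qed (use R(1) C(1) in \<open>auto simp: indicator_def q\<close>)
    qed
    show "norm q \<le> R' + L" if nz: "?G q \<noteq> 0" for q
    proof -
      obtain x l where q: "q = (x, l)" by (cases q)
      have "l \<ge> 0" "a \<bullet> x \<ge> 0" "F (x + l *\<^sub>R z) \<noteq> 0"
        using nz by (auto simp: q indicator_def split: if_splits)
      note b = bounds[OF this] this
      have "norm (x, l) \<le> norm x + norm l" by (rule norm_Pair_le)
      then show ?thesis using b by (simp add: q)
    qed
  qed
qed

text \<open>The substitution that moves the ray parameter from the test function to the density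
  keeps the integrand admissible for Fubini.\<close>

lemma bounded_supported_shear:
  fixes z :: "'a::euclidean_space" and G :: "'a \<times> real \<Rightarrow> real"
  assumes "bounded_supported G"
  shows "bounded_supported (\<lambda>(x, l). G (x - l *\<^sub>R z, l))"
proof -
  obtain R where R: "0 \<le> R" "\<And>x. \<bar>G x\<bar> \<le> R" "\<And>x. G x \<noteq> 0 \<Longrightarrow> norm x \<le> R"
    using bounded_supported_bounds[OF assms] by blast
  have "G \<in> borel_measurable borel" using assms by (rule bounded_supported_measurable)
  then have [measurable]: "G \<in> borel_measurable (borel \<Otimes>\<^sub>M borel)" by (simp add: borel_prod)
  show ?thesis
  proof (rule bounded_supportedI)
    have "(\<lambda>(x, l). G (x - l *\<^sub>R z, l)) \<in> borel_measurable (borel \<Otimes>\<^sub>M borel)" by measurable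
    then show "(\<lambda>(x, l). G (x - l *\<^sub>R z, l)) \<in> borel_measurable borel" by (simp add: borel_prod)
    show "\<bar>(\<lambda>(x, l). G (x - l *\<^sub>R z, l)) q\<bar> \<le> R" for q using R(2) by (simp add: split_beta')
    show "norm q \<le> R + R * norm z + R" if "(\<lambda>(x, l). G (x - l *\<^sub>R z, l)) q \<noteq> 0" for q
    proof -
      obtain x l where q: "q = (x, l)" by (cases q)
      then have "norm (x - l *\<^sub>R z, l) \<le> R" using R(3) that by simp
      then have "norm (x - l *\<^sub>R z) \<le> R" and l: "\<bar>l\<bar> \<le> R"
        using norm_fst_le[of "x - l *\<^sub>R z" l] norm_snd_le[of l "x - l *\<^sub>R z"] by auto
      moreover have "norm x \<le> norm (x - l *\<^sub>R z) + norm (l *\<^sub>R z)"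
        by (metis diff_add_cancel norm_triangle_ineq)
      moreover have "norm (l *\<^sub>R z) \<le> R * norm z" using l by (simp add: mult_right_mono)
      moreover have "norm (x, l) \<le> norm x + norm l" by (rule norm_Pair_le)
      ultimately show ?thesis by (simp add: q)
    qed
  qed
qed

text \<open>The fundamental theorem of calculus along the ray traversed backwards from
  \<open>x\<close>. The ray stays in the half-space up to the parameter \<open>t\<close>, where it
  meets the hyperplane and the antiderivative vanishes.\<close>

lemma integral_antideriv:
  assumes z: "a \<bullet> z > 0"
  shows "(\<integral>l. indicator {0..} l * (indicator {0..} (a \<bullet> (x - l *\<^sub>R z)) * peval p (x - l *\<^sub>R z)) \<partial>lborel)
    = indicator {0..} (a \<bullet> x) * peval (antideriv a z p) x"
proof -
  define t where "t = (a \<bullet> x) / (a \<bullet> z)"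
  have z': "a \<bullet> z \<noteq> 0" using z by simp
  have ind: "indicator {0..} l * (indicator {0..} (a \<bullet> (x - l *\<^sub>R z)) * peval p (x - l *\<^sub>R z))
      = peval p (x - l *\<^sub>R z) * indicator {0..t} l" for l
    using z by (auto simp: indicator_def t_def inner_diff_right field_simps)
  show ?thesis
  proof (cases "a \<bullet> x \<ge> 0")
    case True
    then have "t \<ge> 0" using z by (simp add: t_def)
    let ?g = "\<lambda>l. - peval (antideriv a z p) (x + l *\<^sub>R (- z))"
    have neg: "dir_deriv (- z) (antideriv a z p) = - p"
      using dir_deriv_antideriv[OF z', of p] by (simp add: linear_neg[OF linear_dir_deriv_dir])
    have d: "DERIV ?g l :> peval p (x + l *\<^sub>R (- z))" for l
      using DERIV_minus[OF peval_line_deriv[of "antideriv a z p" x "- z" l UNIV]]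
      unfolding neg linear_neg[OF linear_peval] by simp
    have "(\<integral>l. peval p (x + l *\<^sub>R (- z)) * indicator {0..t} l \<partial>lborel) = ?g t - ?g 0"
    proof (rule integral_FTC_Icc_real[OF \<open>t \<ge> 0\<close> d])
      have "continuous_on UNIV (\<lambda>l. peval p (x + l *\<^sub>R (- z)))" by (intro continuous_intros)
      then show "isCont (\<lambda>l. peval p (x + l *\<^sub>R (- z))) l" for l
        by (simp add: continuous_on_eq_continuous_at)
    qed
    moreover have "a \<bullet> (x + t *\<^sub>R (- z)) = 0"
      using z by (simp add: inner_diff_right t_def)
    then have "?g t = 0"
      using vanishing_antideriv[OF z', of p] by (simp add: vanishing_on_hyperplane_def)
    ultimately show ?thesis using True by (simp add: ind)
  next
    case False
    then have "t < 0" using z by (simp add: t_def divide_neg_pos)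
    then show ?thesis using False by (simp add: ind)
  qed
qed

text \<open>The density \<open>p\<close> on the side \<open>a \<bullet> x \<ge> 0\<close> of the
  subspace spanned by the first \<open>n + 1\<close> basis vectors. The normal is a parameter so
  that both sides of the hyperplane are covered, with \<open>a\<close> and
  \<open>- a\<close>.\<close>

definition half_integral ::
  "(real ^ 'r::finite) list \<Rightarrow> nat \<Rightarrow> real ^ 'r \<Rightarrow> 'r symV \<Rightarrow> (real ^ 'r \<Rightarrow> real) \<Rightarrow> real"
  where "half_integral bs n a p F = (\<integral>c. indicator {0..} (a \<bullet> comb bs (Suc n) c) *
    (peval p (comb bs (Suc n) c) * F (comb bs (Suc n) c)) \<partial>lborel_upto (Suc n))"

context
  fixes bs :: "(real ^ 'r::finite) list" and n :: nat and a :: "real ^ 'r"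
  assumes basis: "is_basis_list bs" and n: "n < length bs"
    and a: "a = coord bs n \<or> a = - coord bs n"
begin

lemma inner_comb: "a \<bullet> comb bs n c = 0"
  using a n coord_comb[OF basis, of n n c] by auto

text \<open>Fubini, translation by \<open>- l *\<^sub>R z\<close> within the subspace and Fubini
  again transfer the ray integral from the function to the density, where it produces the
  antiderivative.\<close>

lemma half_integral_ray:
  assumes F: "halfspace_bounded a F" and z: "a \<bullet> z > 0" "z \<in> span (set (take (Suc n) bs))"
  shows "half_integral bs n a p (ray_integral z F) = half_integral bs n a (antideriv a z p) F"
proof -
  let ?G = "\<lambda>(x, l). indicator {0..} l * (indicator {0..} (a \<bullet> x) * (peval p x * F (x + l *\<^sub>R z)))"
  let ?c = "\<lambda>c. comb bs (Suc n) c"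
  have n': "Suc n \<le> length bs" using n by simp
  have G: "bounded_supported ?G" by (rule bounded_supported_ray_integrand[OF F z(1)])
  have G': "bounded_supported (\<lambda>(x, l). ?G (x - l *\<^sub>R z, l))" by (rule bounded_supported_shear[OF G])
  have slice: "(\<lambda>x. ?G (x, l)) \<in> borel_measurable borel" for l
  proof -
    have [measurable]: "?G \<in> borel_measurable (borel \<Otimes>\<^sub>M borel)"
      using bounded_supported_measurable[OF G] by (simp add: borel_prod)
    show ?thesis by measurable
  qed
  have "half_integral bs n a p (ray_integral z F)
      = (\<integral>c. (\<integral>l. ?G (?c c, l) \<partial>lborel) \<partial>lborel_upto (Suc n))"
    unfolding half_integral_def ray_integral_def set_lebesgue_integral_def
    by (rule Bochner_Integration.integral_cong[OF refl])
      (simp add: integral_mult_right_zero[symmetric] mult_ac del: integral_mult_right_zero integral_mult_left_zero)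
  also have "\<dots> = (\<integral>l. (\<integral>c. ?G (?c c, l) \<partial>lborel_upto (Suc n)) \<partial>lborel)"
    by (rule integral_comb_swap[OF basis n' G])
  also have "\<dots> = (\<integral>l. (\<integral>c. ?G (?c c - l *\<^sub>R z, l) \<partial>lborel_upto (Suc n)) \<partial>lborel)"
  proof (rule Bochner_Integration.integral_cong[OF refl])
    fix l
    have "- l *\<^sub>R z \<in> span (set (take (Suc n) bs))" using z(2) by (rule span_scale)
    from integral_comb_translate[OF basis n' slice[of l] this, symmetric]
    show "(\<integral>c. ?G (?c c, l) \<partial>lborel_upto (Suc n)) = (\<integral>c. ?G (?c c - l *\<^sub>R z, l) \<partial>lborel_upto (Suc n))"
      by simp
  qed
  also have "\<dots> = (\<integral>c. (\<integral>l. ?G (?c c - l *\<^sub>R z, l) \<partial>lborel) \<partial>lborel_upto (Suc n))"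
    using integral_comb_swap[OF basis n' G'] by simp
  also have "\<dots> = half_integral bs n a (antideriv a z p) F"
    unfolding half_integral_def
  proof (rule Bochner_Integration.integral_cong[OF refl])
    fix c
    have "(\<integral>l. ?G (?c c - l *\<^sub>R z, l) \<partial>lborel)
        = (\<integral>l. indicator {0..} l * (indicator {0..} (a \<bullet> (?c c - l *\<^sub>R z)) * peval p (?c c - l *\<^sub>R z)) * F (?c c) \<partial>lborel)"
      by (rule Bochner_Integration.integral_cong[OF refl]) (simp add: mult_ac)
    also have "\<dots> = indicator {0..} (a \<bullet> ?c c) * peval (antideriv a z p) (?c c) * F (?c c)"
      unfolding integral_mult_left_zero integral_antideriv[OF z(1)] ..
    finally show "(\<integral>l. ?G (?c c - l *\<^sub>R z, l) \<partial>lborel)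
        = indicator {0..} (a \<bullet> ?c c) * (peval (antideriv a z p) (?c c) * F (?c c))"
      by simp
  qed
  finally show ?thesis .
qed

text \<open>Write \<open>z\<close> as \<open>\<beta>\<close> times the basis vector plus
  \<open>w\<close>, where \<open>w\<close> lies in the lower subspace. Translating the lower
  coordinates by \<open>- l *\<^sub>R w\<close> leaves a pure shift by \<open>\<beta> * l\<close>
  along the basis vector, and the substitution \<open>s = \<beta> * l\<close> supplies the new
  coordinate. The Jacobian \<open>\<bar>\<beta>\<bar> = a \<bullet> z\<close> is compensated by the
  factor in \<open>transport\<close>.\<close>

lemma hyperplane_integral_ray:
  assumes F: "halfspace_bounded a F" and z: "a \<bullet> z > 0" "z \<in> span (set (take (Suc n) bs))"
  shows "(\<integral>c. peval q (comb bs n c) * ray_integral z F (comb bs n c) \<partial>lborel_upto n)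
    = half_integral bs n a (transport a z q) F"
proof -
  let ?G = "\<lambda>(x, l). indicator {0..} l * (indicator {0..} (a \<bullet> x) * (peval q x * F (x + l *\<^sub>R z)))"
  let ?c = "\<lambda>c. comb bs n c"
  let ?b = "bs ! n"
  define \<beta> where "\<beta> = coord bs n \<bullet> z"
  define w where "w = z - \<beta> *\<^sub>R ?b"
  define E where "E = transport a z q"
  define f where "f x = indicator {0..} (a \<bullet> x) * (peval E x * F x)" for x
  have n': "n \<le> length bs" using n by simp
  have nb: "coord bs n \<bullet> ?b = 1" using n by (simp add: coord_basis[OF basis])
  have az: "a \<bullet> z = \<bar>\<beta>\<bar>" "\<beta> \<noteq> 0" and ab: "a \<bullet> z = \<beta> * (a \<bullet> ?b)"
    using a z(1) nb by (auto simp: \<beta>_def)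
  have w: "w \<in> span (set (take n bs))"
  proof -
    have "coord bs j \<bullet> w = 0" if "n \<le> j" "j < length bs" for j
    proof (cases "j = n")
      case True
      then show ?thesis using nb by (simp add: w_def inner_diff_right \<beta>_def)
    next
      case False
      then have "coord bs j \<bullet> z = 0"
        using z(2) n that by (simp add: span_take_iff[OF basis] Suc_le_eq)
      then show ?thesis
        using False n that by (simp add: w_def inner_diff_right coord_basis[OF basis])
    qed
    then show ?thesis using n by (simp add: span_take_iff[OF basis])
  qed
  have G: "bounded_supported ?G" by (rule bounded_supported_ray_integrand[OF F z(1)])
  have slice: "(\<lambda>x. ?G (x, l)) \<in> borel_measurable borel" for l
  proof -
    have [measurable]: "?G \<in> borel_measurable (borel \<Otimes>\<^sub>M borel)"
      using bounded_supported_measurable[OF G] by (simp add: borel_prod)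
    show ?thesis by measurable
  qed
  have f: "bounded_supported f"
    unfolding f_def by (rule bounded_supported_halfspace_poly[OF F])
  \<comment> \<open>Both points lie on one line in direction \<open>z\<close>, on which
    \<open>E\<close> is constant; the left one is on the hyperplane, where \<open>E\<close> is
    \<open>q / (a \<bullet> z)\<close>.\<close>
  have E: "peval q (x - l *\<^sub>R w) = (a \<bullet> z) * peval E (x + (l * \<beta>) *\<^sub>R ?b)"
    if x: "a \<bullet> x = 0" for x l
  proof -
    have aw: "a \<bullet> w = 0" using ab nb a by (simp add: w_def inner_diff_right)
    have "((\<lambda>t. peval E ((x - l *\<^sub>R w) + t *\<^sub>R z)) has_real_derivative 0) (at t)" for t
      using peval_line_deriv[of E "x - l *\<^sub>R w" z t UNIV] dir_deriv_transport[of a z q] z(1)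
      by (simp add: E_def)
    then have "peval E ((x - l *\<^sub>R w) + l *\<^sub>R z) = peval E ((x - l *\<^sub>R w) + 0 *\<^sub>R z)"
      using DERIV_isconst_all[of "\<lambda>t. peval E ((x - l *\<^sub>R w) + t *\<^sub>R z)"] by blast
    moreover have "(x - l *\<^sub>R w) + l *\<^sub>R z = x + (l * \<beta>) *\<^sub>R ?b"
      by (simp add: w_def algebra_simps)
    moreover have "peval E (x - l *\<^sub>R w) = peval q (x - l *\<^sub>R w) / (a \<bullet> z)"
      unfolding E_def using z(1) x aw by (intro peval_transport) (auto simp: inner_diff_right)
    ultimately show ?thesis using z(1) by simp
  qed
  have "(\<integral>c. peval q (?c c) * ray_integral z F (?c c) \<partial>lborel_upto n)
      = (\<integral>c. (\<integral>l. ?G (?c c, l) \<partial>lborel) \<partial>lborel_upto n)"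
    unfolding ray_integral_def set_lebesgue_integral_def
    by (rule Bochner_Integration.integral_cong[OF refl])
      (simp add: inner_comb integral_mult_right_zero[symmetric] mult_ac del: integral_mult_right_zero integral_mult_left_zero)
  also have "\<dots> = (\<integral>l. (\<integral>c. ?G (?c c, l) \<partial>lborel_upto n) \<partial>lborel)"
    by (rule integral_comb_swap[OF basis n' G])
  also have "\<dots> = (\<integral>l. \<bar>\<beta>\<bar> * (\<integral>c. f (?c c + (\<beta> * l) *\<^sub>R ?b) \<partial>lborel_upto n) \<partial>lborel)"
  proof (rule Bochner_Integration.integral_cong[OF refl])
    fix l
    have "- l *\<^sub>R w \<in> span (set (take n bs))" using w by (rule span_scale)
    from integral_comb_translate[OF basis n' slice[of l] this, symmetric]
    have "(\<integral>c. ?G (?c c, l) \<partial>lborel_upto n) = (\<integral>c. ?G (?c c - l *\<^sub>R w, l) \<partial>lborel_upto n)"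
      by simp
    also have "\<dots> = (\<integral>c. \<bar>\<beta>\<bar> * f (?c c + (\<beta> * l) *\<^sub>R ?b) \<partial>lborel_upto n)"
    proof (rule Bochner_Integration.integral_cong[OF refl])
      fix c
      have aw: "a \<bullet> w = 0" using ab nb a by (simp add: w_def inner_diff_right)
      have "a \<bullet> (?c c + (\<beta> * l) *\<^sub>R ?b) = l * (a \<bullet> z)"
        by (simp add: inner_add_right inner_comb ab)
      then have ind: "indicator {0..} (a \<bullet> (?c c + (\<beta> * l) *\<^sub>R ?b)) = (indicator {0..} l :: real)"
        using z(1) by (simp add: indicator_def zero_le_mult_iff)
      have "?c c - l *\<^sub>R w + l *\<^sub>R z = ?c c + (\<beta> * l) *\<^sub>R ?b"
        by (simp add: w_def algebra_simps)
      then have "F (?c c - l *\<^sub>R w + l *\<^sub>R z) = F (?c c + (\<beta> * l) *\<^sub>R ?b)" by (rule arg_cong)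
      then show "?G (?c c - l *\<^sub>R w, l) = \<bar>\<beta>\<bar> * f (?c c + (\<beta> * l) *\<^sub>R ?b)"
        using E[OF inner_comb, of c l]
        by (simp add: f_def ind inner_diff_right inner_comb aw az mult_ac)
    qed
    finally show "(\<integral>c. ?G (?c c, l) \<partial>lborel_upto n)
        = \<bar>\<beta>\<bar> * (\<integral>c. f (?c c + (\<beta> * l) *\<^sub>R ?b) \<partial>lborel_upto n)" by simp
  qed
  also have "\<dots> = (\<integral>s. (\<integral>c. f (?c c + s *\<^sub>R ?b) \<partial>lborel_upto n) \<partial>lborel)"
    using lborel_integral_real_affine[OF az(2), of "\<lambda>s. (\<integral>c. f (?c c + s *\<^sub>R ?b) \<partial>lborel_upto n)" 0]
    by simp
  also have "\<dots> = (\<integral>c. (\<integral>s. f (?c c + s *\<^sub>R ?b) \<partial>lborel) \<partial>lborel_upto n)"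
  proof -
    \<comment> \<open>The indicator of the hyperplane gives the integrand bounded support jointly in
      \<open>x\<close> and \<open>s\<close>, and it is 1 at all points
      \<open>comb bs n c\<close>.\<close>
    let ?H = "\<lambda>(x, s). indicator {0} (a \<bullet> x) * f (x + s *\<^sub>R ?b)"
    obtain R where R: "0 \<le> R" "\<And>x. \<bar>f x\<bar> \<le> R" "\<And>x. f x \<noteq> 0 \<Longrightarrow> norm x \<le> R"
      using bounded_supported_bounds[OF f] by blast
    have [measurable]: "f \<in> borel_measurable borel" using f by (rule bounded_supported_measurable)
    have H: "bounded_supported ?H"
    proof (rule bounded_supportedI)
      have "?H \<in> borel_measurable (borel \<Otimes>\<^sub>M borel)" by measurable
      then show "?H \<in> borel_measurable borel" by (simp add: borel_prod)
      show "\<bar>?H q\<bar> \<le> R" for q using R by (auto simp: indicator_def split_beta')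
      show "norm q \<le> R + norm a * R * norm ?b + norm a * R" if nz: "?H q \<noteq> 0" for q
      proof -
        obtain x s where q: "q = (x, s)" by (cases q)
        have x: "a \<bullet> x = 0" and fx: "f (x + s *\<^sub>R ?b) \<noteq> 0"
          using nz by (auto simp: q indicator_def split: if_splits)
        have nx: "norm (x + s *\<^sub>R ?b) \<le> R" using R(3) fx by blast
        have "\<bar>s\<bar> = \<bar>a \<bullet> (x + s *\<^sub>R ?b)\<bar>" using x a nb by (auto simp: inner_add_right)
        also have "\<dots> \<le> norm a * norm (x + s *\<^sub>R ?b)" by (rule Cauchy_Schwarz_ineq2)
        also have "\<dots> \<le> norm a * R" by (intro mult_left_mono nx) simp
        finally have s: "\<bar>s\<bar> \<le> norm a * R" .
        have "norm x \<le> norm (x + s *\<^sub>R ?b) + norm (s *\<^sub>R ?b)"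
          by (metis add_diff_cancel norm_triangle_ineq4)
        moreover have "norm (s *\<^sub>R ?b) \<le> norm a * R * norm ?b" using s by (simp add: mult_right_mono)
        moreover have "norm (x, s) \<le> norm x + norm s" by (rule norm_Pair_le)
        ultimately show ?thesis using nx s by (simp add: q)
      qed
    qed
    show ?thesis using integral_comb_swap[OF basis n' H] by (simp add: inner_comb)
  qed
  also have "\<dots> = half_integral bs n a E F"
    unfolding half_integral_def using integral_comb_Suc[OF basis n f] by (simp add: f_def)
  finally show ?thesis unfolding E_def .
qed

lemma half_integral_rays:
  assumes F: "halfspace_bounded a F"
    and zs: "\<forall>z\<in>set zs. a \<bullet> z > 0 \<and> z \<in> span (set (take (Suc n) bs))"
  shows "half_integral bs n a p (rays zs F) = half_integral bs n a (fold (antideriv a) zs p) F"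
  using zs
proof (induction zs arbitrary: p)
  case (Cons z zs)
  then have "half_integral bs n a p (ray_integral z (rays zs F)) = half_integral bs n a (antideriv a z p) (rays zs F)"
    by (intro half_integral_ray halfspace_bounded_rays F) auto
  then show ?case using Cons by simp
qed simp

lemma hyperplane_integral_rays:
  assumes F: "halfspace_bounded a F" and ne: "zs \<noteq> []"
    and zs: "\<forall>z\<in>set zs. a \<bullet> z > 0 \<and> z \<in> span (set (take (Suc n) bs))"
    and b: "a \<bullet> b \<noteq> 0"
  shows "(\<integral>c. peval q (comb bs n c) * rays zs F (comb bs n c) \<partial>lborel_upto n)
    = half_integral bs n a (layer_poly a b zs q) F"
proof -
  obtain y ys where ys: "zs = y # ys" using ne by (cases zs) auto
  have "(\<integral>c. peval q (comb bs n c) * rays zs F (comb bs n c) \<partial>lborel_upto n)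
      = half_integral bs n a (transport a y q) (rays ys F)"
    unfolding ys rays_Cons using zs ys by (intro hyperplane_integral_ray halfspace_bounded_rays F) auto
  also have "\<dots> = half_integral bs n a (fold (antideriv a) ys (transport a y q)) F"
    using zs ys by (intro half_integral_rays F) auto
  also have "fold (antideriv a) ys (transport a y q) = layer_poly a b zs q"
    unfolding ys using zs ys by (intro layer_poly_Cons[OF b, symmetric]) auto
  finally show ?thesis .
qed

end

section \<open>Signs of the layer polynomials\<close>

lemma antideriv_scaleR:
  assumes "a \<bullet> z \<noteq> 0"
  shows "antideriv a z (c *\<^sub>R p) = c *\<^sub>R antideriv a z p"
  using assms vanishing_antideriv[OF assms, of p]
  by (intro antideriv_eqI)
    (auto simp: dir_deriv_scaleR dir_deriv_antideriv vanishing_on_hyperplane_def peval_scaleR)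

lemma antideriv_uminus_vector:
  assumes "a \<bullet> z \<noteq> 0"
  shows "antideriv a (- z) p = (- 1) *\<^sub>R antideriv a z p"
proof (rule antideriv_eqI)
  have neg: "dir_deriv (- z) g = (- 1) *\<^sub>R dir_deriv z g" for g
    using linear_scale[OF linear_dir_deriv_dir, of "- 1" z g] by simp
  show "dir_deriv (- z) ((- 1) *\<^sub>R antideriv a z p) = p"
    unfolding neg dir_deriv_scaleR dir_deriv_antideriv[OF assms] scaleR_scaleR by simp
  show "vanishing_on_hyperplane a ((- 1) *\<^sub>R antideriv a z p)"
    using vanishing_antideriv[OF assms, of p] unfolding vanishing_on_hyperplane_def peval_scaleR by simp
qed (use assms in simp)

lemma antideriv_uminus_normal: "antideriv (- a) z p = antideriv a z p"
  by (simp add: antideriv_def vanishing_on_hyperplane_def)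

lemma transport_uminus_normal: "transport (- a) z q = (- 1) *\<^sub>R transport a z q"
  unfolding transport_def antideriv_uminus_normal scaleR_scaleR by simp

lemma fold_antideriv_scaleR:
  "\<forall>y\<in>set ys. a \<bullet> y \<noteq> 0 \<Longrightarrow> fold (antideriv a) ys (c *\<^sub>R p) = c *\<^sub>R fold (antideriv a) ys p"
  by (induction ys arbitrary: p) (auto simp: antideriv_scaleR)

lemma fold_antideriv_uminus:
  "\<forall>y\<in>set ys. a \<bullet> y \<noteq> 0 \<Longrightarrow>
    fold (antideriv a) (map uminus ys) p = ((- 1) ^ length ys) *\<^sub>R fold (antideriv a) ys p"
proof (induction ys arbitrary: p)
  case (Cons y ys)
  have y: "a \<bullet> y \<noteq> 0" and ys: "\<forall>y\<in>set ys. a \<bullet> y \<noteq> 0" using Cons.prems by simp_all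
  have "fold (antideriv a) (map uminus (y # ys)) p = fold (antideriv a) (map uminus ys) (antideriv a (- y) p)"
    by simp
  also have "\<dots> = ((- 1) ^ length ys) *\<^sub>R fold (antideriv a) ys ((- 1) *\<^sub>R antideriv a y p)"
    unfolding antideriv_uminus_vector[OF y] by (rule Cons.IH[OF ys])
  also have "\<dots> = ((- 1) ^ length (y # ys)) *\<^sub>R fold (antideriv a) (y # ys) p"
    unfolding fold_antideriv_scaleR[OF ys] scaleR_scaleR by simp
  finally show ?case .
qed simp

lemma layer_poly_uminus_vectors:
  assumes "\<forall>y\<in>set (xs @ ys). a \<bullet> y \<noteq> 0"
  shows "layer_poly a b (xs @ map uminus ys) q = ((- 1) ^ length ys) *\<^sub>R layer_poly a b (xs @ ys) q"
  using assms by (simp add: layer_poly_def fold_antideriv_uminus dir_deriv_scaleR)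

text \<open>The hyperplane, and with it every antiderivative, stays the same; only the factor
  \<open>1 / (a \<bullet> b)\<close> in \<open>transport\<close> changes sign.\<close>

lemma layer_poly_uminus_normal:
  assumes "\<forall>y\<in>set ys. a \<bullet> y \<noteq> 0"
  shows "layer_poly (- a) b ys q = (- 1) *\<^sub>R layer_poly a b ys q"
proof -
  have "antideriv (- a) = antideriv a" by (intro ext) (rule antideriv_uminus_normal)
  then show ?thesis
    unfolding layer_poly_def transport_uminus_normal using assms
    by (simp only: fold_antideriv_scaleR dir_deriv_scaleR)
qed

section \<open>Convolutions of splines\<close>

text \<open>When both summands are controlled linearly by the sum, no cancellation at infinity is
  possible, and preimages of compact sets are closed and bounded.\<close>

lemma add_properI:
  fixes A B :: "'a::euclidean_space set"
  assumes closed: "closed A" "closed B"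
    and bound: "\<And>x y. x \<in> A \<Longrightarrow> y \<in> B \<Longrightarrow> norm x \<le> C * norm (x + y) \<and> norm y \<le> C * norm (x + y)"
    and C: "0 \<le> C"
  shows "add_proper A B"
  unfolding add_proper_def
proof (intro conjI allI impI closed)
  fix K :: "'a set" assume K: "compact K"
  then obtain R where R: "\<And>x. x \<in> K \<Longrightarrow> norm x \<le> R"
    using compact_imp_bounded bounded_normE by metis
  have "{z \<in> A \<times> B. fst z + snd z \<in> K} = (A \<times> B) \<inter> (\<lambda>z. fst z + snd z) -` K" by auto
  moreover have "closed ((\<lambda>z::'a \<times> 'a. fst z + snd z) -` K)"
    by (intro closed_vimage compact_imp_closed K continuous_intros)
  ultimately have "closed {z \<in> A \<times> B. fst z + snd z \<in> K}"
    using closed by (simp add: closed_Times closed_Int)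
  moreover have "bounded {z \<in> A \<times> B. fst z + snd z \<in> K}"
  proof (rule boundedI)
    fix z assume z: "z \<in> {z \<in> A \<times> B. fst z + snd z \<in> K}"
    obtain x y where xy: "z = (x, y)" by (cases z)
    have "norm x \<le> C * norm (x + y)" "norm y \<le> C * norm (x + y)"
      using bound[of x y] z by (auto simp: xy)
    moreover have "C * norm (x + y) \<le> C * R" using R[of "x + y"] z C by (auto simp: xy intro: mult_left_mono)
    moreover have "norm (x, y) \<le> norm x + norm y" by (rule norm_Pair_le)
    ultimately show "norm z \<le> C * R + C * R" by (simp add: xy)
  qed
  ultimately show "compact {z \<in> A \<times> B. fst z + snd z \<in> K}"
    by (simp add: compact_eq_bounded_closed)
qed

lemma norm_le_inner:
  fixes a x :: "'a::euclidean_space"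
  assumes "e > 0" "e * norm x \<le> t" "t \<le> \<bar>a \<bullet> y\<bar>"
  shows "norm x \<le> (norm a / e) * norm y"
proof -
  have "e * norm x \<le> norm a * norm y"
    using assms Cauchy_Schwarz_ineq2[of a y] by linarith
  then show ?thesis using assms(1) by (simp add: field_simps)
qed

section \<open>Rays inside cones\<close>

lemma cone_constant_exists:
  assumes "\<forall>z\<in>set zs. a \<bullet> z > (0::real)"
  shows "\<exists>e>0. \<forall>z\<in>set zs. e * norm z \<le> a \<bullet> z"
  using assms
proof (induction zs)
  case (Cons z zs)
  then obtain e where e: "e > 0" "\<forall>z\<in>set zs. e * norm z \<le> a \<bullet> z" by auto
  have z: "a \<bullet> z > 0" "norm z > 0" using Cons.prems by auto
  let ?e = "min e ((a \<bullet> z) / norm z)"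
  have "?e > 0" using e z by simp
  moreover have "?e * norm z \<le> a \<bullet> z"
  proof -
    have "?e * norm z \<le> ((a \<bullet> z) / norm z) * norm z" by (intro mult_right_mono) auto
    then show ?thesis using z by simp
  qed
  moreover have "?e * norm y \<le> a \<bullet> y" if "y \<in> set zs" for y
  proof -
    have "?e * norm y \<le> e * norm y" by (intro mult_right_mono) auto
    then show ?thesis using e that by fastforce
  qed
  ultimately show ?case by (intro exI[of _ ?e]) auto
qed (auto intro: exI[of _ 1])

lemma rays_cong_on:
  assumes step: "\<And>x z l. x \<in> A \<Longrightarrow> z \<in> set zs \<Longrightarrow> 0 \<le> l \<Longrightarrow> x + l *\<^sub>R z \<in> A"
    and eq: "\<And>x. x \<in> A \<Longrightarrow> \<phi> x = \<psi> x" and "x \<in> A"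
  shows "rays zs \<phi> x = rays zs \<psi> x"
  using step \<open>x \<in> A\<close>
proof (induction zs arbitrary: x)
  case (Cons z zs)
  have "indicator {0..} l *\<^sub>R rays zs \<phi> (x + l *\<^sub>R z) = indicator {0..} l *\<^sub>R rays zs \<psi> (x + l *\<^sub>R z)" for l :: real
  proof (cases "l \<ge> 0")
    case True
    then have "x + l *\<^sub>R z \<in> A" using Cons.prems by simp
    then have "rays zs \<phi> (x + l *\<^sub>R z) = rays zs \<psi> (x + l *\<^sub>R z)"
      using Cons.prems(1) by (intro Cons.IH) auto
    then show ?thesis by simp
  qed simp
  then show ?case by (simp only: rays_Cons ray_integral_def set_lebesgue_integral_def)
qed (simp add: eq)

lemma rays_zero: "rays zs (\<lambda>_. 0) = (\<lambda>_. 0)"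
  by (induction zs) (auto simp: ray_integral_def set_lebesgue_integral_def)

text \<open>Used as carrier in place of the cone generated by the vectors: it is closed for trivial
  reasons, stable under the rays, and the constant \<open>e\<close> directly yields the norm
  estimates for \<open>add_properI\<close>.\<close>

definition cone_set :: "'a::euclidean_space \<Rightarrow> real \<Rightarrow> 'a set"
  where "cone_set a e = {x. e * norm x \<le> a \<bullet> x}"

lemma cone_set_step:
  assumes "x \<in> cone_set a e" "z \<in> cone_set a e" "0 \<le> l" "0 < e"
  shows "x + l *\<^sub>R z \<in> cone_set a e"
proof -
  have "e * norm (x + l *\<^sub>R z) \<le> e * (norm x + norm (l *\<^sub>R z))"
    using assms(4) by (intro mult_left_mono norm_triangle_ineq) auto
  also have "\<dots> = e * norm x + l * (e * norm z)" using assms(3) by (simp add: algebra_simps)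
  also have "\<dots> \<le> a \<bullet> x + l * (a \<bullet> z)"
    using assms by (intro add_mono mult_left_mono) (auto simp: cone_set_def)
  finally show ?thesis by (simp add: cone_set_def inner_add_right)
qed

lemma slice_preserving_rays:
  assumes "\<forall>z\<in>set zs. a \<bullet> z > 0"
  shows "slice_preserving (\<lambda>\<phi>. rays zs \<phi> 0)"
  unfolding slice_preserving_def
proof (intro allI impI)
  fix \<Psi> :: "'a \<times> 'a \<Rightarrow> real" assume \<Psi>: "bounded_supported \<Psi>"
  obtain R where R: "0 \<le> R" "\<And>x. \<bar>\<Psi> x\<bar> \<le> R" "\<And>x. \<Psi> x \<noteq> 0 \<Longrightarrow> norm x \<le> R"
    using bounded_supported_bounds[OF \<Psi>] by blast
  have "\<Psi> \<in> borel_measurable borel" using \<Psi> by (rule bounded_supported_measurable)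
  then have meas: "\<Psi> \<in> borel_measurable (borel \<Otimes>\<^sub>M borel)" by (simp add: borel_prod)
  have "norm y \<le> R" if "\<Psi> (x, y) \<noteq> 0" for x y
    using R(3)[OF that] norm_snd_le[of y x] by linarith
  then have "halfspace_family borel a (\<lambda>x y. \<Psi> (x, y))"
    unfolding halfspace_family_def using meas R by (intro conjI exI[of _ R]) auto
  then have fam: "halfspace_family borel a (\<lambda>x. rays zs (\<lambda>y. \<Psi> (x, y)))"
    by (rule halfspace_family_rays) (rule assms)
  then obtain R' where R': "\<And>x. \<bar>rays zs (\<lambda>y. \<Psi> (x, y)) 0\<bar> \<le> R'"
    unfolding halfspace_family_def by (metis UNIV_I inner_zero_right order_refl space_borel)
  have "(\<lambda>(x, y). rays zs (\<lambda>y. \<Psi> (x, y)) y) \<in> borel_measurable (borel \<Otimes>\<^sub>M borel)"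
    using fam by (simp add: halfspace_family_def)
  from measurable_compose[OF measurable_Pair2'[of 0] this]
  have m: "(\<lambda>x. rays zs (\<lambda>y. \<Psi> (x, y)) 0) \<in> borel_measurable borel" by simp
  show "bounded_supported (\<lambda>x. rays zs (\<lambda>y. \<Psi> (x, y)) 0)"
  proof (rule bounded_supportedI[OF m R'])
    fix x assume nz: "rays zs (\<lambda>y. \<Psi> (x, y)) 0 \<noteq> 0"
    show "norm x \<le> R"
    proof (rule ccontr)
      assume "\<not> norm x \<le> R"
      then have "\<Psi> (x, y) = 0" for y
        using R(3)[of "(x, y)"] norm_fst_le[of x y] by linarith
      then show False using nz by (simp add: rays_zero)
    qed
  qed
qed

lemma bounded_supported_diff_scaled:
  assumes f: "bounded_supported f" and g: "bounded_supported g"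
  shows "bounded_supported (\<lambda>x. c * f x - d * g x)"
proof -
  obtain R where R: "0 \<le> R" "\<And>x. \<bar>f x\<bar> \<le> R" "\<And>x. f x \<noteq> 0 \<Longrightarrow> norm x \<le> R"
    using bounded_supported_bounds[OF f] by blast
  obtain R' where R': "0 \<le> R'" "\<And>x. \<bar>g x\<bar> \<le> R'" "\<And>x. g x \<noteq> 0 \<Longrightarrow> norm x \<le> R'"
    using bounded_supported_bounds[OF g] by blast
  have [measurable]: "f \<in> borel_measurable borel" "g \<in> borel_measurable borel"
    using f g by (auto dest: bounded_supported_measurable)
  show ?thesis
  proof (rule bounded_supportedI)
    show "(\<lambda>x. c * f x - d * g x) \<in> borel_measurable borel" by measurable
    show "\<bar>c * f x - d * g x\<bar> \<le> \<bar>c\<bar> * R + \<bar>d\<bar> * R'" for x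
    proof -
      have "\<bar>c * f x\<bar> \<le> \<bar>c\<bar> * R" "\<bar>d * g x\<bar> \<le> \<bar>d\<bar> * R'"
        unfolding abs_mult using R(2)[of x] R'(2)[of x] by (intro mult_left_mono; simp)+
      then show ?thesis by linarith
    qed
    show "norm x \<le> max R R'" if "c * f x - d * g x \<noteq> 0" for x
      using that R(3)[of x] R'(3)[of x] by (cases "f x = 0") (auto simp: le_max_iff_disj)
  qed
qed

lemma represents_on_spline:
  assumes "e > 0" "\<forall>y\<in>set Y. a \<bullet> y > 0" "set Y \<subseteq> cone_set a e"
  shows "represents_on (\<lambda>\<phi>. rays Y \<phi> 0) (spline Y) (cone_set a e)"
  unfolding represents_on_def
proof (intro conjI allI impI)
  fix \<phi> :: "'a \<Rightarrow> real" assume "bounded_supported \<phi>"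
  then show "spline Y \<phi> = rays Y \<phi> 0"
    using assms by (intro spline_eq_rays[of a] bounded_supported_halfspace)
next
  fix \<phi> \<psi> :: "'a \<Rightarrow> real" assume eq: "\<forall>x\<in>cone_set a e. \<phi> x = \<psi> x"
  show "rays Y \<phi> 0 = rays Y \<psi> 0"
    by (rule rays_cong_on[of "cone_set a e"])
      (use assms eq in \<open>auto intro: cone_set_step simp: subset_iff\<close>, simp add: cone_set_def)
qed (simp add: rays_zero)

lemma closed_cone_set: "closed (cone_set a e)"
  unfolding cone_set_def by (intro closed_Collect_le continuous_intros)

lemma conv_splines:
  assumes pos: "\<forall>y\<in>set (Y @ Y'). a \<bullet> y > 0" and \<phi>: "bounded_supported \<phi>"
  shows "conv (spline Y) (spline Y') \<phi> = rays (Y @ Y') \<phi> 0"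
proof -
  obtain e where e: "e > 0" "\<forall>y\<in>set (Y @ Y'). e * norm y \<le> a \<bullet> y"
    using cone_constant_exists[OF pos] by blast
  let ?C = "cone_set a e"
  \<comment> \<open>Both summands have nonnegative inner product with \<open>a\<close>, so
    \<open>a \<bullet> (x + y)\<close> dominates each of \<open>a \<bullet> x\<close> and
    \<open>a \<bullet> y\<close>, and these dominate the norms.\<close>
  have "add_proper ?C ?C"
  proof (rule add_properI[OF closed_cone_set closed_cone_set])
    fix x y assume xy: "x \<in> ?C" "y \<in> ?C"
    then have nonneg: "a \<bullet> x \<ge> 0" "a \<bullet> y \<ge> 0"
      using e(1) by (auto simp: cone_set_def intro: order_trans[rotated])
    then have "a \<bullet> x \<le> \<bar>a \<bullet> (x + y)\<bar>" "a \<bullet> y \<le> \<bar>a \<bullet> (x + y)\<bar>"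
      by (auto simp: inner_add_right)
    then show "norm x \<le> norm a / e * norm (x + y) \<and> norm y \<le> norm a / e * norm (x + y)"
      using xy norm_le_inner[OF e(1)] by (auto simp: cone_set_def)
  qed (use e in simp)
  moreover have "represents_on (\<lambda>\<phi>. rays Y \<phi> 0) (spline Y) ?C"
    "represents_on (\<lambda>\<phi>. rays Y' \<phi> 0) (spline Y') ?C"
    by (rule represents_on_spline; use e pos in \<open>auto simp: cone_set_def\<close>)+
  moreover have "slice_preserving (\<lambda>\<phi>. rays Y' \<phi> 0)"
    using pos by (intro slice_preserving_rays[of _ a]) auto
  ultimately have "conv (spline Y) (spline Y') \<phi> = rays Y (\<lambda>x. rays Y' (\<lambda>y. \<phi> (x + y)) 0) 0"
    using \<phi> by (rule conv_represented)
  then show ?thesis by (simp add: rays_translate rays_append)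
qed

section \<open>The distribution of a layer\<close>

text \<open>The value at 0 is the functional of the layer. Other base points \<open>x\<close> are
  needed because the convolution with the lower layers starts the rays at points of the lower
  subspace.\<close>

definition signed_rays :: "'a::euclidean_space list \<Rightarrow> 'a list \<Rightarrow> ('a \<Rightarrow> real) \<Rightarrow> 'a \<Rightarrow> real"
  where "signed_rays P N \<phi> x = (- 1) ^ length N * rays (P @ map uminus N) \<phi> x
    - (- 1) ^ length P * rays (map uminus P @ N) \<phi> x"

lemma mset_pos_neg_part:
  "mset (pos_part bs Z i @ neg_part bs Z i) = mset (filter (\<lambda>u. u \<in> layer bs i) Z)"
  by (induction Z) (auto simp: pos_part_def neg_part_def)

context
  fixes bs Z :: "(real ^ 'r::finite) list" and n :: nat
  assumes basis: "is_basis_list bs" and n: "n < length bs"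
begin

abbreviation "layer_normal \<equiv> coord bs n"
abbreviation "layer_pos_part \<equiv> pos_part bs Z n"
abbreviation "layer_neg_part \<equiv> neg_part bs Z n"

lemma pos_neg_part_signs:
  "y \<in> set layer_pos_part \<Longrightarrow> layer_normal \<bullet> y > 0 \<and> y \<in> span (set (take (Suc n) bs))"
  "y \<in> set layer_neg_part \<Longrightarrow> layer_normal \<bullet> y < 0 \<and> y \<in> span (set (take (Suc n) bs))"
  using layer_nz[OF basis n]
  by (auto simp: pos_part_def neg_part_def positive_in_def coord_eq_representation[OF basis, symmetric]
      layer_def not_less less_le)

text \<open>The two terms of the layer live in opposite cones. The carrier is the double cone
  containing both; it meets the hyperplane \<open>layer_normal \<bullet> x = 0\<close> only in
  0.\<close>

lemma R_layer_represented:
  obtains e where "e > 0"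
    "represents_on (\<lambda>\<phi>. signed_rays layer_pos_part layer_neg_part \<phi> 0) (R_layer bs Z n) {x. e * norm x \<le> \<bar>layer_normal \<bullet> x\<bar>}"
proof -
  let ?zs = "layer_pos_part @ map uminus layer_neg_part" and ?zs' = "map uminus layer_pos_part @ layer_neg_part"
  have pos: "\<forall>z\<in>set ?zs. layer_normal \<bullet> z > 0" and neg: "\<forall>z\<in>set ?zs'. (- layer_normal) \<bullet> z > 0"
    using pos_neg_part_signs by auto
  obtain e where e: "e > 0" "\<forall>z\<in>set ?zs. e * norm z \<le> layer_normal \<bullet> z"
    using cone_constant_exists[OF pos] by blast
  \<comment> \<open>Negation maps the vectors of the second list to those of the first, so the same
    constant serves both cones.\<close>
  have e': "\<forall>z\<in>set ?zs'. e * norm z \<le> (- layer_normal) \<bullet> z"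
  proof
    fix z assume "z \<in> set ?zs'"
    then have "- z \<in> set ?zs" by auto
    then have "e * norm (- z) \<le> layer_normal \<bullet> (- z)" using e(2) by blast
    then show "e * norm z \<le> (- layer_normal) \<bullet> z" by simp
  qed
  let ?A = "{x. e * norm x \<le> \<bar>layer_normal \<bullet> x\<bar>}"
  have sub: "cone_set layer_normal e \<subseteq> ?A" "cone_set (- layer_normal) e \<subseteq> ?A" by (auto simp: cone_set_def)
  have cone0: "0 \<in> cone_set b e" for b :: "real ^ 'r" by (simp add: cone_set_def)
  have "represents_on (\<lambda>\<phi>. signed_rays layer_pos_part layer_neg_part \<phi> 0) (R_layer bs Z n) ?A"
    unfolding represents_on_def
  proof (intro conjI allI impI)
    fix \<phi> :: "real ^ 'r \<Rightarrow> real" assume \<phi>: "bounded_supported \<phi>"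
    have "conv (spline layer_pos_part) (spline (map uminus layer_neg_part)) \<phi> = rays ?zs \<phi> 0"
      by (rule conv_splines[OF pos \<phi>])
    moreover have "conv (spline (map uminus layer_pos_part)) (spline layer_neg_part) \<phi> = rays ?zs' \<phi> 0"
      by (rule conv_splines[OF neg \<phi>])
    ultimately show "R_layer bs Z n \<phi> = signed_rays layer_pos_part layer_neg_part \<phi> 0"
      by (simp add: R_layer_def T_plus_def T_minus_def signed_rays_def)
  next
    fix \<phi> \<psi> :: "real ^ 'r \<Rightarrow> real" assume eq: "\<forall>x\<in>?A. \<phi> x = \<psi> x"
    have "rays ?zs \<phi> 0 = rays ?zs \<psi> 0"
    proof (rule rays_cong_on[of "cone_set layer_normal e"])
      show "x + l *\<^sub>R z \<in> cone_set layer_normal e" if "x \<in> cone_set layer_normal e" "z \<in> set ?zs" "0 \<le> l" for x z l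
        using that e by (intro cone_set_step) (auto simp: cone_set_def)
      show "\<phi> x = \<psi> x" if "x \<in> cone_set layer_normal e" for x using that eq sub by blast
    qed (rule cone0)
    moreover have "rays ?zs' \<phi> 0 = rays ?zs' \<psi> 0"
    proof (rule rays_cong_on[of "cone_set (- layer_normal) e"])
      show "x + l *\<^sub>R z \<in> cone_set (- layer_normal) e" if "x \<in> cone_set (- layer_normal) e" "z \<in> set ?zs'" "0 \<le> l" for x z l
        using that e(1) e' by (intro cone_set_step) (auto simp: cone_set_def)
      show "\<phi> x = \<psi> x" if "x \<in> cone_set (- layer_normal) e" for x using that eq sub by blast
    qed (rule cone0)
    ultimately show "signed_rays layer_pos_part layer_neg_part \<phi> 0 = signed_rays layer_pos_part layer_neg_part \<psi> 0" by (simp add: signed_rays_def)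
  qed (simp add: signed_rays_def rays_zero)
  then show thesis using e(1) that by blast
qed

lemma slice_preserving_signed_rays: "slice_preserving (\<lambda>\<phi>. signed_rays layer_pos_part layer_neg_part \<phi> 0)"
proof -
  have "slice_preserving (\<lambda>\<phi>. rays (layer_pos_part @ map uminus layer_neg_part) \<phi> 0)"
    using pos_neg_part_signs by (intro slice_preserving_rays[of _ layer_normal]) auto
  moreover have "slice_preserving (\<lambda>\<phi>. rays (map uminus layer_pos_part @ layer_neg_part) \<phi> 0)"
    using pos_neg_part_signs by (intro slice_preserving_rays[of _ "- layer_normal"]) auto
  ultimately show ?thesis
    unfolding slice_preserving_def signed_rays_def
    by (auto intro!: bounded_supported_diff_scaled)
qed

text \<open>Why the difference of two one-sided splines has a single polynomial density
  \<open>L\<close>: negating vectors costs one sign each, which the prefactors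
  \<open>(- 1) ^ length\<close> compensate, and passing to the opposite normal costs one further
  sign, which the minus between the two terms compensates. So \<open>L\<close> appears with
  coefficient 1 on both sides of the hyperplane.\<close>

lemma integral_signed_rays:
  assumes \<phi>: "bounded_supported \<phi>"
  shows "(\<integral>c. peval q (comb bs n c) * signed_rays layer_pos_part layer_neg_part \<phi> (comb bs n c) \<partial>lborel_upto n)
    = (\<integral>c. peval (layer_poly layer_normal (bs ! n) (filter (\<lambda>u. u \<in> layer bs n) Z) q) (comb bs (Suc n) c) *
        \<phi> (comb bs (Suc n) c) \<partial>lborel_upto (Suc n))"
proof (cases "layer_pos_part @ layer_neg_part = []")
  case True
  then have "filter (\<lambda>u. u \<in> layer bs n) Z = []"
    using mset_pos_neg_part[of bs Z n] by simp
  moreover have "layer_normal \<bullet> bs ! n \<noteq> 0" using n by (simp add: coord_basis[OF basis])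
  \<comment> \<open>For an empty layer both ray terms are \<open>\<phi>\<close> itself and cancel,
    and the layer polynomial of the empty list is 0.\<close>
  ultimately show ?thesis using True by (simp add: signed_rays_def)
next
  case False
  let ?b = "bs ! n" and ?x = "\<lambda>c. comb bs n c" and ?y = "\<lambda>c. comb bs (Suc n) c"
  let ?zs = "layer_pos_part @ map uminus layer_neg_part" and ?zs' = "map uminus layer_pos_part @ layer_neg_part"
  define L where "L = layer_poly layer_normal ?b (layer_pos_part @ layer_neg_part) q"
  have b: "layer_normal \<bullet> ?b \<noteq> 0" "(- layer_normal) \<bullet> ?b \<noteq> 0" using n by (auto simp: coord_basis[OF basis])
  have pos: "\<forall>z\<in>set ?zs. layer_normal \<bullet> z > 0 \<and> z \<in> span (set (take (Suc n) bs))"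
    and neg: "\<forall>z\<in>set ?zs'. (- layer_normal) \<bullet> z > 0 \<and> z \<in> span (set (take (Suc n) bs))"
    using pos_neg_part_signs by (auto simp: span_neg)
  have nz: "\<forall>y\<in>set (layer_pos_part @ layer_neg_part). layer_normal \<bullet> y \<noteq> 0"
    using pos_neg_part_signs by force
  have n': "n \<le> length bs" "Suc n \<le> length bs" using n by auto
  have int: "integrable (lborel_upto n) (\<lambda>c. peval q (?x c) * rays ws \<phi> (?x c))"
    if "a' = layer_normal \<or> a' = - layer_normal" "\<forall>z\<in>set ws. a' \<bullet> z > 0" for a' ws
  proof -
    have "halfspace_bounded a' (rays ws \<phi>)"
      using that \<phi> by (intro halfspace_bounded_rays bounded_supported_halfspace)
    from integrable_comb[OF basis n'(1) bounded_supported_halfspace_poly[OF this, of q]]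
    show ?thesis using inner_comb[OF basis n that(1)] by simp
  qed
  have half: "half_integral bs n a' (c *\<^sub>R p) \<phi> = c * half_integral bs n a' p \<phi>" for a' c p
  proof -
    have "half_integral bs n a' (c *\<^sub>R p) \<phi> = (\<integral>t. c * (indicator {0..} (a' \<bullet> comb bs (Suc n) t) *
        (peval p (comb bs (Suc n) t) * \<phi> (comb bs (Suc n) t))) \<partial>lborel_upto (Suc n))"
      unfolding half_integral_def peval_scaleR real_scaleR_def
      by (rule Bochner_Integration.integral_cong[OF refl]) (simp only: mult_ac)
    then show ?thesis by (simp add: half_integral_def)
  qed
  have plus: "(\<integral>c. peval q (?x c) * rays ?zs \<phi> (?x c) \<partial>lborel_upto n)
      = (- 1) ^ length layer_neg_part * half_integral bs n layer_normal L \<phi>"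
  proof -
    have "(\<integral>c. peval q (?x c) * rays ?zs \<phi> (?x c) \<partial>lborel_upto n)
        = half_integral bs n layer_normal (layer_poly layer_normal ?b ?zs q) \<phi>"
      using False pos by (intro hyperplane_integral_rays[OF basis n] bounded_supported_halfspace \<phi> b) auto
    also have "layer_poly layer_normal ?b ?zs q = ((- 1) ^ length layer_neg_part) *\<^sub>R L"
      unfolding L_def by (rule layer_poly_uminus_vectors[OF nz])
    finally show ?thesis by (simp only: half)
  qed
  have minus: "(\<integral>c. peval q (?x c) * rays ?zs' \<phi> (?x c) \<partial>lborel_upto n)
      = - ((- 1) ^ length layer_pos_part * half_integral bs n (- layer_normal) L \<phi>)"
  proof -
    have "(\<integral>c. peval q (?x c) * rays ?zs' \<phi> (?x c) \<partial>lborel_upto n)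
        = half_integral bs n (- layer_normal) (layer_poly (- layer_normal) ?b ?zs' q) \<phi>"
      using False neg by (intro hyperplane_integral_rays[OF basis n] bounded_supported_halfspace \<phi> b) auto
    also have "layer_poly (- layer_normal) ?b ?zs' q = (- 1) *\<^sub>R layer_poly layer_normal ?b ?zs' q"
      using nz by (intro layer_poly_uminus_normal) auto
    \<comment> \<open>Reordered because \<open>layer_poly_uminus_vectors\<close> expects the negated
      vectors at the end.\<close>
    also have "layer_poly layer_normal ?b ?zs' q = layer_poly layer_normal ?b (layer_neg_part @ map uminus layer_pos_part) q"
      using nz by (intro layer_poly_mset b) auto
    also have "\<dots> = ((- 1) ^ length layer_pos_part) *\<^sub>R layer_poly layer_normal ?b (layer_neg_part @ layer_pos_part) q"
      using nz by (intro layer_poly_uminus_vectors) auto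
    also have "layer_poly layer_normal ?b (layer_neg_part @ layer_pos_part) q = L"
      unfolding L_def using nz by (intro layer_poly_mset b) auto
    finally show ?thesis by (simp only: half)
  qed
  have "(\<integral>c. peval q (?x c) * signed_rays layer_pos_part layer_neg_part \<phi> (?x c) \<partial>lborel_upto n)
      = (\<integral>c. (- 1) ^ length layer_neg_part * (peval q (?x c) * rays ?zs \<phi> (?x c))
        - (- 1) ^ length layer_pos_part * (peval q (?x c) * rays ?zs' \<phi> (?x c)) \<partial>lborel_upto n)"
    by (rule Bochner_Integration.integral_cong[OF refl]) (simp add: signed_rays_def algebra_simps)
  also have "\<dots> = (- 1) ^ length layer_neg_part * (\<integral>c. peval q (?x c) * rays ?zs \<phi> (?x c) \<partial>lborel_upto n)
      - (- 1) ^ length layer_pos_part * (\<integral>c. peval q (?x c) * rays ?zs' \<phi> (?x c) \<partial>lborel_upto n)"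
    using pos neg int[of layer_normal ?zs] int[of "- layer_normal" ?zs']
    by (subst Bochner_Integration.integral_diff) (auto intro!: integrable_mult_right)
  also have "\<dots> = half_integral bs n layer_normal L \<phi> + half_integral bs n (- layer_normal) L \<phi>"
    unfolding plus minus by (simp add: mult.assoc[symmetric] power_mult_distrib[symmetric])
  also have "\<dots> = (\<integral>c. peval L (?y c) * \<phi> (?y c) \<partial>lborel_upto (Suc n))"
  proof -
    let ?f = "\<lambda>a' x. indicator {0..} (a' \<bullet> x) * (peval L x * \<phi> x)"
    let ?g = "\<lambda>x. indicator {0} (layer_normal \<bullet> x) * (peval L x * \<phi> x)"
    have f: "bounded_supported (?f a')" for a'
      using \<phi> by (intro bounded_supported_halfspace_poly bounded_supported_halfspace)
    have full: "bounded_supported (\<lambda>x. peval L x * \<phi> x)"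
      \<comment> \<open>With normal 0 the half-space is the whole space.\<close>
      using f[of 0] by simp
    \<comment> \<open>Both closed half-spaces contain the hyperplane, so it is counted twice; the
      excess \<open>?g\<close> integrates to 0 because the hyperplane is a null set.\<close>
    have split: "?f layer_normal x + ?f (- layer_normal) x = peval L x * \<phi> x + ?g x" for x
      by (auto simp: indicator_def)
    have g: "bounded_supported ?g"
    proof -
      have "?g x = 1 * ?f layer_normal x - (- 1) * (1 * ?f (- layer_normal) x - 1 * (peval L x * \<phi> x))" for x
        by (auto simp: indicator_def)
      then have eq: "?g = (\<lambda>x. 1 * ?f layer_normal x - (- 1) * (1 * ?f (- layer_normal) x - 1 * (peval L x * \<phi> x)))"
        by (rule ext)
      show ?thesis
        unfolding eq by (rule bounded_supported_diff_scaled[OF f bounded_supported_diff_scaled[OF f full]])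
    qed
    have "half_integral bs n layer_normal L \<phi> + half_integral bs n (- layer_normal) L \<phi>
        = (\<integral>c. ?f layer_normal (?y c) + ?f (- layer_normal) (?y c) \<partial>lborel_upto (Suc n))"
      unfolding half_integral_def
      by (rule Bochner_Integration.integral_add[symmetric]) (rule integrable_comb[OF basis n'(2) f])+
    also have "\<dots> = (\<integral>c. peval L (?y c) * \<phi> (?y c) + ?g (?y c) \<partial>lborel_upto (Suc n))"
      by (simp only: split)
    also have "\<dots> = (\<integral>c. peval L (?y c) * \<phi> (?y c) \<partial>lborel_upto (Suc n))
        + (\<integral>c. ?g (?y c) \<partial>lborel_upto (Suc n))"
      by (rule Bochner_Integration.integral_add)
        (rule integrable_comb[OF basis n'(2) full] integrable_comb[OF basis n'(2) g])+
    also have "(\<integral>c. ?g (?y c) \<partial>lborel_upto (Suc n)) = 0"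
      by (rule integral_comb_hyperplane[OF basis n g]) simp
    finally show ?thesis by simp
  qed
  also have "L = layer_poly layer_normal ?b (filter (\<lambda>u. u \<in> layer bs n) Z) q"
    unfolding L_def using nz by (intro layer_poly_mset b mset_pos_neg_part)
  finally show ?thesis .
qed

end

lemma bounded_supported_peval_mult:
  assumes "bounded_supported \<phi>"
  shows "bounded_supported (\<lambda>x. peval p x * \<phi> x)"
  using bounded_supported_halfspace_poly[OF bounded_supported_halfspace[OF assms, of 0], of p] by simp

text \<open>One layer at a time: by translation invariance of \<open>rays\<close>, convolving with
  the layer means integrating \<open>signed_rays\<close> over the lower subspace against the old
  density, and \<open>integral_signed_rays\<close> turns this into the new density one dimension
  higher.\<close>

lemma R_dist_partial:
  fixes bs Z :: "(real ^ 'r::finite) list"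
  assumes basis: "is_basis_list bs" and "n \<le> length bs"
  shows "represents_on
    (\<lambda>\<phi>. \<integral>c. peval (flag_poly bs Z n) (comb bs n c) * \<phi> (comb bs n c) \<partial>lborel_upto n)
    (foldl conv (spline []) (map (R_layer bs Z) [0..<n])) (span (set (take n bs)))"
  using assms(2)
proof (induction n)
  case 0
  have "(\<integral>c. peval (flag_poly bs Z 0) (comb bs 0 c) * \<phi> (comb bs 0 c) \<partial>lborel_upto 0) = \<phi> 0" for \<phi>
    by (simp add: comb_def PiM_empty lebesgue_integral_count_space_finite)
  then show ?case by (simp add: represents_on_def spline_Nil)
next
  case (Suc n)
  let ?M = "\<lambda>n \<phi>. \<integral>c. peval (flag_poly bs Z n) (comb bs n c) * \<phi> (comb bs n c) \<partial>lborel_upto n"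
  let ?S = "\<lambda>n. foldl conv (spline []) (map (R_layer bs Z) [0..<n])"
  let ?a = "coord bs n"
  let ?T = "\<lambda>\<phi>. signed_rays (pos_part bs Z n) (neg_part bs Z n) \<phi> 0"
  have n: "n < length bs" using Suc.prems by simp
  obtain e where e: "e > 0"
    and T: "represents_on ?T (R_layer bs Z n) {x. e * norm x \<le> \<bar>?a \<bullet> x\<bar>}"
    using R_layer_represented[OF basis n] by blast
  have S: "represents_on (?M n) (?S n) (span (set (take n bs)))"
    using Suc by simp
  \<comment> \<open>The normal vanishes on the subspace, so \<open>?a \<bullet> y\<close> equals
    \<open>?a \<bullet> (x + y)\<close>; this controls \<open>y\<close> in the double cone, and then
    \<open>x\<close> by the triangle inequality.\<close>
  have "add_proper (span (set (take n bs))) {x. e * norm x \<le> \<bar>?a \<bullet> x\<bar>}"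
  proof (rule add_properI)
    show "closed {x. e * norm x \<le> \<bar>?a \<bullet> x\<bar>}"
      by (intro closed_Collect_le continuous_intros)
    fix x y assume xy: "x \<in> span (set (take n bs))" "y \<in> {x. e * norm x \<le> \<bar>?a \<bullet> x\<bar>}"
    then have "?a \<bullet> x = 0" using n by (simp add: span_take_iff[OF basis])
    then have "\<bar>?a \<bullet> y\<bar> = \<bar>?a \<bullet> (x + y)\<bar>" by (simp add: inner_add_right)
    then have y: "norm y \<le> norm ?a / e * norm (x + y)"
      using xy by (intro norm_le_inner[OF e, of y "\<bar>?a \<bullet> y\<bar>"]) auto
    have "norm x \<le> norm (x + y) + norm y" by (metis add_diff_cancel norm_triangle_ineq4)
    then show "norm x \<le> (norm ?a / e + 1) * norm (x + y) \<and> norm y \<le> (norm ?a / e + 1) * norm (x + y)"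
      using y by (auto simp: algebra_simps intro: order_trans[OF y])
  qed (use e in \<open>auto intro: add_nonneg_nonneg\<close>)
  note conv = conv_represented[OF this S T slice_preserving_signed_rays[OF basis n]]
  have "?S (Suc n) \<phi> = ?M (Suc n) \<phi>" if \<phi>: "bounded_supported \<phi>" for \<phi>
  proof -
    have translate: "signed_rays P N (\<lambda>y. \<phi> (x + y)) 0 = signed_rays P N \<phi> x" for P N x
      by (simp add: signed_rays_def rays_translate)
    have "?S (Suc n) \<phi> = conv (?S n) (R_layer bs Z n) \<phi>" by simp
    also have "\<dots> = ?M n (signed_rays (pos_part bs Z n) (neg_part bs Z n) \<phi>)"
      unfolding conv[OF \<phi>] translate ..
    also have "\<dots> = ?M (Suc n) \<phi>"
      unfolding integral_signed_rays[OF basis n \<phi>] by simp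
    finally show ?thesis .
  qed
  moreover have "?M (Suc n) \<phi> = ?M (Suc n) \<psi>"
    if eq: "\<forall>x\<in>span (set (take (Suc n) bs)). \<phi> x = \<psi> x" for \<phi> \<psi>
  proof (rule Bochner_Integration.integral_cong[OF refl])
    fix c
    have "comb bs (Suc n) c \<in> span (set (take (Suc n) bs))"
      by (rule comb_in_span[OF basis Suc.prems])
    then show "peval (flag_poly bs Z (Suc n)) (comb bs (Suc n) c) * \<phi> (comb bs (Suc n) c)
      = peval (flag_poly bs Z (Suc n)) (comb bs (Suc n) c) * \<psi> (comb bs (Suc n) c)"
      using eq by simp
  qed
  ultimately show ?case
    unfolding represents_on_def by (intro conjI allI impI) simp_all
qed

section \<open>Linear change of variables\<close>

lemma integrable_bounded_supported:
  assumes "bounded_supported f"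
  shows "integrable lborel f"
proof -
  obtain R where R: "0 \<le> R" "\<And>x. \<bar>f x\<bar> \<le> R" "\<And>x. f x \<noteq> 0 \<Longrightarrow> norm x \<le> R"
    using bounded_supported_bounds[OF assms] by blast
  have [measurable]: "f \<in> borel_measurable borel" using assms by (rule bounded_supported_measurable)
  show ?thesis
  proof (rule integrable_bounded_finite_support)
    show "emeasure lborel (cball 0 R) < \<infinity>" by (rule emeasure_bounded_finite[OF bounded_cball])
    show "f x = 0" if "x \<notin> cball 0 R" for x using that R(3)[of x] by auto
  qed (use R in simp_all)
qed

lemma bounded_supported_matrix:
  fixes A :: "real ^ 'r::finite ^ 'r"
  assumes F: "bounded_supported F" and A: "det A \<noteq> 0"
  shows "bounded_supported (\<lambda>x. F (A *v x))"
proof -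
  obtain R where R: "0 \<le> R" "\<And>x. \<bar>F x\<bar> \<le> R" "\<And>x. F x \<noteq> 0 \<Longrightarrow> norm x \<le> R"
    using bounded_supported_bounds[OF F] by blast
  have [measurable]: "F \<in> borel_measurable borel" using F by (rule bounded_supported_measurable)
  have [measurable]: "(*v) A \<in> borel_measurable borel"
    by (intro borel_measurable_continuous_onI linear_continuous_on) (simp add: linear_linear)
  have "inj ((*v) A)"
    using A by (simp add: inj_matrix_vector_mult invertible_det_nz)
  then obtain B where B: "B > 0" "\<And>x. B * norm x \<le> norm (A *v x)"
    using linear_inj_bounded_below_pos[OF matrix_vector_mul_linear] by blast
  show ?thesis
  proof (rule bounded_supportedI)
    show "(\<lambda>x. F (A *v x)) \<in> borel_measurable borel" by measurable
    show "\<bar>F (A *v x)\<bar> \<le> R" for x by (rule R)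
    show "norm x \<le> R / B" if "F (A *v x) \<noteq> 0" for x
    proof -
      have "B * norm x \<le> R" using B(2)[of x] R(3)[OF that] by linarith
      then show ?thesis using B(1) by (simp add: field_simps)
    qed
  qed
qed

lemma prod_Basis_vec: "(\<Prod>b\<in>(Basis :: (real ^ 'r::finite) set). g b) = (\<Prod>i\<in>UNIV. g (axis i 1))"
proof -
  have B: "(Basis :: (real ^ 'r) set) = (\<lambda>i. axis i 1) ` UNIV" by (auto simp: Basis_vec_def)
  have inj: "inj (\<lambda>i::'r. axis i (1::real))" by (auto simp: inj_def axis_eq_axis)
  show ?thesis unfolding B prod.reindex[OF inj] o_def ..
qed

section \<open>Lebesgue measure as a product along the axes, in any order\<close>

context
  fixes js :: "'r::finite list"
  assumes js: "distinct js" "set js = UNIV"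
begin

abbreviation "axes \<equiv> map (\<lambda>j. axis j 1 :: real ^ 'r) js"

lemma length_axes: "length js = CARD('r)"
  using js distinct_card by metis

lemma bij_nth_js: "bij_betw ((!) js) {..<length js} UNIV"
  using bij_betw_nth[OF js(1) refl refl] js(2) by simp

lemma is_basis_list_axes: "is_basis_list axes"
proof -
  have "set axes = (Basis :: (real ^ 'r) set)" using js by (auto simp: Basis_vec_def)
  moreover have "distinct axes" using js by (auto simp: distinct_map inj_on_def axis_eq_axis)
  ultimately show ?thesis by (simp add: is_basis_list_def independent_Basis)
qed

lemma comb_axes_nth: "j < length js \<Longrightarrow> comb axes (length js) c $ (js ! j) = c j"
proof -
  assume j: "j < length js"
  have "comb axes (length js) c $ (js ! j) = (\<Sum>i<length js. if i = j then c i else 0)"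
    unfolding comb_def sum_component using j js(1)
    by (intro sum.cong) (auto simp: axis_def nth_eq_iff_index_eq)
  then show ?thesis using j by (simp add: sum.delta)
qed

lemma lborel_eq_distr_axes:
  "distr (lborel_upto (length js)) borel (comb axes (length js)) = lborel"
proof (rule lborel_eqI[symmetric])
  fix l u :: "real ^ 'r" assume le: "\<And>b. b \<in> Basis \<Longrightarrow> l \<bullet> b \<le> u \<bullet> b"
  have le': "l $ i \<le> u $ i" for i using le[of "axis i 1"] by (simp add: inner_axis axis_in_Basis_iff)
  let ?I = "\<lambda>j. {l $ (js ! j)<..<u $ (js ! j)}"
  have "comb axes (length js) -` box l u \<inter> space (lborel_upto (length js)) = (\<Pi>\<^sub>E j\<in>{..<length js}. ?I j)"
  proof (intro set_eqI iffI)
    fix c assume c: "c \<in> comb axes (length js) -` box l u \<inter> space (lborel_upto (length js))"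
    then have "l $ i < comb axes (length js) c $ i \<and> comb axes (length js) c $ i < u $ i" for i
      by (auto simp: mem_box_cart)
    then have "c j \<in> ?I j" if "j < length js" for j using comb_axes_nth[OF that, of c] by (metis greaterThanLessThan_iff)
    then show "c \<in> (\<Pi>\<^sub>E j\<in>{..<length js}. ?I j)"
      using c by (auto simp: space_PiM PiE_def)
  next
    fix c assume c: "c \<in> (\<Pi>\<^sub>E j\<in>{..<length js}. ?I j)"
    have "l $ i < comb axes (length js) c $ i \<and> comb axes (length js) c $ i < u $ i" for i
    proof -
      obtain j where "j < length js" "i = js ! j" using js(2) by (metis UNIV_I in_set_conv_nth)
      then show ?thesis using c comb_axes_nth[of j c] by (auto simp: PiE_def Pi_def)
    qed
    then show "c \<in> comb axes (length js) -` box l u \<inter> space (lborel_upto (length js))"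
      using c by (auto simp: mem_box_cart space_PiM PiE_def)
  qed
  then have "emeasure (distr (lborel_upto (length js)) borel (comb axes (length js))) (box l u)
      = emeasure (lborel_upto (length js)) (\<Pi>\<^sub>E j\<in>{..<length js}. ?I j)"
    by (subst emeasure_distr) auto
  also have "\<dots> = (\<Prod>j<length js. emeasure lborel (?I j))"
    by (rule lborel_product.emeasure_PiM) auto
  also have "\<dots> = (\<Prod>j<length js. ennreal ((u - l) $ (js ! j)))"
    using le' by (intro prod.cong) auto
  also have "\<dots> = (\<Prod>i\<in>UNIV. ennreal ((u - l) $ i))"
    by (rule prod.reindex_bij_betw[OF bij_nth_js])
  also have "\<dots> = ennreal (\<Prod>b\<in>Basis. (u - l) \<bullet> b)"
    using le' by (subst prod_ennreal) (auto simp: prod_Basis_vec inner_axis)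
  finally show "emeasure (distr (lborel_upto (length js)) borel (comb axes (length js))) (box l u)
      = ennreal (\<Prod>b\<in>Basis. (u - l) \<bullet> b)" .
qed simp

lemma integral_comb_axes:
  fixes F :: "real ^ 'r \<Rightarrow> real"
  assumes "F \<in> borel_measurable borel"
  shows "(\<integral>c. F (comb axes (length js) c) \<partial>lborel_upto (length js)) = (\<integral>x. F x \<partial>lborel)"
  using integral_distr[OF borel_measurable_comb[of axes "length js"] assms]
  by (simp add: lborel_eq_distr_axes)

end

lemma matrix_mult_comb:
  fixes A :: "real ^ 'r::finite ^ 'r"
  shows "n \<le> length bs \<Longrightarrow> A *v comb bs n c = comb (map ((*v) A) bs) n c"
  by (simp add: comb_def linear_sum[OF matrix_vector_mul_linear] linear_scale[OF matrix_vector_mul_linear])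

text \<open>Reduction to elementary matrices. A zero row contradicts the nonzero determinant; a
  diagonal matrix scales Lebesgue measure; a transposition only permutes the order of the axes; a
  shear becomes a translation in the innermost variable.\<close>

lemma integral_linear_change:
  fixes A :: "real ^ 'r::finite ^ 'r"
  assumes "det A \<noteq> 0" "bounded_supported F"
  shows "\<bar>det A\<bar> * (\<integral>x. F (A *v x) \<partial>lborel) = (\<integral>x. F x \<partial>lborel)"
proof -
  have "det A \<noteq> 0 \<longrightarrow> (\<forall>F. bounded_supported F \<longrightarrow>
      \<bar>det A\<bar> * (\<integral>x. F (A *v x) \<partial>lborel) = (\<integral>x. F x \<partial>lborel))" (is "?P A")
  proof (rule induct_matrix_elementary_alt[where P = ?P])
    fix A B :: "real ^ 'r ^ 'r"
    assume A: "?P A" and B: "?P B"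
    show "?P (A ** B)"
    proof (intro impI allI)
      fix F :: "real ^ 'r \<Rightarrow> real"
      assume det: "det (A ** B) \<noteq> 0" and F: "bounded_supported F"
      then have nz: "det A \<noteq> 0" "det B \<noteq> 0" by (auto simp: det_mul)
      have "\<bar>det B\<bar> * (\<integral>x. F (A *v (B *v x)) \<partial>lborel) = (\<integral>x. F (A *v x) \<partial>lborel)"
        by (rule B[rule_format, OF nz(2) bounded_supported_matrix[OF F nz(1)]])
      moreover have "\<bar>det A\<bar> * (\<integral>x. F (A *v x) \<partial>lborel) = (\<integral>x. F x \<partial>lborel)"
        by (rule A[rule_format, OF nz(1) F])
      ultimately show "\<bar>det (A ** B)\<bar> * (\<integral>x. F ((A ** B) *v x) \<partial>lborel) = (\<integral>x. F x \<partial>lborel)"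
        by (simp add: det_mul abs_mult matrix_vector_mul_assoc[symmetric] mult.assoc)
    qed
  next
    fix A :: "real ^ 'r ^ 'r" and i
    assume "row i A = 0"
    then show "?P A" using det_zero_row by auto
  next
    fix A :: "real ^ 'r ^ 'r"
    assume diag: "\<And>i j. i \<noteq> j \<Longrightarrow> A $ i $ j = 0"
    show "?P A"
    proof (intro impI allI)
      fix F :: "real ^ 'r \<Rightarrow> real"
      assume det: "det A \<noteq> 0" and F: "bounded_supported F"
      have [measurable]: "F \<in> borel_measurable borel" using F by (rule bounded_supported_measurable)
      have detA: "det A = (\<Prod>i\<in>UNIV. A $ i $ i)" by (rule det_diagonal) (rule diag)
      \<comment> \<open>The diagonal entries as a function on \<open>Basis\<close>, the form in
        which scaling of \<open>lborel\<close> is available.\<close>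
      define c where "c b = b \<bullet> (A *v b)" for b
      have c: "c (axis i 1) = A $ i $ i" for i
        by (simp add: c_def matrix_vector_mult_basis inner_axis' column_def)
      have cnz: "c b \<noteq> 0" if "b \<in> Basis" for b
        using that det c by (auto simp: Basis_vec_def detA)
      have T: "0 + (\<Sum>b\<in>Basis. (c b * (x \<bullet> b)) *\<^sub>R b) = A *v x" for x
      proof -
        have "(\<Sum>b\<in>Basis. (c b * (x \<bullet> b)) *\<^sub>R b) = (\<Sum>b\<in>Basis. (x \<bullet> b) *\<^sub>R (A *v b))"
        proof (rule sum.cong[OF refl])
          fix b :: "real ^ 'r" assume "b \<in> Basis"
          then obtain i where b: "b = axis i 1" by (auto simp: Basis_vec_def)
          have "A *v b = c b *\<^sub>R b"
            unfolding b c matrix_vector_mult_basis column_def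
            using diag by (auto simp: vec_eq_iff axis_def)
          then show "(c b * (x \<bullet> b)) *\<^sub>R b = (x \<bullet> b) *\<^sub>R (A *v b)" by (simp add: mult.commute)
        qed
        also have "\<dots> = A *v (\<Sum>b\<in>Basis. (x \<bullet> b) *\<^sub>R b)"
          by (simp add: linear_sum[OF matrix_vector_mul_linear] linear_scale[OF matrix_vector_mul_linear])
        finally show ?thesis by (simp add: euclidean_representation)
      qed
      have [measurable]: "(*v) A \<in> borel_measurable borel"
        by (intro borel_measurable_continuous_onI linear_continuous_on) (simp add: linear_linear)
      have "lborel = density (distr lborel borel ((*v) A)) (\<lambda>_. ennreal (\<Prod>b\<in>Basis. \<bar>c b\<bar>))"
        using lborel_affine_euclidean[of c 0, OF cnz] unfolding T by simp
      then have "(\<integral>x. F x \<partial>lborel)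
          = (\<integral>x. F x \<partial>density (distr lborel borel ((*v) A)) (\<lambda>_. ennreal (\<Prod>b\<in>Basis. \<bar>c b\<bar>)))"
        by (rule arg_cong)
      also have "\<dots> = (\<integral>x. (\<Prod>b\<in>Basis. \<bar>c b\<bar>) *\<^sub>R F x \<partial>distr lborel borel ((*v) A))"
        by (rule integral_density) (auto intro!: AE_I2 prod_nonneg)
      also have "\<dots> = (\<integral>x. (\<Prod>b\<in>Basis. \<bar>c b\<bar>) *\<^sub>R F (A *v x) \<partial>lborel)"
        by (rule integral_distr) measurable
      also have "(\<Prod>b\<in>Basis. \<bar>c b\<bar>) = \<bar>det A\<bar>"
        by (simp add: prod_Basis_vec c detA abs_prod)
      finally show "\<bar>det A\<bar> * (\<integral>x. F (A *v x) \<partial>lborel) = (\<integral>x. F x \<partial>lborel)" by simp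
    qed
  next
    fix m n :: 'r assume "m \<noteq> n"
    let ?t = "Transposition.transpose m n"
    let ?A = "(\<chi> i j. mat 1 $ i $ ?t j) :: real ^ 'r ^ 'r"
    have Ax: "?A *v axis j 1 = axis (?t j) 1" for j
      unfolding matrix_vector_mult_basis column_def by (auto simp: vec_eq_iff mat_def axis_def)
    have det: "\<bar>det ?A\<bar> = 1"
      using det_permute_columns[of ?t "mat 1 :: real ^ 'r ^ 'r"] permutes_swap_id[of m UNIV n]
      by (simp add: sign_def)
    obtain js where js: "distinct js" "set js = (UNIV :: 'r set)"
      using finite_distinct_list[OF finite_class.finite_UNIV] by blast
    have js': "distinct (map ?t js)" "set (map ?t js) = UNIV"
      using js by (simp_all add: distinct_map)
    show "?P ?A"
    proof (intro impI allI)
      fix F :: "real ^ 'r \<Rightarrow> real"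
      assume F: "bounded_supported F" and "det ?A \<noteq> 0"
      then have F': "bounded_supported (\<lambda>x. F (?A *v x))" by (intro bounded_supported_matrix)
      have "(\<integral>x. F (?A *v x) \<partial>lborel)
          = (\<integral>c. F (?A *v comb (map (\<lambda>j. axis j 1) js) (length js) c) \<partial>lborel_upto (length js))"
        by (rule integral_comb_axes[OF js bounded_supported_measurable[OF F'], symmetric])
      also have "\<dots> = (\<integral>c. F (comb (map (\<lambda>j. axis j 1) (map ?t js)) (length (map ?t js)) c)
          \<partial>lborel_upto (length (map ?t js)))"
        by (simp add: matrix_mult_comb o_def Ax)
      also have "\<dots> = (\<integral>x. F x \<partial>lborel)"
        by (rule integral_comb_axes[OF js' bounded_supported_measurable[OF F]])
      finally show "\<bar>det ?A\<bar> * (\<integral>x. F (?A *v x) \<partial>lborel) = (\<integral>x. F x \<partial>lborel)"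
        unfolding det by simp
    qed
  next
    fix m n :: 'r assume mn: "m \<noteq> n"
    let ?A = "(\<chi> i j. of_bool (i = m \<and> j = n \<or> i = j)) :: real ^ 'r ^ 'r"
    have Ax: "?A *v x = x + x $ n *\<^sub>R axis m 1" for x
    proof -
      have "(\<Sum>j\<in>UNIV. of_bool (i = m \<and> j = n \<or> i = j) * x $ j)
          = x $ i + (if i = m then x $ n else 0)" for i
      proof -
        have "of_bool (i = m \<and> j = n \<or> i = j) * x $ j
            = (if j = i then x $ j else 0) + (if j = n then (if i = m then x $ j else 0) else 0)" for j
          using mn by auto
        then show ?thesis by (simp add: sum.distrib)
      qed
      then show ?thesis by (auto simp: vec_eq_iff matrix_vector_mult_def axis_def)
    qed
    have det: "det ?A = 1"
    proof -
      have "?A = (\<chi> k. if k = m then row m (mat 1) + 1 *s row n (mat 1) else row k (mat 1))"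
        using mn by (auto simp: vec_eq_iff row_def mat_def)
      then show ?thesis using det_row_operation[OF mn, of "mat 1 :: real ^ 'r ^ 'r" 1] by simp
    qed
    \<comment> \<open>The axis \<open>m\<close> is put last so that it becomes the innermost
      integration variable. There the shear adds \<open>?y $ n\<close>, which is constant because
      \<open>n\<close> differs from \<open>m\<close>.\<close>
    obtain js' where js': "distinct js'" "set js' = UNIV - {m}"
      using finite_distinct_list[of "UNIV - {m}"] by auto
    define js where "js = js' @ [m]"
    have js: "distinct js" "set js = UNIV" using js' by (auto simp: js_def)
    let ?k = "length js'" and ?es = "map (\<lambda>j. axis j 1 :: real ^ 'r) js"
    have k: "?k < length ?es" "length js = Suc ?k" "?es ! ?k = axis m 1"
      by (auto simp: js_def nth_append)
    show "?P ?A"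
    proof (intro impI allI)
      fix F :: "real ^ 'r \<Rightarrow> real"
      assume F: "bounded_supported F" and "det ?A \<noteq> 0"
      then have F': "bounded_supported (\<lambda>x. F (?A *v x))" by (intro bounded_supported_matrix)
      have "(\<integral>x. F (?A *v x) \<partial>lborel)
          = (\<integral>c. F (?A *v comb ?es (Suc ?k) c) \<partial>lborel_upto (Suc ?k))"
        using integral_comb_axes[OF js bounded_supported_measurable[OF F']] by (simp only: k)
      also have "\<dots> = (\<integral>c. (\<integral>s. F (?A *v (comb ?es ?k c + s *\<^sub>R axis m 1)) \<partial>lborel) \<partial>lborel_upto ?k)"
        using integral_comb_Suc[OF is_basis_list_axes[OF js] k(1) F'] by (simp only: k)
      also have "\<dots> = (\<integral>c. (\<integral>s. F (comb ?es ?k c + s *\<^sub>R axis m 1) \<partial>lborel) \<partial>lborel_upto ?k)"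
      proof (rule Bochner_Integration.integral_cong[OF refl])
        fix c
        let ?y = "comb ?es ?k c"
        have "?A *v (?y + s *\<^sub>R axis m 1) = ?y + (?y $ n + 1 * s) *\<^sub>R axis m 1" for s
          unfolding Ax using mn by (simp add: axis_def algebra_simps)
        then show "(\<integral>s. F (?A *v (?y + s *\<^sub>R axis m 1)) \<partial>lborel) = (\<integral>s. F (?y + s *\<^sub>R axis m 1) \<partial>lborel)"
          using lborel_integral_real_affine[of 1 "\<lambda>s. F (?y + s *\<^sub>R axis m 1)" "?y $ n"] by simp
      qed
      also have "\<dots> = (\<integral>c. F (comb ?es (Suc ?k) c) \<partial>lborel_upto (Suc ?k))"
        using integral_comb_Suc[OF is_basis_list_axes[OF js] k(1) F] by (simp only: k)
      also have "\<dots> = (\<integral>x. F x \<partial>lborel)"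
        using integral_comb_axes[OF js bounded_supported_measurable[OF F]] by (simp only: k)
      finally show "\<bar>det ?A\<bar> * (\<integral>x. F (?A *v x) \<partial>lborel) = (\<integral>x. F x \<partial>lborel)"
        unfolding det by simp
    qed
  qed
  then show ?thesis using assms by blast
qed

lemma card_less_nth_sorted_list:
  fixes js :: "'r::{finite,linorder} list"
  defines "js \<equiv> sorted_list_of_set UNIV"
  assumes i: "i < length js"
  shows "card {k. k < js ! i} = i"
proof -
  have js: "sorted_wrt (<) js" "distinct js" "set js = UNIV"
    by (auto simp: js_def strict_sorted_list_of_set)
  have "{k. k < js ! i} = set (take i js)"
  proof (intro set_eqI iffI)
    fix k assume "k \<in> {k. k < js ! i}"
    then have lt: "k < js ! i" by simp
    obtain j where j: "j < length js" "k = js ! j" using js(3) by (metis UNIV_I in_set_conv_nth)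
    have "\<not> i < j" "j \<noteq> i" using lt j sorted_wrt_nth_less[OF js(1), of i j] by auto
    then have "j < i" by simp
    then show "k \<in> set (take i js)" using j i by (auto simp: in_set_conv_nth intro!: exI[of _ j])
  next
    fix k assume "k \<in> set (take i js)"
    then obtain j where "j < i" "k = js ! j" by (auto simp: in_set_conv_nth)
    then show "k \<in> {k. k < js ! i}" using sorted_wrt_nth_less[OF js(1), of j i] i by simp
  qed
  then show ?thesis using i js(2) by (simp add: distinct_card distinct_take)
qed

lemma
  fixes bs :: "(real ^ 'r::{finite,linorder}) list"
  assumes basis: "is_basis_list bs"
  shows basis_det_nz: "basis_det bs \<noteq> 0"
    and integral_comb_basis: "bounded_supported F \<Longrightarrow>
      basis_det bs * (\<integral>c. F (comb bs (length bs) c) \<partial>lborel_upto (length bs)) = (\<integral>x. F x \<partial>lborel)"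
proof -
  define js :: "'r list" where "js = sorted_list_of_set UNIV"
  let ?es = "map (\<lambda>j. axis j 1 :: (real, 'r) vec) js"
  let ?A = "col_matrix bs"
  have js: "distinct js" "set js = UNIV" by (auto simp: js_def)
  have len: "length js = length bs"
    using length_axes[OF js] basis_list_length[OF basis] by simp
  have "map ((*v) ?A) ?es = bs"
  proof (rule nth_equalityI)
    fix i assume i: "i < length (map ((*v) ?A) ?es)"
    have "?A *v axis (js ! i) 1 = bs ! card {k. k < js ! i}"
      by (simp add: matrix_vector_mult_basis column_def col_matrix_def)
    also have "card {k. k < js ! i} = i"
      using i unfolding js_def by (intro card_less_nth_sorted_list) simp
    finally show "map ((*v) ?A) ?es ! i = bs ! i" using i by simp
  qed (simp add: len)
  then have comb: "?A *v comb ?es (length js) c = comb bs (length bs) c" for c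
    by (simp add: matrix_mult_comb len)
  have "surj ((*v) ?A)"
  proof (rule surjI)
    fix x
    have "x = comb bs (length bs) (\<lambda>j. coord bs j \<bullet> x)"
      by (rule span_take_comb[OF basis]) (simp_all add: basis_span[OF basis])
    then show "?A *v comb ?es (length js) (\<lambda>j. coord bs j \<bullet> x) = x" by (simp add: comb)
  qed
  then have det: "det ?A \<noteq> 0"
    by (simp add: matrix_right_invertible_surjective[symmetric] invertible_right_inverse[symmetric]
        invertible_det_nz)
  then show "basis_det bs \<noteq> 0" by (simp add: basis_det_def)
  assume F: "bounded_supported F"
  have "(\<integral>c. F (comb bs (length bs) c) \<partial>lborel_upto (length bs)) = (\<integral>x. F (?A *v x) \<partial>lborel)"
    using integral_comb_axes[OF js bounded_supported_measurable[OF bounded_supported_matrix[OF F det]]]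
    unfolding comb by (simp only: len)
  then show "basis_det bs * (\<integral>c. F (comb bs (length bs) c) \<partial>lborel_upto (length bs)) = (\<integral>x. F x \<partial>lborel)"
    using integral_linear_change[OF det F] by (simp add: basis_det_def)
qed

section \<open>The polynomial density\<close>

text \<open>At a point where \<open>h\<close> is nonzero, a nonnegative bump supported where
  \<open>h\<close> keeps its sign would give a nonzero integral.\<close>

lemma poly_eq_0_if_orthogonal:
  fixes h :: "'r::finite symV"
  assumes zero: "\<And>\<phi>. test_fun \<phi> \<Longrightarrow> (\<integral>x. peval h x * \<phi> x \<partial>lborel) = 0"
  shows "h = 0"
proof (rule peval_eq_0_imp)
  fix x0
  \<comment> \<open>The factor \<open>s\<close> treats both signs at once; it is instantiated with 1
    and \<open>- 1\<close>.\<close>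
  have no_pos: "\<not> s * peval h x0 > 0" for s
  proof
    assume pos: "s * peval h x0 > 0"
    have "open {x. s * peval h x > 0}"
      by (intro open_Collect_less continuous_intros continuous_peval[of _ "\<lambda>x. x"])
    then obtain e where e: "e > 0" "ball x0 e \<subseteq> {x. s * peval h x > 0}"
      using pos by (auto simp: open_contains_ball)
    obtain \<phi> where \<phi>: "test_fun \<phi>" "\<And>x. \<phi> x \<ge> 0" "\<And>x. \<phi> x > 0 \<longleftrightarrow> dist x x0 < e"
      using test_fun_peak_exists[OF e(1), of x0] by blast
    let ?f = "\<lambda>x. s * (peval h x * \<phi> x)"
    have out: "\<phi> x = 0" if "x \<notin> ball x0 e" for x
      using \<phi>(2,3)[of x] that by (auto simp: dist_commute)
    have nonneg: "?f x \<ge> 0" and fpos: "x \<in> ball x0 e \<Longrightarrow> ?f x > 0" for x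
    proof -
      show "?f x > 0" if "x \<in> ball x0 e" for x
      proof -
        have "s * peval h x > 0" "\<phi> x > 0" using e(2) \<phi>(3)[of x] that by (auto simp: dist_commute)
        then have "(s * peval h x) * \<phi> x > 0" by (rule mult_pos_pos)
        then show ?thesis by (simp add: mult.assoc)
      qed
      then show "?f x \<ge> 0" using out[of x] by (cases "x \<in> ball x0 e") (auto intro: less_imp_le)
    qed
    have int: "integrable lborel ?f"
      using \<phi>(1) by (intro integrable_mult_right integrable_bounded_supported
          bounded_supported_peval_mult test_fun_bounded_supported)
    have "(\<integral>x. ?f x \<partial>lborel) = 0" using zero[OF \<phi>(1)] by simp
    then have "AE x in lborel. ?f x = 0"
      using integral_nonneg_eq_0_iff_AE[OF int] nonneg by simp
    then have "AE x in lborel. x \<notin> ball x0 e"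
      by (rule eventually_mono) (use fpos in force)
    then have "emeasure lborel (ball x0 e) = 0"
      by (subst (asm) AE_iff_measurable[OF _ refl]) (auto simp: ball_def)
    then show False using content_ball_pos[OF e(1), of x0] by (simp add: measure_def)
  qed
  from no_pos[of 1] no_pos[of "- 1"] show "peval h x0 = 0" by simp
qed

text \<open>Passing from coordinates to Lebesgue measure divides the density by
  \<open>basis_det bs\<close>, and the factor in \<open>dual_poly\<close> restores it. The definite
  description in \<open>R_poly\<close> is resolved because a polynomial density is determined by
  test functions.\<close>

lemma dual_poly_eq_flag_poly:
  fixes X :: "(real ^ 'r::{finite,linorder}) list"
  assumes D: "D \<in> bases X"
  shows "dual_poly X D = flag_poly (nths X D) (nths X ({..<length X} - ext_active X D)) (length (nths X D))"
proof -
  define bs where "bs = nths X D"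
  define Z where "Z = nths X ({..<length X} - ext_active X D)"
  define q where "q = flag_poly bs Z (length bs)"
  define f where "f = (1 / basis_det bs) *\<^sub>R q"
  have basis: "is_basis_list bs" using D by (simp add: bases_def bs_def)
  have f: "R_dist bs Z \<phi> = (\<integral>x. peval f x * \<phi> x \<partial>lborel)" if "test_fun \<phi>" for \<phi>
  proof -
    have \<phi>: "bounded_supported \<phi>" using that by (rule test_fun_bounded_supported)
    have "R_dist bs Z \<phi> = (\<integral>c. peval q (comb bs (length bs) c) * \<phi> (comb bs (length bs) c) \<partial>lborel_upto (length bs))"
      unfolding R_dist_def q_def by (rule represents_on_eq[OF R_dist_partial[OF basis order_refl] \<phi>])
    also have "\<dots> = (1 / basis_det bs) * (\<integral>x. peval q x * \<phi> x \<partial>lborel)"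
      using integral_comb_basis[OF basis bounded_supported_peval_mult[OF \<phi>, of q]] basis_det_nz[OF basis]
      by (simp add: field_simps)
    also have "\<dots> = (\<integral>x. peval f x * \<phi> x \<partial>lborel)"
      by (simp add: f_def peval_scaleR mult.assoc)
    finally show ?thesis .
  qed
  have "R_poly bs Z = f"
    unfolding R_poly_def
  proof (rule the_equality)
    show "\<forall>\<phi>. test_fun \<phi> \<longrightarrow> R_dist bs Z \<phi> = (\<integral>x. peval f x * \<phi> x \<partial>lborel)" using f by blast
    fix g assume g: "\<forall>\<phi>. test_fun \<phi> \<longrightarrow> R_dist bs Z \<phi> = (\<integral>x. peval g x * \<phi> x \<partial>lborel)"
    have "g - f = 0"
    proof (rule poly_eq_0_if_orthogonal)
      fix \<phi> :: "(real, 'r) vec \<Rightarrow> real" assume \<phi>: "test_fun \<phi>"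
      then have int: "integrable lborel (\<lambda>x. peval p x * \<phi> x)" for p
        by (intro integrable_bounded_supported bounded_supported_peval_mult test_fun_bounded_supported)
      have "(\<integral>x. peval (g - f) x * \<phi> x \<partial>lborel)
          = (\<integral>x. peval g x * \<phi> x \<partial>lborel) - (\<integral>x. peval f x * \<phi> x \<partial>lborel)"
        unfolding peval_diff left_diff_distrib by (rule Bochner_Integration.integral_diff[OF int int])
      then show "(\<integral>x. peval (g - f) x * \<phi> x \<partial>lborel) = 0" using f[OF \<phi>] g \<phi> by simp
    qed
    then show "g = f" by simp
  qed
  then have "dual_poly X D = basis_det bs *\<^sub>R f"
    by (simp add: dual_poly_def bs_def Z_def)
  also have "\<dots> = q" using basis_det_nz[OF basis] by (simp add: f_def)
  finally show ?thesis by (simp add: q_def bs_def Z_def)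
qed

theorem theorem4p2:
  fixes X :: "(real ^ 'r::{finite,linorder}) list"
  assumes "span (set X) = UNIV"
  shows "independent (dual_poly X ` bases X) \<and> span (dual_poly X ` bases X) = DM_space X
    \<and> independent (Q_poly X ` bases X) \<and> span (Q_poly X ` bases X) = P_space X
    \<and> (\<forall>B\<in>bases X. \<forall>D\<in>bases X.
          pairing (Q_poly X B) (dual_poly X D) = (if B = D then 1 else 0))"
  using assms dual_poly_eq_flag_poly by (rule dual_bases_from_flag_polys)

end
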